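(* Let $1<p<\infty$ and $-\frac12\mathbb 1<\tau<p\kappa+\frac{p-1}2\mathbb 1$. There is a constant $c$ such that for every sequence $\{f_j\}_{j\ge1}$ of functions on $S^d$, $$\Big\|\Big(\sum_{j=1}^\infty(\mathcal M_\kappa f_j)^2\Big)^{1/2}\Big\|_{\tau,p}\le c\Big\|\Big(\sum_{j=1}^\infty|f_j|^2\Big)^{1/2}\Big\|_{\tau,p}.$$
   Context: $S^d$ is the unit sphere in $\mathbb R^{d+1}$ with surface measure $d\omega$; $\kappa=(\kappa_1,\dots,\kappa_{d+1})$, $\kappa_i\ge0$. Vector inequalities are componentwise, $\mathbb 1=(1,\dots,1)$. For $\tau>-\frac12\mathbb 1$, $h_\tau(x)=\prod_j|x_j|^{\tau_j}$ and $\|f\|_{\tau,p}=(\int_{S^d}|f|^ph_\tau^2d\omega)^{1/p}$. $V_\kappa f(x)=c_\kappa\int_{[-1,1]^{d+1}}f(x_1t_1,\dots,x_{d+1}t_{d+1})\prod_i(1+t_i)(1-t_i^2)^{\kappa_i-1}dt$ with $V_\kappa1=1$ (factors with $\kappa_i=0$ via the limit $\frac12[g(1)+g(-1)]$). With $B(x,\theta)=\{y\in\mathbb R^{d+1}:\|y\|\le1,\langle x,y\rangle\ge\cos\theta\}$, $$\mathcal M_\kappa f(x)=\sup_{0<\theta\le\pi}\frac{\int_{S^d}|f(y)|V_\kappa[\chi_{B(x,\theta)}](y)h_\kappa^2(y)d\omega(y)}{\int_{S^d}V_\kappa[\chi_{B(x,\theta)}](y)h_\kappa^2(y)d\omega(y)}.$$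 *)

theory Defs
  imports "HOL-Analysis.Analysis" "HOL-Probability.Probability"
begin

definition enn_powr :: "ennreal \<Rightarrow> real \<Rightarrow> ennreal" where
  "enn_powr x a = (if x = \<infinity> then \<infinity> else ennreal (enn2real x powr a))"

text \<open>Surface measure on the unit sphere S^d of R^(d+1), d+1 = CARD('n),
  defined through polar coordinates: omega(A) = (d+1) * vol{r x. 0 < r <= 1, x in A}.\<close>
definition sph_measure :: "(real^'n) measure" where
  "sph_measure =
     distr (density (restrict_space lborel (cball 0 1 - {0})) (\<lambda>_. ennreal (real CARD('n))))
           (restrict_space borel (sphere 0 1)) (\<lambda>x. x /\<^sub>R norm x)"

definition hw :: "real^'n \<Rightarrow> real^'n \<Rightarrow> real" where
  "hw \<tau> x = (\<Prod>j\<in>UNIV. \<bar>x $ j\<bar> powr (\<tau> $ j))"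

text \<open>One-dimensional factor of the measure defining V_kappa:
  for k > 0 the normalised density (1+t)(1-t^2)^(k-1) on [-1,1];
  for k = 0 the limit (delta_1 + delta_(-1))/2.\<close>
definition Zk :: "real \<Rightarrow> real" where
  "Zk k = integral\<^sup>L lborel (\<lambda>t. indicator {-1..1} t * ((1 + t) * (1 - t^2) powr (k - 1)))"

definition mu_k :: "real \<Rightarrow> real measure" where
  "mu_k k = (if k = 0 then distr (measure_pmf (pmf_of_set {-1, 1::real})) borel (\<lambda>t. t)
             else density lborel (\<lambda>t. ennreal (indicator {-1..1} t * ((1 + t) * (1 - t^2) powr (k - 1)) / Zk k)))"

text \<open>The intertwining operator V_kappa (normalised so that V_kappa 1 = 1).\<close>
definition V_kappa :: "real^'n \<Rightarrow> (real^'n \<Rightarrow> real) \<Rightarrow> real^'n \<Rightarrow> real" where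
  "V_kappa \<kappa> g x = (\<integral>t. g (\<chi> i. x $ i * t i) \<partial>(PiM UNIV (\<lambda>i. mu_k (\<kappa> $ i))))"

definition Bset :: "real^'n \<Rightarrow> real \<Rightarrow> (real^'n) set" where
  "Bset x \<theta> = {y. norm y \<le> 1 \<and> x \<bullet> y \<ge> cos \<theta>}"

definition M_kappa :: "real^'n \<Rightarrow> (real^'n \<Rightarrow> real) \<Rightarrow> real^'n \<Rightarrow> ennreal" where
  "M_kappa \<kappa> f x =
     (SUP \<theta>\<in>{0<..pi}.
        (\<integral>\<^sup>+y. ennreal (\<bar>f y\<bar> * V_kappa \<kappa> (indicator (Bset x \<theta>)) y * (hw \<kappa> y)^2) \<partial>sph_measure)
      / (\<integral>\<^sup>+y. ennreal (V_kappa \<kappa> (indicator (Bset x \<theta>)) y * (hw \<kappa> y)^2) \<partial>sph_measure))"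

definition wnorm :: "real^'n \<Rightarrow> real \<Rightarrow> (real^'n \<Rightarrow> ennreal) \<Rightarrow> ennreal" where
  "wnorm \<tau> p G = enn_powr (\<integral>\<^sup>+x. enn_powr (G x) p * ennreal ((hw \<tau> x)^2) \<partial>sph_measure) (1 / p)"

end

theory Submission
  imports Defs
begin

text \<open>
  A function on the sphere is extended to an annulus by homogeneity of degree 0; there the weights
  are products of powers of the coordinates. \<open>V_kappa\<close> of the indicator function of the ball of
  centre x and angle \<theta> is at most a constant times \<open>\<Prod>\<^sub>i (\<theta> / (\<bar>x\<^sub>i\<bar> + \<theta>)) powr (2 \<kappa>\<^sub>i)\<close>, it vanishes
  outside the reflections of a box around x with sides comparable to \<theta>, and it is at least a
  constant times the same product on a fixed portion of that box. The product cancels in the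
  quotient, so the maximal function is dominated by a composition of one-dimensional maximal
  functions with respect to the measures \<open>\<bar>t\<bar> powr (2 \<kappa>\<^sub>i) dt\<close>. The condition on \<tau> says precisely that
  \<open>\<bar>t\<bar> powr (2 (\<tau>\<^sub>i - \<kappa>\<^sub>i))\<close> is a Muckenhoupt \<open>A\<^sub>p\<close> weight for that measure. In one dimension the scalar
  weighted inequality follows from an argument of Lerner, and the square-function version from the
  \<open>L\<^sup>2\<close> case by Rubio de Francia extrapolation; Fubini's theorem then treats one coordinate at a time.
\<close>

section \<open>Powers of extended nonnegative reals\<close>

text \<open>Lerner's argument needs maximal bounds for the measures w dM and s dM. Instead of a
  doubling property, the families of sets have a covering property that does not involve the
  measure: a finite cover can be thinned to overlap two. The unweighted constants then depend on p
  alone. Symmetric sets appear because the upper bound for \<open>V_kappa\<close> controls only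
  absolute values of coordinates; rational endpoints keep the families countable, so that maximal
  functions are measurable. An annulus of relative thickness \<theta> supplies the missing
  dimension: an integral over part of the sphere becomes, up to a factor \<theta>, an integral over
  a box in the full space, where the weight is a product and Fubini applies. For exponent 2 the
  square-function inequality is a sum of scalar ones, so extrapolation only has to feed quotients of
  A_1 weights to the scalar theorem. Calculating in \<open>ennreal\<close> avoids most finiteness
  conditions. Where a term must be absorbed or subtracted, finite partial sums or truncation restore
  finiteness.\<close>

lemma enn_powr_ennreal [simp]: "0 \<le> r \<Longrightarrow> enn_powr (ennreal r) a = ennreal (r powr a)"
  by (simp add: enn_powr_def)

lemma enn_powr_top [simp]: "enn_powr top a = top"
  by (simp add: enn_powr_def)

lemma enn_powr_0 [simp]: "enn_powr 0 a = 0"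
  by (simp add: enn_powr_def)

lemma enn_powr_one [simp]: "enn_powr 1 a = 1"
  by (simp add: enn_powr_def)

lemma enn_powr_1 [simp]: "enn_powr x 1 = x"
  by (cases x) auto

lemma enn_powr_mono: "x \<le> y \<Longrightarrow> 0 \<le> a \<Longrightarrow> enn_powr x a \<le> enn_powr y a"
  by (cases x; cases y) (auto simp: top_unique intro: powr_mono2)

lemma enn_powr_powr: "0 < a \<Longrightarrow> 0 < b \<Longrightarrow> enn_powr (enn_powr x a) b = enn_powr x (a * b)"
  by (cases x) (auto simp: powr_powr)

lemma enn_powr_mult: "0 < a \<Longrightarrow> enn_powr (x * y) a = enn_powr x a * enn_powr y a"
proof (cases x; cases y)
  assume "0 < a" "x = top" "y = top" then show ?thesis by simp
next
  fix r assume *: "0 < a" "x = top" "y = ennreal r" "0 \<le> r" 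
  then show ?thesis by (cases "r = 0") (auto simp: ennreal_top_mult)
next
  fix r assume *: "0 < a" "y = top" "x = ennreal r" "0 \<le> r" 
  then show ?thesis by (cases "r = 0") (auto simp: ennreal_mult_top)
qed (auto simp: powr_mult ennreal_mult[symmetric])

lemma enn_powr_add: "0 < a \<Longrightarrow> 0 < b \<Longrightarrow> enn_powr x (a + b) = enn_powr x a * enn_powr x b"
  by (cases x) (auto simp: powr_add ennreal_mult)

lemma enn_powr_2: "enn_powr x 2 = x\<^sup>2"
  using enn_powr_add[of 1 1 x] by (simp add: power2_eq_square)

lemma enn_powr_inverse: "0 < a \<Longrightarrow> 0 < x \<Longrightarrow> x < top \<Longrightarrow> enn_powr (inverse x) a = inverse (enn_powr x a)"
  by (cases x) (auto simp: inverse_ennreal powr_minus inverse_powr)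

lemma enn_powr_eq_top_iff: "0 < a \<Longrightarrow> enn_powr x a = top \<longleftrightarrow> x = top"
  by (cases x) auto

lemma enn_powr_eq_0_iff: "0 < a \<Longrightarrow> enn_powr x a = 0 \<longleftrightarrow> x = 0"
  by (cases x) (auto simp: ennreal_eq_0_iff)

lemma enn_powr_pos_iff: "0 < a \<Longrightarrow> 0 < enn_powr x a \<longleftrightarrow> 0 < x"
  using enn_powr_eq_0_iff[of a x] by (simp add: zero_less_iff_neq_zero)

lemma enn_powr_less_top_iff: "0 < a \<Longrightarrow> enn_powr x a < top \<longleftrightarrow> x < top"
  using enn_powr_eq_top_iff[of a x] by (metis less_top)

text \<open>A positive power is an order isomorphism of [0, top] whose inverse is the power 1/a. As
  a Galois connection this makes powers commute with suprema.\<close>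

lemma enn_powr_le_iff: "0 < a \<Longrightarrow> enn_powr x a \<le> y \<longleftrightarrow> x \<le> enn_powr y (1/a)"
  using enn_powr_mono[of x "enn_powr y (1/a)" a] enn_powr_mono[of "enn_powr x a" y "1/a"]
  by (auto simp: enn_powr_powr)

lemma enn_powr_measurable [measurable (raw)]:
  assumes [measurable]: "f \<in> borel_measurable M"
  shows "(\<lambda>x. enn_powr (f x) a) \<in> borel_measurable M"
  unfolding enn_powr_def by measurable

lemma enn_powr_SUP:
  assumes "0 < a" "I \<noteq> {}"
  shows "enn_powr (SUP i\<in>I. X i) a = (SUP i\<in>I. enn_powr (X i) a)"
proof (rule antisym)
  show "enn_powr (SUP i\<in>I. X i) a \<le> (SUP i\<in>I. enn_powr (X i) a)"
    unfolding enn_powr_le_iff[OF assms(1)]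
    by (intro SUP_least) (metis SUP_upper assms(1) enn_powr_le_iff)
  show "(SUP i\<in>I. enn_powr (X i) a) \<le> enn_powr (SUP i\<in>I. X i) a"
    using assms by (intro SUP_least enn_powr_mono SUP_upper) auto
qed

lemma young_real:
  fixes x y :: real
  assumes "0 \<le> x" "0 \<le> y" "1 < p"
  shows "x * y \<le> x powr p / p + y powr (p/(p-1)) * ((p-1)/p)"
proof -
  have "1/p + 1/(p/(p-1)) = 1" using assms by (simp add: field_simps)
  from Youngs_inequality[OF _ _ this assms(1,2)] show ?thesis using assms by (simp add: field_simps)
qed

lemma enn_young_weighted:
  fixes x y :: ennreal
  assumes "1 < p"
  shows "x * y \<le> ennreal (1/p) * enn_powr x p + ennreal ((p-1)/p) * enn_powr y (p/(p-1))"
proof (cases x; cases y)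
  fix r s assume *: "x = ennreal r" "0 \<le> r" "y = ennreal s" "0 \<le> s"
  have "r * s \<le> 1/p * r powr p + (p-1)/p * s powr (p/(p-1))"
    using young_real[of r s p] * assms by (simp add: mult.commute)
  then show ?thesis using * assms
    by (simp add: ennreal_mult[symmetric] ennreal_plus[symmetric] ennreal_leI del: ennreal_plus)
qed (use assms in \<open>auto simp: ennreal_mult_top\<close>)

lemma enn_young:
  fixes x y :: ennreal
  assumes "1 < p"
  shows "x * y \<le> enn_powr x p + enn_powr y (p/(p-1))"
proof -
  have "ennreal (1/p) * enn_powr x p + ennreal ((p-1)/p) * enn_powr y (p/(p-1)) \<le> 1 * enn_powr x p + 1 * enn_powr y (p/(p-1))"
    using assms by (intro add_mono mult_right_mono) auto
  then show ?thesis using enn_young_weighted[OF assms, of x y] by simp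
qed

text \<open>Jensen's inequality for the probability weights 1/2, 1/4, ... If S is positive and
  finite, Young's inequality with second factor b = S^((p-1)/p), whose conjugate power is S, bounds
  X b by S = S^(1/p) b, and b cancels. It serves to sum a Neumann series in a weighted L^p space
  without Minkowski's inequality.\<close>

lemma enn_powr_suminf_geometric_le:
  fixes a :: "nat \<Rightarrow> ennreal"
  assumes p: "1 < p"
  shows "enn_powr (\<Sum>k. ennreal ((1/2)^Suc k) * a k) p \<le> (\<Sum>k. ennreal ((1/2)^Suc k) * enn_powr (a k) p)"
proof -
  define X S b where "X = (\<Sum>k. ennreal ((1/2)^Suc k) * a k)" and "S = (\<Sum>k. ennreal ((1/2)^Suc k) * enn_powr (a k) p)"
    and "b = enn_powr S ((p-1)/p)"
  have one: "(\<Sum>k. ennreal ((1/2)^Suc k)) = 1"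
    using power_half_series by (subst suminf_ennreal_eq[where x=1]) auto
  consider "S = top" | "S = 0" | "0 < S" "S < top" by (metis less_top zero_less_iff_neq_zero)
  then have "enn_powr X p \<le> S"
  proof cases
    case 2
    then have "a k = 0" for k using p by (simp add: S_def suminf_eq_zero_iff enn_powr_eq_0_iff del: power_Suc)
    then show ?thesis using p by (simp add: X_def)
  next
    case 3
    have b: "0 < b" "b < top" using 3 p by (auto simp: b_def enn_powr_pos_iff enn_powr_less_top_iff)
    have bp: "enn_powr b (p/(p-1)) = S" using p by (simp add: b_def enn_powr_powr)
    have "X * b = (\<Sum>k. ennreal ((1/2)^Suc k) * (a k * b))"
      unfolding X_def by (simp add: mult.assoc del: power_Suc flip: ennreal_suminf_multc)
    also have "\<dots> \<le> (\<Sum>k. ennreal ((1/2)^Suc k) * (ennreal (1/p) * enn_powr (a k) p + ennreal ((p-1)/p) * S))"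
      using enn_young_weighted[OF p, of _ b] unfolding bp by (intro suminf_le mult_left_mono) auto
    also have "\<dots> = (\<Sum>k. ennreal (1/p) * (ennreal ((1/2)^Suc k) * enn_powr (a k) p) + (ennreal ((p-1)/p) * S) * ennreal ((1/2)^Suc k))"
      by (simp add: distrib_left mult_ac del: power_Suc)
    also have "\<dots> = ennreal (1/p) * S + (ennreal ((p-1)/p) * S) * (\<Sum>k. ennreal ((1/2)^Suc k))"
      unfolding S_def by (simp add: suminf_add[symmetric] del: power_Suc)
    also have "\<dots> = (ennreal (1/p) + ennreal ((p-1)/p)) * S" unfolding one by (simp add: distrib_right)
    also have "ennreal (1/p) + ennreal ((p-1)/p) = 1"
      using p by (subst ennreal_plus[symmetric]) (auto simp: field_simps)
    also have "1 * S = enn_powr S (1/p) * b"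
      using p unfolding b_def by (subst enn_powr_add[symmetric]) (auto simp: field_simps)
    finally have "b * X \<le> b * enn_powr S (1/p)" by (simp only: mult_ac)
    then have "X \<le> enn_powr S (1/p)" using b by (subst (asm) ennreal_mult_le_mult_iff) auto
    then show ?thesis using p by (subst enn_powr_le_iff) auto
  qed auto
  then show ?thesis by (simp only: X_def S_def)
qed

section \<open>Maximal functions over families of sets with thin covers\<close>

text \<open>Degenerate denominators are harmless: c = 0 makes the left side 0, and division by top
  yields 0, which forces t = 0. Averages over sets of measure 0 or top therefore need no separate
  treatment.\<close>

lemma ennreal_divide_gt_imp: "t \<le> b / c \<Longrightarrow> t * c \<le> (b::ennreal)"
proof (cases "c = 0 \<or> c = top")
  case True
  assume "t \<le> b / c"
  with True show ?thesis
    by (cases "c = 0") (auto simp: divide_ennreal_def)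
next
  case False
  assume "t \<le> b / c"
  then have "t * c \<le> b / c * c" by (rule mult_right_mono) simp
  also have "b / c * c = b" using False by (simp add: ennreal_divide_times less_top ennreal_times_divide mult.commute ennreal_mult_divide_eq)
  finally show ?thesis .
qed

lemma ennreal_divide_self_le_1: "x / x \<le> (1::ennreal)"
  by (cases "x = 0 \<or> x = top") (auto simp: less_top)

section \<open>The layer-cake formula\<close>

lemma layer_cake_real:
  assumes "0 < a" "0 \<le> r"
  shows "(\<integral>\<^sup>+t. ennreal (a * t powr (a-1)) * indicator {0<..} t * indicator {t. ennreal t < ennreal r} t \<partial>lborel) = ennreal (r powr a)"
proof -
  have "((\<lambda>t. a * t powr (a-1)) has_integral a * (r powr (a-1+1) / (a-1+1))) {0..r}"
    using assms by (intro has_integral_mult_right has_integral_powr_from_0) auto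
  then have I: "((\<lambda>t. a * t powr (a-1)) has_integral r powr a) {0..r}" using assms by simp
  have "(\<integral>\<^sup>+t. ennreal (a * t powr (a-1)) * indicator {0<..} t * indicator {t. ennreal t < ennreal r} t \<partial>lborel)
    = (\<integral>\<^sup>+t. ennreal (indicator {0..r} t * (a * t powr (a-1))) \<partial>lborel)"
    \<comment> \<open>The integrands differ at most at t = r. At t = 0 both vanish, the right one
      because \<open>0 powr x\<close> is 0.\<close>
    using AE_lborel_singleton[of r] assms
    by (intro nn_integral_cong_AE, elim AE_mp, intro AE_I2) (auto simp: indicator_def ennreal_less_iff not_less)
  also have "\<dots> = ennreal (r powr a)"
    using assms I by (intro nn_integral_has_integral_lebesgue) auto
  finally show ?thesis .
qed

lemma layer_cake:
  assumes "0 < a"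
  shows "(\<integral>\<^sup>+t. ennreal (a * t powr (a-1)) * indicator {0<..} t * indicator {t. ennreal t < y} t \<partial>lborel) = enn_powr y a"
proof (cases y)
  case (real r)
  then show ?thesis using layer_cake_real[OF assms, of r] by simp
next
  case top
  \<comment> \<open>The finite level n^(1/a) already yields the value n, and the integral is
    monotone in the level; hence level top gives top.\<close>
  have "of_nat n \<le> (\<integral>\<^sup>+t. ennreal (a * t powr (a-1)) * indicator {0<..} t * indicator {t. ennreal t < y} t \<partial>lborel)" for n :: nat
  proof -
    have "of_nat n = ennreal ((real n powr (1/a)) powr a)" using assms
      by (cases "n = 0") (auto simp: powr_powr ennreal_of_nat_eq_real_of_nat)
    also have "\<dots> = (\<integral>\<^sup>+t. ennreal (a * t powr (a-1)) * indicator {0<..} t * indicator {t. ennreal t < ennreal (real n powr (1/a))} t \<partial>lborel)"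
      using layer_cake_real[OF assms, of "real n powr (1/a)"] by simp
    also have "\<dots> \<le> (\<integral>\<^sup>+t. ennreal (a * t powr (a-1)) * indicator {0<..} t * indicator {t. ennreal t < y} t \<partial>lborel)"
      using top by (intro nn_integral_mono) (auto simp: indicator_def)
    finally show ?thesis .
  qed
  then have "(SUP n::nat. of_nat n :: ennreal) \<le> (\<integral>\<^sup>+t. ennreal (a * t powr (a-1)) * indicator {0<..} t * indicator {t. ennreal t < y} t \<partial>lborel)"
    by (rule SUP_least)
  then show ?thesis using top assms by (simp add: ennreal_SUP_of_nat_eq_top top_unique)
qed

section \<open>Averages, maximal functions, weak and strong type\<close>

definition mean_on :: "'a measure \<Rightarrow> ('a \<Rightarrow> ennreal) \<Rightarrow> 'a set \<Rightarrow> ennreal" where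
  "mean_on M f A = (\<integral>\<^sup>+y\<in>A. f y \<partial>M) / emeasure M A"

text \<open>The uncentred maximal function: x may lie anywhere in the competing sets. Where no
  member of S contains x, the empty supremum makes it 0.\<close>

definition maxfn :: "'a measure \<Rightarrow> 'a set set \<Rightarrow> ('a \<Rightarrow> ennreal) \<Rightarrow> 'a \<Rightarrow> ennreal" where
  "maxfn M S f x = (SUP A\<in>{A\<in>S. x \<in> A}. mean_on M f A)"

text \<open>Stands in for a Vitali covering lemma. No measure occurs in it, so the bounds derived
  from it hold with the same constant for every measure on the same sets.\<close>

definition thinnable :: "'a set set \<Rightarrow> bool" where
  "thinnable S \<longleftrightarrow> (\<forall>F\<subseteq>S. finite F \<longrightarrow> (\<exists>G\<subseteq>F. \<Union>G = \<Union>F \<and> (\<forall>x. card {A\<in>G. x \<in> A} \<le> 2)))"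

lemma mean_le_maxfn: "A \<in> S \<Longrightarrow> x \<in> A \<Longrightarrow> mean_on M f A \<le> maxfn M S f x"
  unfolding maxfn_def by (intro SUP_upper) auto

lemma maxfn_least: "(\<And>A. A \<in> S \<Longrightarrow> x \<in> A \<Longrightarrow> mean_on M f A \<le> b) \<Longrightarrow> maxfn M S f x \<le> b"
  unfolding maxfn_def by (intro SUP_least) auto

text \<open>The index set no longer depends on x, so for countable S the maximal function is a
  countable supremum of measurable functions.\<close>

lemma maxfn_eq_SUP_indicator: "maxfn M S f x = (SUP A\<in>S. mean_on M f A * indicator A x)"
  unfolding maxfn_def
  by (intro antisym SUP_least) (auto intro: SUP_upper2 simp: indicator_def)

lemma maxfn_measurable [measurable (raw)]:
  assumes "countable S" "S \<subseteq> sets M" "sets N = sets M"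
  shows "maxfn M' S f \<in> borel_measurable N"
proof -
  have "maxfn M' S f = (\<lambda>x. SUP A\<in>S. mean_on M' f A * indicator A x)"
    by (simp add: maxfn_eq_SUP_indicator fun_eq_iff)
  moreover have "(\<lambda>x. SUP A\<in>S. mean_on M' f A * indicator A x) \<in> borel_measurable N"
    using assms by (intro borel_measurable_SUP) (auto intro!: borel_measurable_times_ennreal borel_measurable_indicator)
  ultimately show ?thesis by simp
qed

lemma mean_on_mono: "(\<And>y. y \<in> A \<Longrightarrow> f y \<le> g y) \<Longrightarrow> mean_on M f A \<le> mean_on M g A"
  unfolding mean_on_def by (intro divide_right_mono_ennreal nn_integral_mono) (auto simp: indicator_def)

lemma mean_on_const_le: "A \<in> sets M \<Longrightarrow> mean_on M (\<lambda>_. c) A \<le> c"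
proof -
  assume "A \<in> sets M"
  then have "mean_on M (\<lambda>_. c) A = c * (emeasure M A / emeasure M A)"
    unfolding mean_on_def by (simp add: nn_integral_cmult_indicator ennreal_times_divide)
  also have "\<dots> \<le> c * 1" by (intro mult_left_mono ennreal_divide_self_le_1) auto
  finally show ?thesis by simp
qed

lemma mean_on_add:
  assumes [measurable]: "f \<in> borel_measurable M" "g \<in> borel_measurable M" "A \<in> sets M"
  shows "mean_on M (\<lambda>y. f y + g y) A = mean_on M f A + mean_on M g A"
  unfolding mean_on_def by (simp add: nn_integral_add distrib_right add_divide_distrib_ennreal)

lemma mean_on_cmult:
  assumes [measurable]: "f \<in> borel_measurable M" "A \<in> sets M"
  shows "mean_on M (\<lambda>y. c * f y) A = c * mean_on M f A"
  unfolding mean_on_def by (simp add: nn_integral_cmult mult.assoc ennreal_times_divide)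

lemma mean_on_suminf:
  assumes [measurable]: "\<And>i::nat. f i \<in> borel_measurable M" "A \<in> sets M"
  shows "mean_on M (\<lambda>y. \<Sum>i. f i y) A = (\<Sum>i. mean_on M (f i) A)"
  unfolding mean_on_def divide_ennreal_def
  by (simp add: nn_integral_suminf[symmetric])

lemma maxfn_cmult:
  assumes [measurable]: "f \<in> borel_measurable M" and S: "S \<subseteq> sets M"
  shows "maxfn M S (\<lambda>y. c * f y) x = c * maxfn M S f x"
proof -
  have "maxfn M S (\<lambda>y. c * f y) x = (SUP A\<in>{A\<in>S. x \<in> A}. c * mean_on M f A)"
    unfolding maxfn_def using S by (intro SUP_cong) (auto intro!: mean_on_cmult)
  then show ?thesis unfolding maxfn_def by (simp add: SUP_mult_left_ennreal)
qed

lemma maxfn_suminf_le: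
  assumes "\<And>i::nat. f i \<in> borel_measurable M" and S: "S \<subseteq> sets M"
  shows "maxfn M S (\<lambda>y. \<Sum>i. f i y) x \<le> (\<Sum>i. maxfn M S (f i) x)"
proof (rule maxfn_least)
  fix A assume A: "A \<in> S" "x \<in> A"
  have "mean_on M (\<lambda>y. \<Sum>i. f i y) A = (\<Sum>i. mean_on M (f i) A)"
    using assms A by (intro mean_on_suminf) auto
  also have "\<dots> \<le> (\<Sum>i. maxfn M S (f i) x)"
    by (intro suminf_le mean_le_maxfn A) auto
  finally show "mean_on M (\<lambda>y. \<Sum>i. f i y) A \<le> (\<Sum>i. maxfn M S (f i) x)" .
qed

text \<open>A thinned cover G has the same union as F, and the sum of its indicators is at most 2.
  This overlap bound is the constant 2.\<close>

lemma weak_type_finite: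
  assumes [measurable]: "f \<in> borel_measurable M" and S: "S \<subseteq> sets M" "thinnable S"
    and F: "F \<subseteq> S" "finite F" "\<And>A. A \<in> F \<Longrightarrow> t \<le> mean_on M f A"
  shows "t * emeasure M (\<Union>F) \<le> 2 * (\<integral>\<^sup>+x. f x \<partial>M)"
proof -
  obtain G where G: "G \<subseteq> F" "\<Union>G = \<Union>F" "\<And>x. card {A\<in>G. x \<in> A} \<le> 2"
    using S(2) F(1,2) unfolding thinnable_def by meson
  have [simp]: "finite G" using G(1) F(2) by (rule finite_subset)
  have GM: "A \<in> sets M" if "A \<in> G" for A using G(1) F(1) S(1) that by (meson subsetD)
  have "t * emeasure M (\<Union>F) \<le> t * (\<Sum>A\<in>G. emeasure M A)"
    unfolding G(2)[symmetric] using GM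
    by (intro mult_left_mono) (use emeasure_subadditive_finite[of G "\<lambda>A. A" M] in auto)
  also have "\<dots> = (\<Sum>A\<in>G. t * emeasure M A)" by (simp add: sum_distrib_left)
  also have "\<dots> \<le> (\<Sum>A\<in>G. \<integral>\<^sup>+y. f y * indicator A y \<partial>M)"
    using F(3) G(1) unfolding mean_on_def by (intro sum_mono ennreal_divide_gt_imp) auto
  also have "\<dots> = (\<integral>\<^sup>+y. (\<Sum>A\<in>G. f y * indicator A y) \<partial>M)"
    using GM by (intro nn_integral_sum[symmetric]) auto
  also have "\<dots> \<le> (\<integral>\<^sup>+y. 2 * f y \<partial>M)"
  proof (intro nn_integral_mono)
    fix y
    have "(\<Sum>A\<in>G. f y * indicator A y) = f y * (\<Sum>A\<in>G. indicator A y)" by (simp add: sum_distrib_left)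
    also have "(\<Sum>A\<in>G. indicator A y) = (of_nat (card {A\<in>G. y \<in> A}) :: ennreal)"
      by (simp add: indicator_def Int_def sum.If_cases)
    also have "f y * \<dots> \<le> f y * of_nat 2"
      by (intro mult_left_mono of_nat_mono G) auto
    finally show "(\<Sum>A\<in>G. f y * indicator A y) \<le> 2 * f y" by (simp add: mult.commute)
  qed
  also have "\<dots> = 2 * (\<integral>\<^sup>+x. f x \<partial>M)" by (simp add: nn_integral_cmult)
  finally show ?thesis .
qed

text \<open>The superlevel set is exactly the union of the members with average above t. This family
  is countable, so the union is exhausted by finite unions, for which the bound is known, and
  continuity from below finishes.\<close>

lemma weak_type:
  assumes f[measurable]: "f \<in> borel_measurable M" and S: "countable S" "S \<subseteq> sets M" "thinnable S"
  shows "t * emeasure M {x\<in>space M. t < maxfn M S f x} \<le> 2 * (\<integral>\<^sup>+x. f x \<partial>M)"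
proof -
  define Q where "Q = {A\<in>S. t < mean_on M f A}"
  have eq: "{x\<in>space M. t < maxfn M S f x} = \<Union>Q"
  proof (intro set_eqI iffI)
    fix x assume "x \<in> \<Union>Q"
    then obtain A where A: "A \<in> S" "x \<in> A" "t < mean_on M f A" by (auto simp: Q_def)
    then have "t < maxfn M S f x" using mean_le_maxfn[OF A(1,2), of M f] by (blast intro: order.strict_trans2)
    then show "x \<in> {x\<in>space M. t < maxfn M S f x}" using A(1,2) S(2) sets.sets_into_space by auto
  qed (auto simp: Q_def maxfn_def less_SUP_iff)
  have Q: "Q \<subseteq> S" "countable Q" using S(1) by (auto simp: Q_def)
  show ?thesis
  proof (cases "Q = {}")
    case True then show ?thesis unfolding eq by simp
  next
    case False
    define B where "B n = (\<Union>i<n. from_nat_into Q i)" for n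
    have QB: "\<Union>Q = (\<Union>n. B n)"
    proof -
      have "\<Union>Q = (\<Union>i. from_nat_into Q i)" using range_from_nat_into[OF False Q(2)] by simp
      also have "\<dots> = (\<Union>n. B n)" unfolding B_def by blast
      finally show ?thesis .
    qed
    have Bs: "range B \<subseteq> sets M" 
      unfolding B_def using from_nat_into[OF False] Q S by (intro image_subsetI sets.finite_UN) auto
    have "incseq B" unfolding B_def by (intro monoI UN_mono) auto
    then have "emeasure M (\<Union>Q) = (SUP n. emeasure M (B n))"
      unfolding QB using Bs by (intro SUP_emeasure_incseq[symmetric])
    then have "t * emeasure M (\<Union>Q) = (SUP n. t * emeasure M (B n))"
      by (simp add: SUP_mult_left_ennreal)
    also have "\<dots> \<le> 2 * (\<integral>\<^sup>+x. f x \<partial>M)"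
    proof (intro SUP_least)
      fix n
      have "from_nat_into Q i \<in> Q" for i using from_nat_into[OF False] .
      then show "t * emeasure M (B n) \<le> 2 * (\<integral>\<^sup>+x. f x \<partial>M)"
        unfolding B_def using Q S
        by (intro weak_type_finite[where S=S]) (auto simp: Q_def subset_eq less_imp_le)
    qed
    finally show ?thesis unfolding eq .
  qed
qed

text \<open>Truncating f at height t/2 makes the layer-cake integral below converge without knowing
  beforehand that the maximal function is in \<open>L\<^sup>p\<close>.\<close>

lemma weak_type_truncated:
  fixes t :: real
  assumes f[measurable]: "f \<in> borel_measurable M" and S: "countable S" "S \<subseteq> sets M" "thinnable S" and t: "0 < t"
  shows "emeasure M {x\<in>space M. ennreal t < maxfn M S f x}
    \<le> ennreal (4 / t) * (\<integral>\<^sup>+x. f x * indicator {x. ennreal t < 2 * f x} x \<partial>M)"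
proof -
  define g where "g x = f x * indicator {x. ennreal t < 2 * f x} x" for x
  have g[measurable]: "g \<in> borel_measurable M" unfolding g_def by measurable
  have fg: "f x \<le> g x + ennreal (t/2)" for x
  proof (cases "ennreal t < 2 * f x")
    case True then show ?thesis by (simp add: g_def)
  next
    case False
    then have "2 * f x \<le> 2 * ennreal (t/2)" using t 
      by (simp add: not_less ennreal_mult[symmetric] flip: ennreal_numeral)
    then show ?thesis by (simp add: ennreal_mult_le_mult_iff g_def add_increasing)
  qed
  have le: "maxfn M S f x \<le> maxfn M S g x + ennreal (t/2)" for x
  proof (rule maxfn_least)
    fix A assume A: "A \<in> S" "x \<in> A"
    have [measurable]: "A \<in> sets M" using A S by auto
    have "mean_on M f A \<le> mean_on M (\<lambda>y. g y + ennreal (t/2)) A" by (intro mean_on_mono fg)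
    also have "\<dots> = mean_on M g A + mean_on M (\<lambda>y. ennreal (t/2)) A" by (intro mean_on_add) auto
    also have "\<dots> \<le> maxfn M S g x + ennreal (t/2)" by (intro add_mono mean_le_maxfn A mean_on_const_le) auto
    finally show "mean_on M f A \<le> maxfn M S g x + ennreal (t/2)" .
  qed
  have sub: "ennreal (t/2) < maxfn M S g x" if "ennreal t < maxfn M S f x" for x
  proof (rule ccontr)
    assume "\<not> ennreal (t/2) < maxfn M S g x"
    then have "maxfn M S f x \<le> ennreal (t/2) + ennreal (t/2)" using le[of x] by (meson add_mono not_less order.trans order_refl)
    then show False using that t by (simp add: ennreal_plus[symmetric] del: ennreal_plus)
  qed
  have mm[measurable]: "maxfn M S g \<in> borel_measurable M" by (rule maxfn_measurable) (use S in auto)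
  have "emeasure M {x\<in>space M. ennreal t < maxfn M S f x} \<le> emeasure M {x\<in>space M. ennreal (t/2) < maxfn M S g x}"
    by (intro emeasure_mono) (auto intro: sub)
  also have "\<dots> = ennreal (2/t) * (ennreal (t/2) * emeasure M {x\<in>space M. ennreal (t/2) < maxfn M S g x})"
    using t by (simp add: mult.assoc[symmetric] ennreal_mult[symmetric])
  also have "\<dots> \<le> ennreal (2/t) * (2 * (\<integral>\<^sup>+x. g x \<partial>M))"
    by (intro mult_left_mono weak_type S g) auto
  also have "\<dots> = ennreal (4/t) * (\<integral>\<^sup>+x. g x \<partial>M)"
    using t by (simp add: mult.assoc[symmetric] ennreal_mult[symmetric] flip: ennreal_numeral)
  finally show ?thesis unfolding g_def .
qed

text \<open>The truncated weak-type bound is integrated against p t^(p-1) dt. After Fubini the inner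
  integral of t^(p-2) over t < 2 f(x) equals (2 f(x))^(p-1) / (p-1), and the factor f(x) restores
  the power p. The measure enters only through sigma-finiteness, which Fubini's theorem
  uses.\<close>

theorem strong_type:
  assumes "sigma_finite_measure M" and f[measurable]: "f \<in> borel_measurable M"
    and S: "countable S" "S \<subseteq> sets M" "thinnable S" and p: "1 < p"
  shows "(\<integral>\<^sup>+x. enn_powr (maxfn M S f x) p \<partial>M) \<le> ennreal (4*p/(p-1) * 2 powr (p-1)) * (\<integral>\<^sup>+x. enn_powr (f x) p \<partial>M)"
proof -
  interpret sigma_finite_measure M by fact
  interpret pair_sigma_finite lborel M ..
  have mm[measurable]: "maxfn M S f \<in> borel_measurable M" by (rule maxfn_measurable) (use S in auto)
  have "(\<integral>\<^sup>+x. enn_powr (maxfn M S f x) p \<partial>M) = 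
    (\<integral>\<^sup>+x. (\<integral>\<^sup>+t. ennreal (p * t powr (p-1)) * indicator {0<..} t * indicator {t. ennreal t < maxfn M S f x} t \<partial>lborel) \<partial>M)"
    using p by (simp add: layer_cake)
  also have "\<dots> = (\<integral>\<^sup>+t. (\<integral>\<^sup>+x. ennreal (p * t powr (p-1)) * indicator {0<..} t * indicator {t. ennreal t < maxfn M S f x} t \<partial>M) \<partial>lborel)"
    by (rule Fubini') (auto simp: indicator_def)
  also have "\<dots> \<le> (\<integral>\<^sup>+t. (\<integral>\<^sup>+x. ennreal (4*p * t powr (p-2)) * indicator {0<..} t * (f x * indicator {t. ennreal t < 2 * f x} t) \<partial>M) \<partial>lborel)"
  proof (rule nn_integral_mono)
    fix t :: real
    have "(\<integral>\<^sup>+x. ennreal (p * t powr (p-1)) * (indicator {t. ennreal t < maxfn M S f x} t) \<partial>M)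
      \<le> (\<integral>\<^sup>+x. ennreal (4*p * t powr (p-2)) * (f x * indicator {t. ennreal t < 2 * f x} t) \<partial>M)" if t: "0 < t"
    proof -
      have "(\<integral>\<^sup>+x. ennreal (p * t powr (p-1)) * (indicator {t. ennreal t < maxfn M S f x} t) \<partial>M)
        = (\<integral>\<^sup>+x. ennreal (p * t powr (p-1)) * indicator {x\<in>space M. ennreal t < maxfn M S f x} x \<partial>M)"
        by (intro nn_integral_cong) (auto simp: indicator_def)
      also have "\<dots> = ennreal (p * t powr (p-1)) * emeasure M {x\<in>space M. ennreal t < maxfn M S f x}"
        by (simp add: nn_integral_cmult_indicator)
      also have "\<dots> \<le> ennreal (p * t powr (p-1)) * (ennreal (4 / t) * (\<integral>\<^sup>+x. f x * indicator {x. ennreal t < 2 * f x} x \<partial>M))"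
        by (intro mult_left_mono weak_type_truncated f S t) auto
      also have "\<dots> = ennreal (4*p * t powr (p-2)) * (\<integral>\<^sup>+x. f x * indicator {x. ennreal t < 2 * f x} x \<partial>M)"
      proof -
        have "t powr (p-1) / t = t powr (p-2)" using t powr_diff[of t "p-1" 1] by simp
        then have eq: "(p * t powr (p-1)) * (4/t) = 4*p * t powr (p-2)" by (metis (no_types, lifting) mult.assoc mult.commute times_divide_eq_right)
        have "ennreal (p * t powr (p-1)) * ennreal (4/t) = ennreal (4*p * t powr (p-2))"
          unfolding eq[symmetric] using t p by (intro ennreal_mult[symmetric]) auto
        then show ?thesis by (simp add: mult.assoc[symmetric])
      qed
      also have "\<dots> = (\<integral>\<^sup>+x. ennreal (4*p * t powr (p-2)) * (f x * indicator {t. ennreal t < 2 * f x} t) \<partial>M)"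
        by (subst nn_integral_cmult[symmetric]) (auto simp: indicator_def)
      finally show ?thesis .
    qed
    then show "(\<integral>\<^sup>+x. ennreal (p * t powr (p-1)) * indicator {0<..} t * indicator {t. ennreal t < maxfn M S f x} t \<partial>M)
      \<le> (\<integral>\<^sup>+x. ennreal (4*p * t powr (p-2)) * indicator {0<..} t * (f x * indicator {t. ennreal t < 2 * f x} t) \<partial>M)"
      by (cases "0 < t") auto
  qed
  also have "\<dots> = (\<integral>\<^sup>+x. (\<integral>\<^sup>+t. ennreal (4*p * t powr (p-2)) * indicator {0<..} t * (f x * indicator {t. ennreal t < 2 * f x} t) \<partial>lborel) \<partial>M)"
    by (rule Fubini'[symmetric]) (auto simp: indicator_def)
  also have "\<dots> = (\<integral>\<^sup>+x. ennreal (4*p/(p-1) * 2 powr (p-1)) * enn_powr (f x) p \<partial>M)"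
  proof (rule nn_integral_cong)
    fix x
    have "(\<integral>\<^sup>+t. ennreal (4*p * t powr (p-2)) * indicator {0<..} t * (f x * indicator {t. ennreal t < 2 * f x} t) \<partial>lborel)
      = (\<integral>\<^sup>+t. (f x * ennreal (4*p/(p-1))) * (ennreal ((p-1) * t powr ((p-1) - 1)) * indicator {0<..} t * indicator {t. ennreal t < 2 * f x} t) \<partial>lborel)"
    proof (rule nn_integral_cong)
      fix t :: real
      have "ennreal (4*p * t powr (p-2)) = ennreal (4*p/(p-1)) * ennreal ((p-1) * t powr ((p-1)-1))"
        using p by (subst ennreal_mult[symmetric]) auto
      then show "ennreal (4*p * t powr (p-2)) * indicator {0<..} t * (f x * indicator {t. ennreal t < 2 * f x} t)
        = (f x * ennreal (4*p/(p-1))) * (ennreal ((p-1) * t powr ((p-1) - 1)) * indicator {0<..} t * indicator {t. ennreal t < 2 * f x} t)"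
        by (simp only: mult_ac)
    qed
    also have "\<dots> = f x * ennreal (4*p/(p-1)) * enn_powr (2 * f x) (p-1)"
      using p layer_cake[of "p-1" "2 * f x"] by (subst nn_integral_cmult) auto
    also have "\<dots> = ennreal (4*p/(p-1) * 2 powr (p-1)) * (enn_powr (f x) 1 * enn_powr (f x) (p-1))"
    proof -
      have "ennreal (4*p/(p-1) * 2 powr (p-1)) = ennreal (4*p/(p-1)) * enn_powr 2 (p-1)"
        using p by (subst ennreal_mult) (auto simp flip: ennreal_numeral)
      then show ?thesis using p by (simp add: enn_powr_mult mult_ac)
    qed
    also have "\<dots> = ennreal (4*p/(p-1) * 2 powr (p-1)) * enn_powr (f x) p"
      using p by (subst enn_powr_add[symmetric]) auto
    finally show "(\<integral>\<^sup>+t. ennreal (4*p * t powr (p-2)) * indicator {0<..} t * (f x * indicator {t. ennreal t < 2 * f x} t) \<partial>lborel)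
      = ennreal (4*p/(p-1) * 2 powr (p-1)) * enn_powr (f x) p" .
  qed
  also have "\<dots> = ennreal (4*p/(p-1) * 2 powr (p-1)) * (\<integral>\<^sup>+x. enn_powr (f x) p \<partial>M)"
    by (simp add: nn_integral_cmult)
  finally show ?thesis .
qed

section \<open>Muckenhoupt weights\<close>

abbreviation (input) p_integral :: "'a measure \<Rightarrow> real \<Rightarrow> ('a \<Rightarrow> ennreal) \<Rightarrow> ('a \<Rightarrow> ennreal) \<Rightarrow> ennreal" where
  "p_integral M p w f \<equiv> (\<integral>\<^sup>+x. enn_powr (f x) p * w x \<partial>M)"

abbreviation (input) sq_fun :: "real \<Rightarrow> (nat \<Rightarrow> 'a \<Rightarrow> ennreal) \<Rightarrow> 'a \<Rightarrow> ennreal" where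
  "sq_fun p F x \<equiv> enn_powr (\<Sum>j. (F j x)\<^sup>2) (p/2)"

abbreviation (input) sq_integral :: "'a measure \<Rightarrow> real \<Rightarrow> ('a \<Rightarrow> ennreal) \<Rightarrow> (nat \<Rightarrow> 'a \<Rightarrow> ennreal) \<Rightarrow> ennreal" where
  "sq_integral M p w F \<equiv> (\<integral>\<^sup>+x. sq_fun p F x * w x \<partial>M)"

abbreviation (input) sq_integral_un :: "'a measure \<Rightarrow> real \<Rightarrow> (nat \<Rightarrow> 'a \<Rightarrow> ennreal) \<Rightarrow> ennreal" where
  "sq_integral_un M p F \<equiv> (\<integral>\<^sup>+x. sq_fun p F x \<partial>M)"

definition K_strong :: "real \<Rightarrow> ennreal" where
  "K_strong p = ennreal (4*p/(p-1) * 2 powr (p-1))"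

lemma K_strong_less_top [simp]: "K_strong p < top"
  by (simp add: K_strong_def)

lemma set_nn_integral_pos:
  assumes [measurable]: "A \<in> sets M" "w \<in> borel_measurable M" and "AE x in M. 0 < w x" "0 < emeasure M A"
  shows "0 < (\<integral>\<^sup>+x\<in>A. w x \<partial>M)"
proof (rule ccontr)
  assume "\<not> 0 < (\<integral>\<^sup>+x\<in>A. w x \<partial>M)"
  then have "(\<integral>\<^sup>+x\<in>A. w x \<partial>M) = 0" by (simp add: zero_less_iff_neq_zero)
  then have "AE x in M. w x * indicator A x = 0" by (subst (asm) nn_integral_0_iff_AE) auto
  with assms(3) have "AE x in M. x \<notin> A" by (auto simp: indicator_def split: if_splits)
  moreover have "{x \<in> space M. \<not> x \<notin> A} = A" using sets.sets_into_space[OF assms(1)] by auto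
  ultimately show False using assms AE_iff_measurable[of A M "\<lambda>x. x \<notin> A"] by simp
qed

lemma set_nn_integral_density_eq:
  assumes [measurable]: "A \<in> sets M" "s \<in> borel_measurable M" "f \<in> borel_measurable M"
    and "AE x in M. 0 < s x \<and> s x < top"
  shows "(\<integral>\<^sup>+x\<in>A. (f x * inverse (s x)) \<partial>density M s) = (\<integral>\<^sup>+x\<in>A. f x \<partial>M)"
proof -
  have "(\<integral>\<^sup>+x\<in>A. (f x * inverse (s x)) \<partial>density M s) = (\<integral>\<^sup>+x. s x * (f x * inverse (s x) * indicator A x) \<partial>M)"
    by (intro nn_integral_density) auto
  also have "\<dots> = (\<integral>\<^sup>+x\<in>A. f x \<partial>M)"
    using assms(4)
  proof (intro nn_integral_cong_AE, elim AE_mp, intro AE_I2 impI)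
    fix x assume "0 < s x \<and> s x < top"
    then have "s x * inverse (s x) = 1" by (metis ennreal_divide_self divide_ennreal_def less_irrefl)
    then show "s x * (f x * inverse (s x) * indicator A x) = f x * indicator A x"
      by (metis (no_types, lifting) mult.commute mult.left_commute mult.right_neutral)
  qed
  finally show ?thesis .
qed

text \<open>Lerner's argument: the weighted bound is reduced to the unweighted ones for the two measures
  w dM and s dM, which hold with constants that do not depend on the measure.\<close>

theorem muckenhoupt:
  assumes "sigma_finite_measure M" and f[measurable]: "f \<in> borel_measurable M"
    and S: "countable S" "S \<subseteq> sets M" "thinnable S" and p: "1 < p"
    and w[measurable]: "w \<in> borel_measurable M" and s[measurable]: "s \<in> borel_measurable M"
    and ws: "AE x in M. 0 < w x \<and> w x < top \<and> 0 < s x \<and> s x < top \<and> w x * enn_powr (s x) (p-1) = 1"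
    and pos: "\<And>I. I \<in> S \<Longrightarrow> 0 < emeasure M I \<and> emeasure M I < top"
    and A: "A < top" "\<And>I. I \<in> S \<Longrightarrow> (\<integral>\<^sup>+x\<in>I. w x \<partial>M) * enn_powr (\<integral>\<^sup>+x\<in>I. s x \<partial>M) (p-1) \<le> A * enn_powr (emeasure M I) p"
  shows "p_integral M p w (maxfn M S f)
    \<le> enn_powr A (p/(p-1)) * K_strong (p/(p-1)) * K_strong p * p_integral M p w f"
proof -
  interpret sigma_finite_measure M by fact
  define q where "q = p/(p-1)"
  have q: "1 < q" "(p-1) * q = p" using p by (auto simp: q_def field_simps)
  have S': "S \<subseteq> sets (density M s)" "S \<subseteq> sets (density M w)" using S by auto
  have sfs: "sigma_finite_measure (density M s)" using ws by (subst sigma_finite_iff_density_finite') (auto elim: AE_mp)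
  have sfw: "sigma_finite_measure (density M w)" using ws by (subst sigma_finite_iff_density_finite') (auto elim: AE_mp)
  define m where "m = maxfn (density M s) S (\<lambda>x. f x * inverse (s x))"
  have [measurable]: "m \<in> borel_measurable M" unfolding m_def by (rule maxfn_measurable) (use S in auto)
  define N where "N = maxfn (density M w) S (\<lambda>x. enn_powr (m x) (p-1) * inverse (w x))"
  have [measurable]: "N \<in> borel_measurable M" unfolding N_def by (rule maxfn_measurable) (use S in auto)
  have wae: "AE x in M. 0 < w x" "AE x in M. 0 < s x" "AE x in M. 0 < w x \<and> w x < top" "AE x in M. 0 < s x \<and> s x < top" 
    using ws by (auto elim: AE_mp)
  \<comment> \<open>The pointwise heart of the argument. On I the integral of f is at most s(I) m(y)
    for every y in I. The (p-1)-th power is averaged over y in I with respect to M, and the average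
    is rewritten as an integral against w dM, where it is at most w(I) N(x). The product of w(I) and
    s(I)^(p-1) is then removed by the A_p condition.\<close>
  have key: "enn_powr (maxfn M S f x) (p-1) \<le> A * N x" for x
  proof (subst enn_powr_le_iff)
    show "0 < p - 1" using p by simp
    show "maxfn M S f x \<le> enn_powr (A * N x) (1 / (p - 1))"
    proof (rule maxfn_least)
      fix I assume I: "I \<in> S" "x \<in> I"
      have [measurable]: "I \<in> sets M" using I S by auto
      define wI sI where "wI = (\<integral>\<^sup>+x\<in>I. w x \<partial>M)" and "sI = (\<integral>\<^sup>+x\<in>I. s x \<partial>M)"
      have ew: "emeasure (density M w) I = wI" "emeasure (density M s) I = sI"
        by (auto simp: emeasure_density wI_def sI_def)
      have p0: "0 < wI" "0 < sI"
        using pos[OF I(1)] wae unfolding wI_def sI_def by (auto intro: set_nn_integral_pos)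
      have fin: "A * enn_powr (emeasure M I) p < top" using pos[OF I(1)] A(1) p
        by (auto simp: ennreal_mult_less_top enn_powr_less_top_iff)
      have le: "wI * enn_powr sI (p-1) \<le> A * enn_powr (emeasure M I) p" using A(2)[OF I(1)] by (simp add: wI_def sI_def)
      have lt: "wI * enn_powr sI (p-1) < top" using le fin by (rule order.strict_trans1)
      have sp: "0 < enn_powr sI (p-1)" using p0 p by (simp add: enn_powr_pos_iff)
      have fin2: "wI < top" "sI < top" 
        using lt sp p0 p by (auto simp: ennreal_mult_less_top enn_powr_less_top_iff)
      have f1: "(\<integral>\<^sup>+x\<in>I. f x \<partial>M) \<le> sI * m y" if "y \<in> I" for y
      proof -
        have "(\<integral>\<^sup>+x\<in>I. f x \<partial>M) = (\<integral>\<^sup>+x\<in>I. (f x * inverse (s x)) \<partial>density M s)"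
          using wae by (subst set_nn_integral_density_eq) auto
        also have "\<dots> = sI * mean_on (density M s) (\<lambda>x. f x * inverse (s x)) I"
          unfolding mean_on_def ew using p0 fin2 by (simp add: ennreal_times_divide mult.commute[of sI] ennreal_mult_divide_eq less_imp_neq)
        also have "\<dots> \<le> sI * m y" unfolding m_def using I that by (intro mult_left_mono mean_le_maxfn) auto
        finally show ?thesis .
      qed
      \<comment> \<open>The left side is a constant integrated over y in I; the estimate by m(y) may
        then be used at each y separately.\<close>
      have "enn_powr (\<integral>\<^sup>+x\<in>I. f x \<partial>M) (p-1) * emeasure M I = (\<integral>\<^sup>+y\<in>I. enn_powr (\<integral>\<^sup>+x\<in>I. f x \<partial>M) (p-1) \<partial>M)"
        by (simp add: nn_integral_cmult_indicator)
      also have "\<dots> \<le> (\<integral>\<^sup>+y\<in>I. (enn_powr sI (p-1) * enn_powr (m y) (p-1)) \<partial>M)"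
        using f1 p by (intro nn_integral_mono) (auto simp: indicator_def enn_powr_mult[symmetric] intro!: enn_powr_mono)
      also have "\<dots> = enn_powr sI (p-1) * (\<integral>\<^sup>+y\<in>I. enn_powr (m y) (p-1) \<partial>M)"
        by (subst nn_integral_cmult[symmetric]) (auto simp: mult.assoc)
      finally have c1: "enn_powr (\<integral>\<^sup>+x\<in>I. f x \<partial>M) (p-1) * emeasure M I \<le> enn_powr sI (p-1) * (\<integral>\<^sup>+y\<in>I. enn_powr (m y) (p-1) \<partial>M)" .
      have "(\<integral>\<^sup>+y\<in>I. enn_powr (m y) (p-1) \<partial>M) = (\<integral>\<^sup>+y\<in>I. (enn_powr (m y) (p-1) * inverse (w y)) \<partial>density M w)"
        using wae by (subst set_nn_integral_density_eq) auto
      also have "\<dots> = wI * mean_on (density M w) (\<lambda>y. enn_powr (m y) (p-1) * inverse (w y)) I"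
        unfolding mean_on_def ew using p0 fin2 by (simp add: ennreal_times_divide mult.commute[of wI] ennreal_mult_divide_eq less_imp_neq)
      also have "\<dots> \<le> wI * N x" unfolding N_def using I by (intro mult_left_mono mean_le_maxfn) auto
      finally have "enn_powr sI (p-1) * (\<integral>\<^sup>+y\<in>I. enn_powr (m y) (p-1) \<partial>M) \<le> enn_powr sI (p-1) * (wI * N x)"
        by (intro mult_left_mono) auto
      also have "enn_powr sI (p-1) * (wI * N x) = (wI * enn_powr sI (p-1)) * N x" by (simp add: mult_ac)
      also have "\<dots> \<le> A * enn_powr (emeasure M I) p * N x" using le by (intro mult_right_mono) auto
      also have "enn_powr (emeasure M I) p = enn_powr (emeasure M I) (p-1) * emeasure M I"
        using p enn_powr_add[of "p-1" 1 "emeasure M I"] by simp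
      finally have *: "enn_powr (\<integral>\<^sup>+x\<in>I. f x \<partial>M) (p-1) * emeasure M I \<le> (A * N x * enn_powr (emeasure M I) (p-1)) * emeasure M I"
        using c1 by (simp add: mult_ac)
      have **: "enn_powr (\<integral>\<^sup>+x\<in>I. f x \<partial>M) (p-1) \<le> A * N x * enn_powr (emeasure M I) (p-1)"
        using * pos[OF I(1)] by (metis ennreal_mult_le_mult_iff less_irrefl mult.commute)
      have "enn_powr (mean_on M f I) (p-1) = enn_powr (\<integral>\<^sup>+x\<in>I. f x \<partial>M) (p-1) * inverse (enn_powr (emeasure M I) (p-1))"
        unfolding mean_on_def divide_ennreal_def using p pos[OF I(1)] by (simp add: enn_powr_mult enn_powr_inverse)
      also have "\<dots> \<le> A * N x * enn_powr (emeasure M I) (p-1) * inverse (enn_powr (emeasure M I) (p-1))"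
        using ** by (intro mult_right_mono) auto
      also have "\<dots> = A * N x * (enn_powr (emeasure M I) (p-1) / enn_powr (emeasure M I) (p-1))" by (simp add: divide_ennreal_def mult_ac)
      also have "\<dots> \<le> A * N x * 1" by (intro mult_left_mono ennreal_divide_self_le_1) auto
      finally have "enn_powr (mean_on M f I) (p-1) \<le> A * N x" by simp
      then show "mean_on M f I \<le> enn_powr (A * N x) (1 / (p - 1))" using p by (subst enn_powr_le_iff[symmetric]) auto
    qed
  qed
  have "p_integral M p w (maxfn M S f) \<le> (\<integral>\<^sup>+x. enn_powr A q * (w x * enn_powr (N x) q) \<partial>M)"
  proof (rule nn_integral_mono)
    fix x
    have "enn_powr (maxfn M S f x) p = enn_powr (enn_powr (maxfn M S f x) (p-1)) q"
      using p q by (simp add: enn_powr_powr)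
    also have "\<dots> \<le> enn_powr (A * N x) q" using key q by (intro enn_powr_mono) auto
    also have "\<dots> = enn_powr A q * enn_powr (N x) q" using q by (simp add: enn_powr_mult)
    finally show "enn_powr (maxfn M S f x) p * w x \<le> enn_powr A q * (w x * enn_powr (N x) q)"
      by (metis (no_types, lifting) mult.assoc mult.commute mult_right_mono zero_le)
  qed
  also have "\<dots> = enn_powr A q * (\<integral>\<^sup>+x. enn_powr (N x) q \<partial>density M w)"
    by (subst nn_integral_density) (auto simp: nn_integral_cmult)
  finally have c1: "p_integral M p w (maxfn M S f) \<le> enn_powr A q * (\<integral>\<^sup>+x. enn_powr (N x) q \<partial>density M w)" .
  have c2: "(\<integral>\<^sup>+x. enn_powr (N x) q \<partial>density M w) \<le> K_strong q * (\<integral>\<^sup>+x. enn_powr (enn_powr (m x) (p-1) * inverse (w x)) q \<partial>density M w)"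
    unfolding N_def K_strong_def by (rule strong_type[OF sfw]) (use S q in auto)
  have "(\<integral>\<^sup>+x. enn_powr (enn_powr (m x) (p-1) * inverse (w x)) q \<partial>density M w) = (\<integral>\<^sup>+x. w x * enn_powr (enn_powr (m x) (p-1) * inverse (w x)) q \<partial>M)"
    by (intro nn_integral_density) auto
  also have "\<dots> = (\<integral>\<^sup>+x. s x * enn_powr (m x) p \<partial>M)"
    using ws
  proof (intro nn_integral_cong_AE, elim AE_mp, intro AE_I2 impI)
    fix x assume *: "0 < w x \<and> w x < top \<and> 0 < s x \<and> s x < top \<and> w x * enn_powr (s x) (p - 1) = 1"
    then have iw: "inverse (w x) = enn_powr (s x) (p-1)" 
      by (metis divide_ennreal_def ennreal_mult_divide_eq less_irrefl mult.commute mult_1)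
    \<comment> \<open>Since 1/w = s^(p-1) and (p-1) q = p, the integrand is (w s^(p-1)) (s m^p),
      whose first factor is 1. The outer bound for w dM with exponent q thus meets the inner one for
      s dM with exponent p.\<close>
    have "w x * enn_powr (enn_powr (m x) (p-1) * inverse (w x)) q = w x * (enn_powr (m x) p * enn_powr (s x) p)"
      unfolding iw using p q by (simp add: enn_powr_mult enn_powr_powr)
    also have "enn_powr (s x) p = enn_powr (s x) (p-1) * s x" using p enn_powr_add[of "p-1" 1 "s x"] by simp
    also have "w x * (enn_powr (m x) p * (enn_powr (s x) (p-1) * s x)) = (w x * enn_powr (s x) (p-1)) * (s x * enn_powr (m x) p)"
      by (simp only: mult_ac)
    finally show "w x * enn_powr (enn_powr (m x) (p-1) * inverse (w x)) q = s x * enn_powr (m x) p" using * by simp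
  qed
  also have "\<dots> = (\<integral>\<^sup>+x. enn_powr (m x) p \<partial>density M s)" by (subst nn_integral_density) auto
  finally have c3: "(\<integral>\<^sup>+x. enn_powr (enn_powr (m x) (p-1) * inverse (w x)) q \<partial>density M w) = (\<integral>\<^sup>+x. enn_powr (m x) p \<partial>density M s)" .
  have c4: "(\<integral>\<^sup>+x. enn_powr (m x) p \<partial>density M s) \<le> K_strong p * (\<integral>\<^sup>+x. enn_powr (f x * inverse (s x)) p \<partial>density M s)"
    unfolding m_def K_strong_def by (rule strong_type[OF sfs]) (use S p in auto)
  have "(\<integral>\<^sup>+x. enn_powr (f x * inverse (s x)) p \<partial>density M s) = (\<integral>\<^sup>+x. s x * enn_powr (f x * inverse (s x)) p \<partial>M)"
    by (intro nn_integral_density) auto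
  also have "\<dots> = p_integral M p w f"
    using ws
  proof (intro nn_integral_cong_AE, elim AE_mp, intro AE_I2 impI)
    fix x assume *: "0 < w x \<and> w x < top \<and> 0 < s x \<and> s x < top \<and> w x * enn_powr (s x) (p - 1) = 1"
    have s1: "s x * inverse (s x) = 1" using * by (metis ennreal_divide_self divide_ennreal_def less_irrefl)
    have s2: "enn_powr (s x) (p-1) * enn_powr (inverse (s x)) (p-1) = 1" using s1 p by (simp add: enn_powr_mult[symmetric])
    have "w x = w x * (enn_powr (s x) (p-1) * enn_powr (inverse (s x)) (p-1))" using s2 by simp
    also have "\<dots> = enn_powr (inverse (s x)) (p-1)" using * by (simp add: mult.assoc[symmetric])
    finally have wi: "w x = enn_powr (inverse (s x)) (p-1)" .
    have "s x * enn_powr (f x * inverse (s x)) p = s x * (enn_powr (f x) p * enn_powr (inverse (s x)) p)" using p by (simp add: enn_powr_mult)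
    also have "enn_powr (inverse (s x)) p = w x * inverse (s x)" using p enn_powr_add[of "p-1" 1 "inverse (s x)"] wi by simp
    also have "s x * (enn_powr (f x) p * (w x * inverse (s x))) = (s x * inverse (s x)) * (enn_powr (f x) p * w x)" by (simp only: mult_ac)
    finally show "s x * enn_powr (f x * inverse (s x)) p = enn_powr (f x) p * w x" using s1 by simp
  qed
  finally have c5: "(\<integral>\<^sup>+x. enn_powr (f x * inverse (s x)) p \<partial>density M s) = p_integral M p w f" .
  note c1
  also have "enn_powr A q * (\<integral>\<^sup>+x. enn_powr (N x) q \<partial>density M w) \<le> enn_powr A q * (K_strong q * (K_strong p * p_integral M p w f))"
    by (intro mult_left_mono order.trans[OF c2]) (use c3 c4 c5 in auto)
  finally show ?thesis by (simp add: q_def mult_ac)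
qed

section \<open>Extrapolation\<close>

lemma suminf_Suc_le: "(\<Sum>k. f (Suc k)) \<le> (\<Sum>k. f k :: ennreal)"
proof (rule suminf_le_const)
  fix n
  have "(\<Sum>k<n. f (Suc k)) \<le> (\<Sum>k<Suc n. f k)" unfolding sum.lessThan_Suc_shift by simp
  also have "\<dots> \<le> (\<Sum>k. f k)" by (rule sum_le_suminf) auto
  finally show "(\<Sum>k<n. f (Suc k)) \<le> (\<Sum>k. f k)" .
qed auto

text \<open>Rubio de Francia's algorithm: the Neumann series \<open>\<Sum>k. M\<^sup>k g / (2 b)\<^sup>k\<close> is an \<open>A\<^sub>1\<close> majorant of g.\<close>

lemma rubio_de_francia:
  assumes S: "countable S" "S \<subseteq> sets M" and p: "1 < p" and g[measurable]: "g \<in> borel_measurable M"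
    and [measurable]: "w \<in> borel_measurable M" and b: "0 < b"
    and bound: "\<And>f. f \<in> borel_measurable M \<Longrightarrow>
      p_integral M p w (maxfn M S f) \<le> ennreal (b powr p) * p_integral M p w f"
  obtains H where "H \<in> borel_measurable M" "\<And>x. g x \<le> H x" "\<And>x. maxfn M S H x \<le> ennreal (2*b) * H x"
    "p_integral M p w H \<le> ennreal (2 powr p) * p_integral M p w g"
proof -
  define F where "F k = (maxfn M S ^^ k) g" for k
  have F[measurable]: "F k \<in> borel_measurable M" for k
    by (induction k) (auto simp: F_def intro: maxfn_measurable[OF S refl])
  have F0: "F 0 = g" and FS: "F (Suc k) = maxfn M S (F k)" for k by (auto simp: F_def)
  \<comment> \<open>The p-th root of the weighted integral of \<open>F k\<close> is at most b^k
    times that of g, so the coefficients (1/(2b))^k leave a geometric series of ratio 1/2.\<close>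
  define c where "c = 1/(2*b)"
  have c: "0 < c" using b by (simp add: c_def)
  define H where "H x = (\<Sum>k. ennreal (c^k) * F k x)" for x
  have [measurable]: "H \<in> borel_measurable M" unfolding H_def by measurable
  have Fb: "p_integral M p w (F k) \<le> ennreal ((b powr p)^k) * p_integral M p w g" for k
  proof (induction k)
    case (Suc k)
    have "p_integral M p w (F (Suc k)) \<le> ennreal (b powr p) * p_integral M p w (F k)"
      unfolding FS by (rule bound) simp
    also have "\<dots> \<le> ennreal (b powr p) * (ennreal ((b powr p)^k) * p_integral M p w g)"
      by (intro mult_left_mono Suc) auto
    finally show ?case by (simp add: ennreal_mult mult.assoc)
  qed (simp add: F0)
  show thesis
  proof (rule that)
    show "H \<in> borel_measurable M" by simp
    show "g x \<le> H x" for x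
      using sum_le_suminf[of "\<lambda>k. ennreal (c^k) * F k x" "{0}"] unfolding H_def by (simp add: F0)
    show "maxfn M S H x \<le> ennreal (2*b) * H x" for x
    proof -
      have "maxfn M S H x \<le> (\<Sum>k. maxfn M S (\<lambda>y. ennreal (c^k) * F k y) x)"
        unfolding H_def by (rule maxfn_suminf_le) (use S in auto)
      also have "\<dots> = (\<Sum>k. ennreal (2*b) * (ennreal (c^Suc k) * F (Suc k) x))"
      proof (intro arg_cong[where f=suminf] ext)
        fix k
        have "ennreal (c^k) = ennreal (2*b) * ennreal (c^Suc k)"
          using b by (subst ennreal_mult[symmetric]) (auto simp: c_def)
        then show "maxfn M S (\<lambda>y. ennreal (c^k) * F k y) x = ennreal (2*b) * (ennreal (c^Suc k) * F (Suc k) x)"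
          using S by (subst maxfn_cmult) (auto simp: FS mult.assoc simp del: power_Suc)
      qed
      also have "\<dots> = ennreal (2*b) * (\<Sum>k. ennreal (c^Suc k) * F (Suc k) x)" by (simp del: power_Suc)
      also have "\<dots> \<le> ennreal (2*b) * H x"
        unfolding H_def by (intro mult_left_mono suminf_Suc_le[where f="\<lambda>k. ennreal (c^k) * F k x"]) simp
      finally show ?thesis .
    qed
    have "p_integral M p w H \<le> (\<integral>\<^sup>+x. (\<Sum>k. ennreal ((1/2)^Suc k) * (ennreal (2 powr p * (b powr -p)^k) * (enn_powr (F k x) p * w x))) \<partial>M)"
    proof (rule nn_integral_mono)
      fix x
      \<comment> \<open>The coefficient c^k is split into 2^-(k+1), the Jensen weight, and 2 b^-k.
        The latter is compensated by the growth of the integrals of \<open>F k\<close>, so that only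
        the factor 2 powr p survives.\<close>
      have "H x = (\<Sum>k. ennreal ((1/2)^Suc k) * (ennreal (2 * (1/b)^k) * F k x))"
        unfolding H_def mult.assoc[symmetric] using b
        by (intro arg_cong[where f=suminf] ext, subst ennreal_mult[symmetric]) (auto simp: c_def power_divide power_mult_distrib)
      then have "enn_powr (H x) p \<le> (\<Sum>k. ennreal ((1/2)^Suc k) * enn_powr (ennreal (2 * (1/b)^k) * F k x) p)"
        using enn_powr_suminf_geometric_le[OF p] by metis
      also have "\<dots> = (\<Sum>k. ennreal ((1/2)^Suc k) * (ennreal (2 powr p * (b powr -p)^k) * enn_powr (F k x) p))"
      proof (intro arg_cong[where f=suminf] ext arg_cong2[where f="(*)"] refl)
        fix k
        have "(2 * (1/b)^k) powr p = 2 powr p * (b powr -p)^k"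
          using b by (simp add: powr_mult powr_power powr_minus power_one_over powr_powr flip: powr_realpow)
            (simp add: field_simps powr_minus powr_divide powr_powr)
        then show "enn_powr (ennreal (2 * (1/b)^k) * F k x) p = ennreal (2 powr p * (b powr -p)^k) * enn_powr (F k x) p"
          using p b by (simp add: enn_powr_mult)
      qed
      finally have "enn_powr (H x) p * w x \<le> (\<Sum>k. ennreal ((1/2)^Suc k) * (ennreal (2 powr p * (b powr -p)^k) * enn_powr (F k x) p)) * w x"
        by (rule mult_right_mono) simp
      then show "enn_powr (H x) p * w x \<le> (\<Sum>k. ennreal ((1/2)^Suc k) * (ennreal (2 powr p * (b powr -p)^k) * (enn_powr (F k x) p * w x)))"
        by (simp only: ennreal_suminf_multc[symmetric] mult.assoc)
    qed
    also have "\<dots> = (\<Sum>k. ennreal ((1/2)^Suc k) * (ennreal (2 powr p * (b powr -p)^k) * p_integral M p w (F k)))"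
      by (simp add: nn_integral_suminf nn_integral_cmult del: power_Suc)
    also have "\<dots> \<le> (\<Sum>k. ennreal ((1/2)^Suc k) * (ennreal (2 powr p) * p_integral M p w g))"
    proof (intro suminf_le mult_left_mono)
      fix k
      have "ennreal (2 powr p * (b powr -p)^k) * p_integral M p w (F k)
        \<le> ennreal (2 powr p * (b powr -p)^k) * (ennreal ((b powr p)^k) * p_integral M p w g)"
        by (intro mult_left_mono Fb) auto
      also have "\<dots> = ennreal (2 powr p * (b powr -p)^k * (b powr p)^k) * p_integral M p w g"
        by (simp add: ennreal_mult mult.assoc)
      also have "2 powr p * (b powr -p)^k * (b powr p)^k = 2 powr p"
        using b by (simp add: mult.assoc powr_minus power_inverse)
      finally show "ennreal (2 powr p * (b powr -p)^k) * p_integral M p w (F k) \<le> ennreal (2 powr p) * p_integral M p w g" .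
    qed auto
    also have "\<dots> = ennreal (2 powr p) * p_integral M p w g"
    proof -
      have "(\<Sum>k. ennreal ((1/2)^Suc k)) = 1"
        using power_half_series by (subst suminf_ennreal_eq[where x=1]) auto
      then show ?thesis by (simp only: ennreal_suminf_multc mult_1)
    qed
    finally show "p_integral M p w H \<le> ennreal (2 powr p) * p_integral M p w g" .
  qed
qed

section \<open>The weighted inequality for exponent 2 and its passage to exponent p\<close>

lemma ennreal_pos_finite_cases:
  assumes "0 < x" "x < top"
  obtains r where "x = ennreal r" "0 < r"
  using assms by (cases x) auto

lemma ennreal_mult_inverse_self: "0 < x \<Longrightarrow> x < top \<Longrightarrow> x * inverse x = (1::ennreal)"
  by (metis ennreal_divide_self divide_ennreal_def less_irrefl)

lemma ennreal_inverse_antimono: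
  fixes x y :: ennreal
  assumes "x \<le> y"
  shows "inverse y \<le> inverse x"
proof (cases "x = 0 \<or> y = top")
  case False
  then have "0 < x" "y < top" by (auto simp: less_top zero_less_iff_neq_zero)
  then obtain r t where "x = ennreal r" "0 < r" "y = ennreal t" "0 < t"
    by (meson assms ennreal_pos_finite_cases order.strict_trans1 order.strict_trans2)
  then show ?thesis using assms by (simp add: inverse_ennreal ennreal_le_iff)
qed auto

text \<open>With m an average and u a value of an A_1 weight, this turns the A_1 condition into an
  upper bound for the reciprocal of the weight.\<close>

lemma mult_inverse_le_imp_inverse_le:
  fixes m u :: ennreal
  assumes "m \<le> a * u" "0 < a" "a < top"
  shows "inverse u \<le> a * inverse m"
proof -
  have "inverse (a * u) \<le> inverse m" using assms(1) by (rule ennreal_inverse_antimono)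
  moreover have "inverse u = a * inverse (a * u)"
  proof (cases "u = 0 \<or> u = top")
    case True then show ?thesis using assms by (auto simp: ennreal_mult_top ennreal_top_mult)
  next
    case False
    obtain t where "a = ennreal t" "0 < t" using assms(2,3) by (rule ennreal_pos_finite_cases)
    moreover obtain r where "u = ennreal r" "0 < r" 
      using False by (meson ennreal_pos_finite_cases less_top zero_less_iff_neq_zero)
    ultimately show ?thesis by (simp add: ennreal_mult[symmetric] inverse_ennreal)
  qed
  ultimately show ?thesis by (simp add: mult_left_mono)
qed

text \<open>A quotient U/H of two A_1 weights is an A_2 weight, the easy half of the factorisation
  theorem. The dual weight for exponent 2 is H/U. On a set I each reciprocal is bounded by a
  multiple of the reciprocal average, and the integrals of U and H cancel in the product, which
  leaves the A_2 constant a b.\<close>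

lemma weighted_L2:
  assumes M: "sigma_finite_measure M" and f[measurable]: "f \<in> borel_measurable M"
    and S: "countable S" "S \<subseteq> sets M" "thinnable S"
    and pos: "\<And>I. I \<in> S \<Longrightarrow> 0 < emeasure M I \<and> emeasure M I < top"
    and [measurable]: "H \<in> borel_measurable M" "U \<in> borel_measurable M"
    and fin: "AE x in M. 0 < H x \<and> H x < top \<and> 0 < U x \<and> U x < top"
    and a: "0 < a" "a < top" "\<And>x. maxfn M S H x \<le> a * H x"
    and b: "0 < b" "b < top" "\<And>x. maxfn M S U x \<le> b * U x"
  shows "(\<integral>\<^sup>+x. (maxfn M S f x)\<^sup>2 * (U x * inverse (H x)) \<partial>M)
    \<le> (a*b)\<^sup>2 * K_strong 2 * K_strong 2 * (\<integral>\<^sup>+x. (f x)\<^sup>2 * (U x * inverse (H x)) \<partial>M)"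
proof -
  \<comment> \<open>On I the average of G is at most its maximal function, hence at most c G. So 1/G
    may be replaced by c over that average, which is constant on I.\<close>
  have half: "(\<integral>\<^sup>+x\<in>I. V x * inverse (G x) \<partial>M) \<le> c * inverse (mean_on M G I) * (\<integral>\<^sup>+x\<in>I. V x \<partial>M)"
    if [measurable]: "V \<in> borel_measurable M" "I \<in> sets M" and "I \<in> S" "0 < c" "c < top" "\<And>x. maxfn M S G x \<le> c * G x" for V G c I
  proof -
    have "(\<integral>\<^sup>+x\<in>I. V x * inverse (G x) \<partial>M) \<le> (\<integral>\<^sup>+x\<in>I. V x * (c * inverse (mean_on M G I)) \<partial>M)"
    proof (rule nn_integral_mono)
      fix x
      show "V x * inverse (G x) * indicator I x \<le> V x * (c * inverse (mean_on M G I)) * indicator I x"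
        using that mean_le_maxfn[of I S x M G]
        by (cases "x \<in> I") (auto intro!: mult_left_mono mult_inverse_le_imp_inverse_le intro: order.trans)
    qed
    also have "\<dots> = (\<integral>\<^sup>+x. (c * inverse (mean_on M G I)) * (V x * indicator I x) \<partial>M)"
      by (intro nn_integral_cong) (simp only: mult_ac)
    also have "\<dots> = c * inverse (mean_on M G I) * (\<integral>\<^sup>+x\<in>I. V x \<partial>M)"
      by (subst nn_integral_cmult) auto
    finally show ?thesis .
  qed
  \<comment> \<open>An infinite integral over I would make the average infinite, and the A_1
    condition would force c G = top on all of I, although G is finite almost everywhere and I has
    positive measure.\<close>
  have mean_fin: "0 < (\<integral>\<^sup>+x\<in>I. G x \<partial>M) \<and> (\<integral>\<^sup>+x\<in>I. G x \<partial>M) < top"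
    if [measurable]: "G \<in> borel_measurable M" and I: "I \<in> S" and "AE x in M. 0 < G x \<and> G x < top" "c < top" "\<And>x. maxfn M S G x \<le> c * G x" for G c I
  proof
    have [measurable]: "I \<in> sets M" using I S by auto
    show "0 < (\<integral>\<^sup>+x\<in>I. G x \<partial>M)"
      using pos[OF I] that(3) by (intro set_nn_integral_pos) (auto elim: AE_mp)
    show "(\<integral>\<^sup>+x\<in>I. G x \<partial>M) < top"
    proof (rule ccontr)
      assume "\<not> (\<integral>\<^sup>+x\<in>I. G x \<partial>M) < top"
      then have "mean_on M G I = top" using pos[OF I] 
        by (auto simp: mean_on_def less_top[symmetric] top_unique ennreal_top_divide)
      then have *: "c * G x = top" if "x \<in> I" for x
        using mean_le_maxfn[OF I that, of M G] \<open>maxfn M S G x \<le> c * G x\<close> by (auto simp: top_unique)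
      have "AE x in M. x \<notin> I" using that(3) *
      proof (elim AE_mp, intro AE_I2 impI notI)
        fix x assume "0 < G x \<and> G x < top" "x \<in> I" 
        then have "c * G x < top" using that(4) by (auto simp: ennreal_mult_less_top)
        then show False using *[OF \<open>x \<in> I\<close>] by simp
      qed
      moreover have "{x \<in> space M. \<not> x \<notin> I} = I" using sets.sets_into_space[of I M] by auto
      ultimately show False using pos[OF I] AE_iff_measurable[of I M "\<lambda>x. x \<notin> I"] by simp
    qed
  qed
  have finH: "AE x in M. 0 < H x \<and> H x < top" and finU: "AE x in M. 0 < U x \<and> U x < top"
    using fin by (auto elim: AE_mp)
  have pw: "enn_powr x 2 = x\<^sup>2" for x by (rule enn_powr_2)
  have "(\<integral>\<^sup>+x. enn_powr (maxfn M S f x) 2 * (U x * inverse (H x)) \<partial>M)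
    \<le> enn_powr (a*b) (2/(2-1)) * K_strong (2/(2-1)) * K_strong 2 * (\<integral>\<^sup>+x. enn_powr (f x) 2 * (U x * inverse (H x)) \<partial>M)"
  proof (rule muckenhoupt[OF M f S, where s="\<lambda>x. H x * inverse (U x)"])
    show "AE x in M. 0 < U x * inverse (H x) \<and> U x * inverse (H x) < top \<and> 0 < H x * inverse (U x) \<and> H x * inverse (U x) < top
      \<and> U x * inverse (H x) * enn_powr (H x * inverse (U x)) (2 - 1) = 1"
      using fin
    proof (elim AE_mp, intro AE_I2 impI)
      fix x assume *: "0 < H x \<and> H x < top \<and> 0 < U x \<and> U x < top"
      have "U x * inverse (H x) * (H x * inverse (U x)) = (U x * inverse (U x)) * (H x * inverse (H x))" by (simp only: mult_ac)
      then have 1: "U x * inverse (H x) * (H x * inverse (U x)) = 1" using * by (simp add: ennreal_mult_inverse_self)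
      obtain r where "H x = ennreal r" "0 < r" using * by (meson ennreal_pos_finite_cases)
      moreover obtain t where "U x = ennreal t" "0 < t" using * by (meson ennreal_pos_finite_cases)
      ultimately show "0 < U x * inverse (H x) \<and> U x * inverse (H x) < top \<and> 0 < H x * inverse (U x) \<and> H x * inverse (U x) < top
        \<and> U x * inverse (H x) * enn_powr (H x * inverse (U x)) (2 - 1) = 1"
        using 1 by (simp add: inverse_ennreal ennreal_mult[symmetric])
    qed
    show "a * b < top" using a b by (simp add: ennreal_mult_less_top)
    fix I assume I: "I \<in> S"
    show "0 < emeasure M I \<and> emeasure M I < top" by (rule pos[OF I])
    have [measurable]: "I \<in> sets M" using I S by auto
    define mu u h where "mu = emeasure M I" and "u = (\<integral>\<^sup>+x\<in>I. U x \<partial>M)" and "h = (\<integral>\<^sup>+x\<in>I. H x \<partial>M)"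
    have hu: "0 < h" "h < top" "0 < u" "u < top"
      using mean_fin[of H I a] mean_fin[of U I b] a b I finH finU unfolding u_def h_def by auto
    have imh: "inverse (mean_on M H I) = mu * inverse h" and imu: "inverse (mean_on M U I) = mu * inverse u"
    proof -
      have "inverse (t / mu) = mu * inverse t" if "0 < t" "t < top" for t
      proof -
        obtain r where "t = ennreal r" "0 < r" using \<open>0 < t\<close> \<open>t < top\<close> by (rule ennreal_pos_finite_cases)
        moreover obtain m where "mu = ennreal m" "0 < m"
          using pos[OF I] unfolding mu_def by (meson ennreal_pos_finite_cases)
        ultimately show ?thesis by (simp add: divide_ennreal inverse_ennreal ennreal_mult[symmetric] field_simps)
      qed
      then show "inverse (mean_on M H I) = mu * inverse h" "inverse (mean_on M U I) = mu * inverse u"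
        using hu by (auto simp: mean_on_def h_def u_def mu_def)
    qed
    have "(\<integral>\<^sup>+x\<in>I. U x * inverse (H x) \<partial>M) * (\<integral>\<^sup>+x\<in>I. H x * inverse (U x) \<partial>M)
      \<le> (a * (mu * inverse h) * u) * (b * (mu * inverse u) * h)"
    proof (intro mult_mono)
      show "(\<integral>\<^sup>+x\<in>I. U x * inverse (H x) \<partial>M) \<le> a * (mu * inverse h) * u"
        using half[of U I a H] I a by (simp add: imh flip: u_def)
      show "(\<integral>\<^sup>+x\<in>I. H x * inverse (U x) \<partial>M) \<le> b * (mu * inverse u) * h"
        using half[of H I b U] I b by (simp add: imu flip: h_def)
    qed auto
    also have "\<dots> = a * b * mu\<^sup>2 * (h * inverse h) * (u * inverse u)" by (simp only: mult_ac power2_eq_square)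
    also have "\<dots> = a * b * mu\<^sup>2" using hu by (simp add: ennreal_mult_inverse_self)
    finally show "(\<integral>\<^sup>+x\<in>I. U x * inverse (H x) \<partial>M) * enn_powr (\<integral>\<^sup>+x\<in>I. H x * inverse (U x) \<partial>M) (2-1) \<le> a * b * enn_powr (emeasure M I) 2"
      by (simp add: pw mu_def)
  qed (use assms in auto)
  then show ?thesis by (simp add: pw)
qed

text \<open>Repackages the constant as b powr p with b > 0, the form in which the majorant
  construction takes its hypothesis. Adding 1 to the real value of the constant guarantees b >
  0.\<close>

lemma muckenhoupt_real:
  fixes M :: "'a measure"
  assumes "sigma_finite_measure M"
    and S: "countable S" "S \<subseteq> sets M" "thinnable S" and p: "1 < p"
    and w: "w \<in> borel_measurable M" and s: "s \<in> borel_measurable M"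
    and ws: "AE x in M. 0 < w x \<and> w x < top \<and> 0 < s x \<and> s x < top \<and> w x * enn_powr (s x) (p-1) = 1"
    and pos: "\<And>I. I \<in> S \<Longrightarrow> 0 < emeasure M I \<and> emeasure M I < top"
    and A: "A < top" "\<And>I. I \<in> S \<Longrightarrow> (\<integral>\<^sup>+x\<in>I. w x \<partial>M) * enn_powr (\<integral>\<^sup>+x\<in>I. s x \<partial>M) (p-1) \<le> A * enn_powr (emeasure M I) p"
  obtains b where "0 < b" "\<And>f. f \<in> borel_measurable M \<Longrightarrow>
      p_integral M p w (maxfn M S f) \<le> ennreal (b powr p) * p_integral M p w f"
proof -
  define c where "c = enn_powr A (p/(p-1)) * K_strong (p/(p-1)) * K_strong p"
  have "c < top" using A p by (simp add: c_def ennreal_mult_less_top enn_powr_less_top_iff)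
  define b where "b = (enn2real c + 1) powr (1/p)"
  have "0 < enn2real c + 1" by (simp add: add_nonneg_pos)
  then have bp: "0 < b" "b powr p = enn2real c + 1" using p by (auto simp: b_def powr_powr)
  have cb: "c \<le> ennreal (b powr p)"
    using \<open>c < top\<close> unfolding bp by (cases c) (auto intro!: ennreal_leI)
  show thesis
  proof (rule that[OF bp(1)])
    fix f :: "'a \<Rightarrow> ennreal" assume "f \<in> borel_measurable M"
    from muckenhoupt[OF assms(1) this S p w s ws, of A] pos A
    have "p_integral M p w (maxfn M S f) \<le> c * p_integral M p w f"
      by (simp add: c_def)
    also have "\<dots> \<le> ennreal (b powr p) * p_integral M p w f"
      using cb by (rule mult_right_mono) simp
    finally show "p_integral M p w (maxfn M S f) \<le> ennreal (b powr p) * p_integral M p w f" .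
  qed
qed

text \<open>Duality of Muckenhoupt classes: raising the A_p condition for w to the power q - 1 =
  1/(p-1) gives the A_q condition for s, with w as its dual weight.\<close>

lemma muckenhoupt_dual_real:
  assumes M: "sigma_finite_measure M"
    and S: "countable S" "S \<subseteq> sets M" "thinnable S" and p: "1 < p"
    and w: "w \<in> borel_measurable M" and s: "s \<in> borel_measurable M"
    and ws: "AE x in M. 0 < w x \<and> w x < top \<and> 0 < s x \<and> s x < top \<and> w x * enn_powr (s x) (p-1) = 1"
    and pos: "\<And>I. I \<in> S \<Longrightarrow> 0 < emeasure M I \<and> emeasure M I < top"
    and A: "A < top" "\<And>I. I \<in> S \<Longrightarrow> (\<integral>\<^sup>+x\<in>I. w x \<partial>M) * enn_powr (\<integral>\<^sup>+x\<in>I. s x \<partial>M) (p-1) \<le> A * enn_powr (emeasure M I) p"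
    and q: "q = p/(p-1)"
  obtains b where "0 < b" "\<And>f. f \<in> borel_measurable M \<Longrightarrow>
      p_integral M q s (maxfn M S f) \<le> ennreal (b powr q) * p_integral M q s f"
proof -
  have q1: "1 < q" "q - 1 = 1/(p-1)" "p * (q-1) = q" "0 < q - 1" using p by (auto simp: q field_simps)
  have dual: "enn_powr (x * enn_powr y (p-1)) (q-1) = y * enn_powr x (q-1)" for x y
  proof -
    have "enn_powr (x * enn_powr y (p-1)) (q-1) = enn_powr x (q-1) * enn_powr (enn_powr y (p-1)) (q-1)"
      using q1 by (intro enn_powr_mult) auto
    also have "enn_powr (enn_powr y (p-1)) (q-1) = y" using q1 p by (simp add: enn_powr_powr)
    finally show ?thesis by (simp add: mult.commute)
  qed
  show thesis
  proof (rule muckenhoupt_real[OF M S q1(1) s w _ pos])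
    show "AE x in M. 0 < s x \<and> s x < top \<and> 0 < w x \<and> w x < top \<and> s x * enn_powr (w x) (q - 1) = 1"
      using ws by (elim AE_mp, intro AE_I2 impI) (metis dual enn_powr_one)
    show "enn_powr A (q-1) < top" using A q1 by (simp add: enn_powr_less_top_iff)
    show "(\<integral>\<^sup>+x\<in>I. s x \<partial>M) * enn_powr (\<integral>\<^sup>+x\<in>I. w x \<partial>M) (q-1) \<le> enn_powr A (q-1) * enn_powr (emeasure M I) q" if "I \<in> S" for I
    proof -
      have "enn_powr ((\<integral>\<^sup>+x\<in>I. w x \<partial>M) * enn_powr (\<integral>\<^sup>+x\<in>I. s x \<partial>M) (p-1)) (q-1) \<le> enn_powr (A * enn_powr (emeasure M I) p) (q-1)"
        using A(2)[OF that] q1 by (intro enn_powr_mono) auto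
      then show ?thesis using q1 p by (simp add: dual enn_powr_mult enn_powr_powr mult.commute)
    qed
  qed (use that in auto)
qed

text \<open>The sum is at most J times its largest term. The bound degenerates as J grows; it is
  used only to see that the integral for a finite partial sum is finite.\<close>

lemma enn_powr_sum_le:
  fixes y :: "nat \<Rightarrow> ennreal"
  assumes a: "0 < a"
  shows "enn_powr (\<Sum>j<J. y j) a \<le> ennreal (real J powr a) * (\<Sum>j<J. enn_powr (y j) a)"
proof (cases "J = 0")
  case False
  define m where "m = Max (y ` {..<J})"
  have "m \<in> y ` {..<J}" unfolding m_def using False by (intro Max_in) auto
  then obtain i where i: "i < J" "m = y i" by auto
  have "(\<Sum>j<J. y j) \<le> of_nat (card {..<J}) * m"
    by (intro sum_bounded_above) (auto simp: m_def)
  then have "enn_powr (\<Sum>j<J. y j) a \<le> enn_powr (ennreal (real J) * y i) a"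
    using a i by (intro enn_powr_mono) (auto simp: ennreal_of_nat_eq_real_of_nat)
  also have "\<dots> = ennreal (real J powr a) * enn_powr (y i) a" using a by (simp add: enn_powr_mult)
  also have "\<dots> \<le> ennreal (real J powr a) * (\<Sum>j<J. enn_powr (y j) a)"
    using i by (intro mult_left_mono member_le_sum) auto
  finally show ?thesis .
qed simp

text \<open>Because X is finite, X/2 may be subtracted from both sides; this leaves X <= 2 K (G + d)
  + d. The coefficient h is a variable so that the hypothesis can be supplied with an unsimplified
  coefficient.\<close>

lemma absorb_half:
  fixes X G d :: ennreal
  assumes "X \<le> ennreal K * (G + d) + ennreal h * (X + d)" "X < top" "0 \<le> K" and h: "h = 1/2"
  shows "X \<le> ennreal (2*K+1) * (G + d)"
proof (cases "G = top \<or> d = top")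
  case True
  have "ennreal (2*K+1) \<noteq> 0" using assms by (simp add: ennreal_eq_0_iff)
  then show ?thesis using True by (auto simp: ennreal_mult_top)
next
  case False
  have "0 \<le> h" using h by simp
  from False obtain x g e where r: "X = ennreal x" "0 \<le> x" "G = ennreal g" "0 \<le> g" "d = ennreal e" "0 \<le> e"
    using assms(2) by (cases X; cases G; cases d) auto
  have "x \<le> K * (g + e) + h * (x + e)"
    using assms(1,3) r \<open>0 \<le> h\<close> by (simp add: ennreal_mult[symmetric] ennreal_plus[symmetric] ennreal_le_iff del: ennreal_plus)
  moreover have "x \<le> Z" if "x \<le> Y + h * (x + e)" "Z = 2 * Y + (g + e)" for Y Z
    using that r(4) unfolding h by argo
  moreover have "(2*K+1) * (g+e) = 2 * (K * (g+e)) + (g+e)" by (simp add: algebra_simps)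
  ultimately have "x \<le> (2*K+1) * (g+e)" by blast
  then show ?thesis using assms(3) r
    by (simp add: ennreal_mult[symmetric] ennreal_plus[symmetric] ennreal_le_iff del: ennreal_plus)
qed

text \<open>Let P be a finite partial sum of the squared maximal functions. The A_1 majorants are H,
  above the square root of G and controlled in L^p(w), and U, above P^((p-1)/2) w and controlled in
  L^q(s). The exponent-2 inequality with weight U/H can be summed over j and bounds the integral of
  P U/H by that of G U/H, hence by that of H U. Young's inequality splits the integral of H U into a
  part with G and a small multiple of the quantity to be estimated, which is absorbed.\<close>

theorem vector_valued_muckenhoupt:
  assumes M: "sigma_finite_measure M"
    and S: "countable S" "S \<subseteq> sets M" "thinnable S" and p: "1 < p"
    and w[measurable]: "w \<in> borel_measurable M" and s[measurable]: "s \<in> borel_measurable M"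
    and ws: "AE x in M. 0 < w x \<and> w x < top \<and> 0 < s x \<and> s x < top \<and> w x * enn_powr (s x) (p-1) = 1"
    and pos: "\<And>I. I \<in> S \<Longrightarrow> 0 < emeasure M I \<and> emeasure M I < top"
    and A: "A < top" "\<And>I. I \<in> S \<Longrightarrow> (\<integral>\<^sup>+x\<in>I. w x \<partial>M) * enn_powr (\<integral>\<^sup>+x\<in>I. s x \<partial>M) (p-1) \<le> A * enn_powr (emeasure M I) p"
  obtains C :: real where "0 < C" "\<And>F :: nat \<Rightarrow> 'a \<Rightarrow> ennreal. (\<And>j. F j \<in> borel_measurable M) \<Longrightarrow>
      sq_integral M p w (\<lambda>j. maxfn M S (F j))
        \<le> ennreal C * sq_integral M p w F"
proof -
  interpret sigma_finite_measure M by fact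
  define q where "q = p/(p-1)"
  have q: "1 < q" "(p-1) * q = p" "p/q = p - 1" "1/p + 1/q = 1" "p/(p-1) = q" using p by (auto simp: q_def field_simps)
  have pq: "(p-1) * (q-1) = 1" using p by (simp add: q_def field_simps)
  obtain b1 where b1: "0 < b1" "\<And>f. f \<in> borel_measurable M \<Longrightarrow>
      p_integral M p w (maxfn M S f) \<le> ennreal (b1 powr p) * p_integral M p w f"
    using muckenhoupt_real[OF M S p w s ws pos A] by blast
  obtain b2 where b2: "0 < b2" "\<And>f. f \<in> borel_measurable M \<Longrightarrow>
      p_integral M q s (maxfn M S f) \<le> ennreal (b2 powr q) * p_integral M q s f"
    using muckenhoupt_dual_real[OF M S p w s ws pos A q_def] by blast
  define D where "D = (ennreal (2*b1) * ennreal (2*b2))\<^sup>2 * K_strong 2 * K_strong 2"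
  have "D < top" by (simp add: D_def ennreal_mult_less_top power2_eq_square)
  then obtain d where d: "D = ennreal d" "0 \<le> d" by (cases D) auto
  \<comment> \<open>Balances Young's inequality: with this l the coefficient in front of the unknown
    integral is exactly 1/2.\<close>
  define l where "l = 2 * (2 * (d+1)) powr (1/q)"
  have l: "0 < l" using d by (simp add: l_def)
  have lq: "(d+1) * ((1/l) powr q * 2 powr q) = 1/2"
  proof -
    have "l powr q = 2 powr q * (2 * (d+1))" using d q by (simp add: l_def powr_mult powr_powr)
    then show ?thesis using d l by (simp add: powr_divide)
  qed
  define K where "K = (d+1) * (l powr p * 2 powr p)"
  have K: "0 \<le> K" using d by (simp add: K_def)
  \<comment> \<open>A strictly positive function integrable for w dM exists because that measure is
    sigma-finite.\<close>
  obtain X where X[measurable]: "X \<in> borel_measurable M" and Xfin: "(\<integral>\<^sup>+x. X x * w x \<partial>M) < top" and Xpos: "\<And>x. x \<in> space M \<Longrightarrow> 0 < X x \<and> X x < top"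
  proof -
    interpret W: sigma_finite_measure "density M w"
      using ws by (subst sigma_finite_iff_density_finite') (auto elim: AE_mp)
    obtain X where X: "X \<in> borel_measurable M" "integral\<^sup>N (density M w) X \<noteq> top" "\<forall>x\<in>space M. 0 < X x \<and> X x < top"
      using W.Ex_finite_integrable_function by auto
    show thesis by (rule that[OF X(1)]) (use X in \<open>auto simp: nn_integral_density less_top mult.commute\<close>)
  qed
  have wae: "AE x in M. 0 < w x \<and> w x < top" and sae: "AE x in M. 0 < s x \<and> s x < top" using ws by (auto elim: AE_mp)
  have fin_ae: "AE x in M. f x < top" if [measurable]: "f \<in> borel_measurable M" "v \<in> borel_measurable M"
      and "(\<integral>\<^sup>+x. enn_powr (f x) r * v x \<partial>M) < top" "0 < r" "AE x in M. 0 < v x \<and> v x < top" for f v and r :: real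
  proof -
    have "AE x in M. enn_powr (f x) r * v x \<noteq> \<infinity>"
      using that by (intro nn_integral_PInf_AE) (auto simp: less_top)
    with that(5) show ?thesis
    proof (elim AE_mp, intro AE_I2 impI)
      fix x assume "0 < v x \<and> v x < top" "enn_powr (f x) r * v x \<noteq> \<infinity>"
      then show "f x < top" using that(4) by (cases "f x") (auto simp: ennreal_top_mult zero_less_iff_neq_zero)
    qed
  qed
  show thesis
  proof (rule that[of "2*K+1"])
    show "0 < 2*K+1" using K by simp
    fix F :: "nat \<Rightarrow> 'a \<Rightarrow> ennreal" assume F[measurable]: "\<And>j. F j \<in> borel_measurable M"
    define G where "G x = (\<Sum>j. (F j x)\<^sup>2)" for x
    have [measurable]: "G \<in> borel_measurable M" unfolding G_def by measurable
    define IG where "IG = (\<integral>\<^sup>+x. enn_powr (G x) (p/2) * w x \<partial>M)"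
    have T[measurable]: "maxfn M S (F j) \<in> borel_measurable M" for j by (rule maxfn_measurable[OF S(1,2) refl])
    have main: "(\<integral>\<^sup>+x. enn_powr (\<Sum>j<J. (maxfn M S (F j) x)\<^sup>2) (p/2) * w x \<partial>M) \<le> ennreal (2*K+1) * IG" for J
    proof (cases "IG = top")
      case True
      have "ennreal (2*K+1) \<noteq> 0" using K by (simp add: ennreal_eq_0_iff)
      then show ?thesis using True by (simp add: ennreal_mult_top)
    next
      case False
      then have IGfin: "IG < top" by (simp add: less_top)
      define P where "P x = (\<Sum>j<J. (maxfn M S (F j) x)\<^sup>2)" for x
      have P[measurable]: "P \<in> borel_measurable M" unfolding P_def by measurable
      define IP where "IP = (\<integral>\<^sup>+x. enn_powr (P x) (p/2) * w x \<partial>M)"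
      have sqp: "enn_powr (y\<^sup>2) (p/2) = enn_powr y p" for y using p by (simp add: enn_powr_powr flip: enn_powr_2)
      have IPfin: "IP < top"
      proof -
        have "IP \<le> (\<integral>\<^sup>+x. (\<Sum>j<J. ennreal (real J powr (p/2)) * (enn_powr (maxfn M S (F j) x) p * w x)) \<partial>M)"
          unfolding IP_def
        proof (rule nn_integral_mono)
          fix x
          have "enn_powr (P x) (p/2) \<le> ennreal (real J powr (p/2)) * (\<Sum>j<J. enn_powr (maxfn M S (F j) x) p)"
            unfolding P_def using enn_powr_sum_le[of "p/2" "\<lambda>j. (maxfn M S (F j) x)\<^sup>2" J] p by (simp add: sqp)
          then have "enn_powr (P x) (p/2) * w x \<le> ennreal (real J powr (p/2)) * (\<Sum>j<J. enn_powr (maxfn M S (F j) x) p) * w x"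
            by (rule mult_right_mono) simp
          then show "enn_powr (P x) (p/2) * w x \<le> (\<Sum>j<J. ennreal (real J powr (p/2)) * (enn_powr (maxfn M S (F j) x) p * w x))"
            by (simp add: sum_distrib_left sum_distrib_right mult.assoc)
        qed
        also have "\<dots> = (\<Sum>j<J. ennreal (real J powr (p/2)) * p_integral M p w (maxfn M S (F j)))"
          by (simp add: nn_integral_sum nn_integral_cmult)
        also have "\<dots> < top"
        proof -
          have "p_integral M p w (maxfn M S (F j)) < top" for j
          proof -
            have "p_integral M p w (F j) \<le> IG"
              unfolding IG_def
            proof (intro nn_integral_mono mult_right_mono)
              fix x
              have "(F j x)\<^sup>2 \<le> G x" unfolding G_def using sum_le_suminf[of "\<lambda>j. (F j x)\<^sup>2" "{j}"] by simp
              then show "enn_powr (F j x) p \<le> enn_powr (G x) (p/2)" unfolding sqp[symmetric] using p by (intro enn_powr_mono) auto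
            qed simp
            then have "p_integral M p w (F j) < top" using IGfin by (rule order.strict_trans1)
            then have "ennreal (b1 powr p) * p_integral M p w (F j) < top" by (simp add: ennreal_mult_less_top)
            then show ?thesis using b1(2)[OF F] by (rule order.strict_trans1[rotated])
          qed
          then show ?thesis by (auto simp: ennreal_mult_less_top)
        qed
        finally show ?thesis .
      qed
      \<comment> \<open>Since IP is finite for finitely many functions, the part of the estimate containing it can be
        absorbed; adding a small multiple of X makes the weight U/H positive.\<close>
      have step: "IP \<le> ennreal (2*K+1) * (IG + ennreal e * (\<integral>\<^sup>+x. X x * w x \<partial>M))" if e: "0 < e" for e :: real
      proof -
        define dd where "dd = ennreal e * (\<integral>\<^sup>+x. X x * w x \<partial>M)"
        have ddfin: "dd < top" using Xfin by (simp add: dd_def ennreal_mult_less_top)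
        \<comment> \<open>Normalised so that the integral of G0^p w is IG + dd and that of U0^q s is
          IP + dd. Up to the perturbation, U0 is the extremal dual function P^((p-1)/2) w.\<close>
        define G0 where "G0 x = enn_powr (enn_powr (G x) (p/2) + ennreal e * X x) (1/p)" for x
        define U0 where "U0 x = enn_powr (enn_powr (P x) (p/2) + ennreal e * X x) (1/q) * w x" for x
        have [measurable]: "G0 \<in> borel_measurable M" "U0 \<in> borel_measurable M" unfolding G0_def U0_def by measurable
        have IG0: "p_integral M p w G0 = IG + dd"
          using p by (simp add: G0_def enn_powr_powr IG_def dd_def distrib_right nn_integral_add nn_integral_cmult mult.assoc)
        have IU0: "p_integral M q s U0 = IP + dd"
        proof -
          have "p_integral M q s U0 = (\<integral>\<^sup>+x. (enn_powr (P x) (p/2) + ennreal e * X x) * w x \<partial>M)"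
            using ws
          proof (intro nn_integral_cong_AE, elim AE_mp, intro AE_I2 impI)
            fix x assume *: "0 < w x \<and> w x < top \<and> 0 < s x \<and> s x < top \<and> w x * enn_powr (s x) (p - 1) = 1"
            \<comment> \<open>The relation between w and s raised to the power q - 1 reads w^(q-1) s
              = 1, hence w^q s = w.\<close>
            have "enn_powr (w x * enn_powr (s x) (p - 1)) (q-1) = 1" using * by simp
            then have sw: "enn_powr (w x) (q-1) * s x = 1"
              using p q(1) by (subst (asm) enn_powr_mult) (auto simp: enn_powr_powr pq)
            have "enn_powr (U0 x) q * s x = (enn_powr (P x) (p/2) + ennreal e * X x) * enn_powr (w x) q * s x"
              using q(1) by (simp add: U0_def enn_powr_mult enn_powr_powr)
            also have "enn_powr (w x) q = w x * enn_powr (w x) (q-1)" using q(1) enn_powr_add[of 1 "q-1" "w x"] by simp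
            finally show "enn_powr (U0 x) q * s x = (enn_powr (P x) (p/2) + ennreal e * X x) * w x"
              using sw by (metis (no_types, lifting) mult.assoc mult.right_neutral)
          qed
          then show ?thesis by (simp add: IP_def dd_def distrib_right nn_integral_add nn_integral_cmult mult.assoc)
        qed
        obtain H where H[measurable]: "H \<in> borel_measurable M" and H1: "\<And>x. G0 x \<le> H x" "\<And>x. maxfn M S H x \<le> ennreal (2*b1) * H x"
            "p_integral M p w H \<le> ennreal (2 powr p) * (IG + dd)"
          using rubio_de_francia[OF S(1,2) p, of G0 w b1] b1 unfolding IG0 by auto
        obtain U where U[measurable]: "U \<in> borel_measurable M" and U1: "\<And>x. U0 x \<le> U x" "\<And>x. maxfn M S U x \<le> ennreal (2*b2) * U x"
            "p_integral M q s U \<le> ennreal (2 powr q) * (IP + dd)"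
          using rubio_de_francia[OF S(1,2) q(1), of U0 s b2] b2 unfolding IU0 by auto
        have Hfin: "AE x in M. H x < top"
          using p IGfin ddfin wae by (intro fin_ae[where r=p and v=w] order.strict_trans1[OF H1(3)]) (auto simp: ennreal_mult_less_top)
        have Ufin: "AE x in M. U x < top"
          using q(1) IPfin ddfin sae by (intro fin_ae[where r=q and v=s] order.strict_trans1[OF U1(3)]) (auto simp: ennreal_mult_less_top)
        have fin: "AE x in M. 0 < H x \<and> H x < top \<and> 0 < U x \<and> U x < top"
          using Hfin Ufin wae
        proof (elim AE_mp, intro AE_I2 impI)
          fix x assume *: "x \<in> space M" "0 < w x \<and> w x < top" "U x < top" "H x < top"
          have "0 < ennreal e * X x" using e Xpos[OF *(1)] by (simp add: ennreal_zero_less_mult_iff)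
          then have "0 < G0 x" "0 < U0 x" using p q(1) *
            by (auto simp: G0_def U0_def enn_powr_pos_iff ennreal_zero_less_mult_iff add_nonneg_pos)
          then show "0 < H x \<and> H x < top \<and> 0 < U x \<and> U x < top" using H1(1)[of x] U1(1)[of x] * by (auto intro: order.strict_trans2)
        qed
        define HU where "HU = (\<integral>\<^sup>+x. H x * U x \<partial>M)"
        have GH: "G x \<le> (H x)\<^sup>2" for x
        proof -
          have "enn_powr (G x) (1/2) = enn_powr (enn_powr (G x) (p/2)) (1/p)" using p by (simp add: enn_powr_powr)
          also have "\<dots> \<le> G0 x" unfolding G0_def using p by (intro enn_powr_mono) auto
          also have "\<dots> \<le> H x" by (rule H1)
          finally have "enn_powr (G x) (1/2) \<le> H x" .
          then show ?thesis by (simp add: enn_powr_le_iff enn_powr_2)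
        qed
        have PV: "(\<integral>\<^sup>+x. P x * (U x * inverse (H x)) \<partial>M) \<le> ennreal d * HU"
        proof -
          have "(\<integral>\<^sup>+x. P x * (U x * inverse (H x)) \<partial>M) = (\<Sum>j<J. \<integral>\<^sup>+x. (maxfn M S (F j) x)\<^sup>2 * (U x * inverse (H x)) \<partial>M)"
            unfolding P_def by (simp add: sum_distrib_right nn_integral_sum)
          also have "\<dots> \<le> (\<Sum>j<J. D * (\<integral>\<^sup>+x. (F j x)\<^sup>2 * (U x * inverse (H x)) \<partial>M))"
            unfolding D_def using fin b1(1) b2(1) H1(2) U1(2) by (intro sum_mono weighted_L2 M S pos) auto
          also have "\<dots> \<le> (\<Sum>j. D * (\<integral>\<^sup>+x. (F j x)\<^sup>2 * (U x * inverse (H x)) \<partial>M))"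
            by (intro sum_le_suminf) auto
          also have "\<dots> = D * (\<integral>\<^sup>+x. G x * (U x * inverse (H x)) \<partial>M)"
            unfolding G_def by (simp add: nn_integral_suminf flip: ennreal_suminf_multc)
          also have "\<dots> \<le> D * HU"
            unfolding HU_def using fin
          proof (intro mult_left_mono nn_integral_mono_AE, elim AE_mp, intro AE_I2 impI)
            fix x assume *: "0 < H x \<and> H x < top \<and> 0 < U x \<and> U x < top"
            have "G x * (U x * inverse (H x)) \<le> (H x)\<^sup>2 * (U x * inverse (H x))" by (intro mult_right_mono GH) simp
            also have "\<dots> = H x * U x * (H x * inverse (H x))" by (simp only: power2_eq_square mult_ac)
            also have "\<dots> = H x * U x" using * by (simp add: ennreal_mult_inverse_self)
            finally show "G x * (U x * inverse (H x)) \<le> H x * U x" .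
          qed simp
          finally show ?thesis by (simp add: d)
        qed
        have "IP \<le> (\<integral>\<^sup>+x. P x * (U x * inverse (H x)) + H x * U x \<partial>M)"
          unfolding IP_def using fin
        proof (intro nn_integral_mono_AE, elim AE_mp, intro AE_I2 impI)
          fix x assume *: "0 < H x \<and> H x < top \<and> 0 < U x \<and> U x < top"
          define f where "f = enn_powr (P x) (1/2)"
          have f2: "f * f = P x" unfolding f_def using enn_powr_add[of "1/2" "1/2" "P x"] by simp
          have "enn_powr (P x) (p/2) = enn_powr f 1 * enn_powr f (p-1)"
            using p by (subst enn_powr_add[symmetric]) (auto simp: f_def enn_powr_powr)
          also have "enn_powr f (p-1) * w x \<le> U0 x"
          proof -
            have "enn_powr f (p-1) = enn_powr (enn_powr (P x) (p/2)) (1/q)"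
            proof -
              have "1/2 * (p-1) = p/2 * (1/q)" unfolding q(3)[symmetric] by simp
              then show ?thesis using p q(1) by (simp only: f_def enn_powr_powr)
                (simp add: enn_powr_powr)
            qed
            then show ?thesis unfolding U0_def using q(1) by (auto intro!: mult_right_mono enn_powr_mono)
          qed
          then have "enn_powr f 1 * enn_powr f (p-1) * w x \<le> f * U x"
            using U1(1)[of x] by (simp add: mult.assoc) (meson mult_left_mono order.trans zero_le)
          finally have "enn_powr (P x) (p/2) * w x \<le> f * U x" .
          \<comment> \<open>Where f <= H the second summand suffices; elsewhere f = f H / H <= f^2 /
            H and the first one does. This brings in the square of f, to which the exponent-2
            inequality applies.\<close>
          also have "f * U x \<le> P x * (U x * inverse (H x)) + H x * U x"
          proof (cases "f \<le> H x")
            case True then show ?thesis by (intro add_increasing mult_right_mono) auto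
          next
            case False
            have "f * U x = f * U x * (H x * inverse (H x))" using * by (simp add: ennreal_mult_inverse_self)
            also have "\<dots> = H x * (f * (U x * inverse (H x)))" by (simp only: mult_ac)
            also have "\<dots> \<le> f * (f * (U x * inverse (H x)))" using False by (intro mult_right_mono) auto
            also have "\<dots> = P x * (U x * inverse (H x))" by (simp add: f2[symmetric] mult.assoc)
            finally show ?thesis by (rule add_increasing2[rotated]) simp
          qed
          finally show "enn_powr (P x) (p/2) * w x \<le> P x * (U x * inverse (H x)) + H x * U x" .
        qed
        also have "\<dots> = (\<integral>\<^sup>+x. P x * (U x * inverse (H x)) \<partial>M) + HU" unfolding HU_def by (subst nn_integral_add) auto
        also have "\<dots> \<le> ennreal d * HU + HU" by (intro add_right_mono PV)
        also have "\<dots> = ennreal (d+1) * HU" using d by (simp add: distrib_right)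
        finally have 1: "IP \<le> ennreal (d+1) * HU" .
        have "HU \<le> (\<integral>\<^sup>+x. ennreal (l powr p) * (enn_powr (H x) p * w x) + ennreal ((1/l) powr q) * (enn_powr (U x) q * s x) \<partial>M)"
          unfolding HU_def using ws
        proof (intro nn_integral_mono_AE, elim AE_mp, intro AE_I2 impI)
          fix x assume *: "0 < w x \<and> w x < top \<and> 0 < s x \<and> s x < top \<and> w x * enn_powr (s x) (p - 1) = 1"
          \<comment> \<open>Raised to the power 1/p the relation becomes w^(1/p) s^(1/q) = 1. This
            factor and l * (1/l) = 1 are distributed over H and U before Young's inequality is
            applied.\<close>
          have "enn_powr (w x * enn_powr (s x) (p - 1)) (1/p) = 1" using * by simp
          then have sw: "enn_powr (w x) (1/p) * enn_powr (s x) (1/q) = 1"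
            using p by (subst (asm) enn_powr_mult) (auto simp: enn_powr_powr q_def)
          have "ennreal l * ennreal (1/l) = 1" using l by (simp add: ennreal_mult[symmetric])
          then have "H x * U x = H x * U x * ((ennreal l * ennreal (1/l)) * (enn_powr (w x) (1/p) * enn_powr (s x) (1/q)))" using sw by simp
          also have "\<dots> = (ennreal l * (H x * enn_powr (w x) (1/p))) * (ennreal (1/l) * (U x * enn_powr (s x) (1/q)))"
            by (simp only: mult_ac)
          also have "\<dots> \<le> enn_powr (ennreal l * (H x * enn_powr (w x) (1/p))) p + enn_powr (ennreal (1/l) * (U x * enn_powr (s x) (1/q))) q"
            using enn_young[OF p] unfolding q(5) .
          also have "\<dots> = ennreal (l powr p) * (enn_powr (H x) p * w x) + ennreal ((1/l) powr q) * (enn_powr (U x) q * s x)"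
            using p q(1) l by (simp add: enn_powr_mult enn_powr_powr)
          finally show "H x * U x \<le> \<dots>" .
        qed
        also have "\<dots> = ennreal (l powr p) * p_integral M p w H + ennreal ((1/l) powr q) * p_integral M q s U"
          by (simp add: nn_integral_add nn_integral_cmult)
        also have "\<dots> \<le> ennreal (l powr p) * (ennreal (2 powr p) * (IG + dd)) + ennreal ((1/l) powr q) * (ennreal (2 powr q) * (IP + dd))"
          by (intro add_mono mult_left_mono H1 U1) auto
        also have "\<dots> = ennreal (l powr p * 2 powr p) * (IG + dd) + ennreal ((1/l) powr q * 2 powr q) * (IP + dd)"
          by (simp add: ennreal_mult mult.assoc)
        finally have 2: "HU \<le> ennreal (l powr p * 2 powr p) * (IG + dd) + ennreal ((1/l) powr q * 2 powr q) * (IP + dd)" .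
        have "IP \<le> ennreal (d+1) * (ennreal (l powr p * 2 powr p) * (IG + dd) + ennreal ((1/l) powr q * 2 powr q) * (IP + dd))"
          using 1 2 by (meson mult_left_mono order.trans zero_le)
        also have "\<dots> = ennreal K * (IG + dd) + ennreal ((d+1) * ((1/l) powr q * 2 powr q)) * (IP + dd)"
          using d by (simp add: K_def ennreal_mult distrib_left mult.assoc)
        finally have "IP \<le> ennreal K * (IG + dd) + ennreal ((d+1) * ((1/l) powr q * 2 powr q)) * (IP + dd)" .
        from absorb_half[OF this IPfin K lq] show ?thesis by (simp add: dd_def)
      qed
      have "IP \<le> ennreal (2*K+1) * IG"
      proof (rule ennreal_le_epsilon)
        fix e :: real assume e: "0 < e"
        obtain x where x: "(\<integral>\<^sup>+x. X x * w x \<partial>M) = ennreal x" "0 \<le> x" using Xfin by (cases "\<integral>\<^sup>+x. X x * w x \<partial>M") auto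
        \<comment> \<open>The perturbation scale t makes the error (2K+1) t x at most e; the
          denominator has x + 1 because x may be 0.\<close>
        define t where "t = e / ((2*K+1) * (x + 1))"
        have t: "0 < t" using e K x by (simp add: t_def)
        have "(2*K+1) * (t * x) \<le> (2*K+1) * (t * (x+1))" using K t x by (intro mult_left_mono) auto
        also have "\<dots> = e" using K x by (simp add: t_def divide_simps)
        finally have te: "(2*K+1) * (t * x) \<le> e" .
        have "IP \<le> ennreal (2*K+1) * IG + ennreal (2*K+1) * (ennreal t * ennreal x)"
          using step[OF t] unfolding x by (simp add: distrib_left)
        also have "ennreal (2*K+1) * (ennreal t * ennreal x) = ennreal ((2*K+1) * (t * x))" using K t x by (simp add: ennreal_mult)
        also have "ennreal (2*K+1) * IG + \<dots> \<le> ennreal (2*K+1) * IG + ennreal e" using te by (intro add_left_mono ennreal_leI)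
        finally show "IP \<le> ennreal (2*K+1) * IG + ennreal e" .
      qed
      then show ?thesis by (simp add: IP_def P_def)
    qed
    \<comment> \<open>The bound for partial sums does not depend on J, so monotone convergence
      passes to the full series.\<close>
    have "sq_integral M p w (\<lambda>j. maxfn M S (F j))
      = (\<integral>\<^sup>+x. (SUP J. enn_powr (\<Sum>j<J. (maxfn M S (F j) x)\<^sup>2) (p/2) * w x) \<partial>M)"
      using p by (simp add: suminf_eq_SUP enn_powr_SUP SUP_mult_right_ennreal)
    also have "\<dots> = (SUP J. \<integral>\<^sup>+x. enn_powr (\<Sum>j<J. (maxfn M S (F j) x)\<^sup>2) (p/2) * w x \<partial>M)"
      using p by (intro nn_integral_monotone_convergence_SUP)
        (auto simp: incseq_def le_fun_def intro!: mult_right_mono enn_powr_mono sum_mono2)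
    also have "\<dots> \<le> ennreal (2*K+1) * IG" by (intro SUP_least main)
    finally show "sq_integral M p w (\<lambda>j. maxfn M S (F j))
        \<le> ennreal (2*K+1) * sq_integral M p w F" by (simp add: IG_def G_def)
  qed
qed

section \<open>Power weights on the line\<close>

definition shell :: "real \<Rightarrow> real \<Rightarrow> real set" where
  "shell a b = {t. a \<le> \<bar>t\<bar> \<and> \<bar>t\<bar> \<le> b}"

text \<open>With a = 0 a shell is a symmetric interval, otherwise a pair of opposite intervals.
  Rational endpoints make the family countable, and a < b gives each member positive length.\<close>

definition rat_shells :: "real set set" where
  "rat_shells = {shell a b | a b. a \<in> \<rat> \<and> b \<in> \<rat> \<and> 0 \<le> a \<and> a < b}"

text \<open>The factor of the measure h_k^2 dx belonging to one coordinate.\<close>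

definition power_measure :: "real \<Rightarrow> real measure" where
  "power_measure k = density lborel (\<lambda>t. ennreal (\<bar>t\<bar> powr (2 * k)))"

lemma shell_borel [measurable]: "shell a b \<in> sets borel"
  unfolding shell_def by measurable

lemma countable_rat_shells: "countable rat_shells"
proof (rule countable_subset)
  show "rat_shells \<subseteq> (\<lambda>(a,b). shell a b) ` (\<rat> \<times> \<rat>)" by (auto simp: rat_shells_def)
  show "countable ((\<lambda>(a,b). shell a b) ` (\<rat> \<times> \<rat>))"
    using countable_rat by (intro countable_image countable_SIGMA) auto
qed

text \<open>Of three shells with a common point, the two reaching farthest inwards and outwards cover the third,
  so a minimal subcover has overlap at most two.\<close>

lemma shells_covered_by_two:
  assumes "finite F" "F \<noteq> {}" "\<And>A. A \<in> F \<Longrightarrow> \<exists>a b. A = shell a b" "\<And>A. A \<in> F \<Longrightarrow> x \<in> A"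
  obtains A B where "A \<in> F" "B \<in> F" "\<Union>F \<subseteq> A \<union> B"
proof -
  have "\<forall>A\<in>F. \<exists>c. A = shell (fst c) (snd c)" using assms(3) by fastforce
  from bchoice[OF this] obtain c where c: "\<And>A. A \<in> F \<Longrightarrow> A = shell (fst (c A)) (snd (c A))" by blast
  define a b where "a A = fst (c A)" and "b A = snd (c A)" for A
  have ab: "A = shell (a A) (b A)" if "A \<in> F" for A unfolding a_def b_def using that by (rule c)
  have "Min (a ` F) \<in> a ` F" "Max (b ` F) \<in> b ` F" using assms(1,2) by (auto intro!: Min_in Max_in)
  then obtain A B where A: "A \<in> F" "a A = Min (a ` F)" and B: "B \<in> F" "b B = Max (b ` F)" by (auto simp: image_iff)
  have AB: "a A \<le> a C" "b C \<le> b B" if "C \<in> F" for C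
    unfolding A(2) B(2) using assms(1) that by auto
  have "y \<in> A \<union> B" if "y \<in> C" "C \<in> F" for y C
  proof -
    have "a C \<le> \<bar>y\<bar>" "\<bar>y\<bar> \<le> b C" using that ab[of C] by (auto simp: shell_def)
    moreover have "a A \<le> \<bar>x\<bar>" "\<bar>x\<bar> \<le> b A" "a B \<le> \<bar>x\<bar>" "\<bar>x\<bar> \<le> b B" 
      using assms(4)[OF A(1)] assms(4)[OF B(1)] ab[OF A(1)] ab[OF B(1)] by (auto simp: shell_def)
    moreover have "a A \<le> a C" "b C \<le> b B" using AB that by auto
    ultimately have "y \<in> shell (a A) (b A) \<or> y \<in> shell (a B) (b B)" unfolding shell_def by force
    then show ?thesis using ab[OF A(1)] ab[OF B(1)] by simp
  qed
  then show thesis using that[OF A(1) B(1)] by blast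
qed

lemma thinnable_shells: "thinnable rat_shells"
  unfolding thinnable_def
proof (intro allI impI)
  fix F assume F: "F \<subseteq> rat_shells" "finite F"
  define P where "P n \<longleftrightarrow> (\<exists>G\<subseteq>F. \<Union>G = \<Union>F \<and> card G = n)" for n
  have "P (card F)" unfolding P_def by blast
  then have "P (LEAST n. P n)" by (rule LeastI)
  then obtain G where G: "G \<subseteq> F" "\<Union>G = \<Union>F" "card G = (LEAST n. P n)" unfolding P_def by blast
  have finG: "finite G" using G(1) F(2) by (rule finite_subset)
  have "card {A\<in>G. x \<in> A} \<le> 2" for x
  proof (rule ccontr)
    assume c: "\<not> card {A\<in>G. x \<in> A} \<le> 2"
    define E where "E = {A\<in>G. x \<in> A}"
    have "\<not> card E \<le> 2" using c unfolding E_def .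
    then have "E \<noteq> {}" by (metis card.empty zero_le)
    with finG have E: "finite E" "E \<noteq> {}" by (auto simp: E_def)
    have sh: "\<exists>a b. A = shell a b" and xA: "x \<in> A" if "A \<in> E" for A
      using that G(1) F(1) unfolding E_def rat_shells_def by blast+
    obtain A B where AB: "A \<in> E" "B \<in> E" "\<Union>E \<subseteq> A \<union> B"
      using shells_covered_by_two[OF E sh xA] by metis
    have "card {A,B} < card E" using c unfolding E_def by (simp add: card_insert_if)
    then obtain C where C: "C \<in> E" "C \<noteq> A" "C \<noteq> B"
      using E AB by (metis card_mono finite.emptyI finite.insertI insertCI leD subsetI)
    have "\<Union>(G - {C}) = \<Union>G"
    proof
      show "\<Union>G \<subseteq> \<Union>(G - {C})"
      proof
        fix y assume "y \<in> \<Union>G"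
        then obtain D where D: "D \<in> G" "y \<in> D" by blast
        show "y \<in> \<Union>(G - {C})"
        proof (cases "D = C")
          case True
          then have "y \<in> A \<union> B" using AB C D by blast
          then show ?thesis using AB C unfolding E_def by blast
        qed (use D in blast)
      qed
    qed blast
    then have "\<Union>(G - {C}) = \<Union>F" using G(2) by (rule trans)
    moreover have "G - {C} \<subseteq> F" using G(1) by blast
    ultimately have "P (card (G - {C}))" unfolding P_def by (intro exI[of _ "G - {C}"] conjI refl)
    then have "card G \<le> card (G - {C})" unfolding G(3) by (rule Least_le)
    moreover have "card (G - {C}) < card G" using C finG unfolding E_def by (intro psubset_card_mono) auto
    ultimately show False by linarith
  qed
  with G(1,2) show "\<exists>G\<subseteq>F. \<Union>G = \<Union>F \<and> (\<forall>x. card {A \<in> G. x \<in> A} \<le> 2)"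
    by (intro exI[of _ G] conjI allI)
qed

section \<open>Power integrals over intervals and shells\<close>

lemma nn_integral_powr_0:
  assumes "-1 < a" "0 \<le> b"
  shows "(\<integral>\<^sup>+t\<in>{0..b}. ennreal (t powr a) \<partial>lborel) = ennreal (b powr (a+1) / (a+1))"
proof -
  have "((\<lambda>t. t powr a) has_integral b powr (a+1) / (a+1)) {0..b}"
    using assms by (intro has_integral_powr_from_0)
  then have "(\<integral>\<^sup>+t. ennreal (indicator {0..b} t * t powr a) \<partial>lborel) = ennreal (b powr (a+1) / (a+1))"
    using assms by (intro nn_integral_has_integral_lebesgue) auto
  then show ?thesis by (simp add: ennreal_mult' ennreal_indicator mult.commute)
qed

text \<open>If a <= b/2, then b <= 2 (b - a) and the integral over all of [0, b] is small enough,
  with constant 2/(\<alpha>+1). Otherwise t is comparable to b on the interval, and t^\<alpha> is at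
  most b^\<alpha> or 2^(-\<alpha>) b^\<alpha> according to the sign of \<alpha>. The constant adds
  the three possibilities.\<close>

lemma nn_integral_powr_interval_le:
  assumes a: "-1 < \<alpha>" and ab: "0 \<le> a" "a < b"
  shows "(\<integral>\<^sup>+t\<in>{a..b}. ennreal (\<bar>t\<bar> powr \<alpha>) \<partial>lborel) \<le> ennreal ((2/(\<alpha>+1) + 1 + 2 powr (-\<alpha>)) * ((b-a) * b powr \<alpha>))"
proof (cases "a \<le> b/2")
  case True
  have "(\<integral>\<^sup>+t\<in>{a..b}. ennreal (\<bar>t\<bar> powr \<alpha>) \<partial>lborel) \<le> (\<integral>\<^sup>+t\<in>{0..b}. ennreal (t powr \<alpha>) \<partial>lborel)"
    using ab by (intro nn_integral_mono) (auto simp: indicator_def)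
  also have "\<dots> = ennreal (b powr (\<alpha>+1) / (\<alpha>+1))" using ab a by (intro nn_integral_powr_0) auto
  also have "\<dots> \<le> ennreal ((2/(\<alpha>+1) + 1 + 2 powr (-\<alpha>)) * ((b-a) * b powr \<alpha>))"
  proof (rule ennreal_leI)
    have "b powr (\<alpha>+1) / (\<alpha>+1) = (b * b powr \<alpha>) / (\<alpha>+1)" using ab by (simp add: powr_add)
    also have "\<dots> \<le> (2 * (b-a) * b powr \<alpha>) / (\<alpha>+1)" using True a ab by (intro divide_right_mono mult_right_mono) auto
    also have "\<dots> = (2/(\<alpha>+1) + 0 + 0) * ((b-a) * b powr \<alpha>)" by simp
    also have "\<dots> \<le> (2/(\<alpha>+1) + 1 + 2 powr (-\<alpha>)) * ((b-a) * b powr \<alpha>)"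
      using ab by (intro mult_right_mono add_mono) auto
    finally show "b powr (\<alpha>+1) / (\<alpha>+1) \<le> (2/(\<alpha>+1) + 1 + 2 powr (-\<alpha>)) * ((b-a) * b powr \<alpha>)" .
  qed
  finally show ?thesis .
next
  case False
  have pt: "t powr \<alpha> \<le> (1 + 2 powr (-\<alpha>)) * b powr \<alpha>" if "t \<in> {a..b}" for t
  proof (cases "0 \<le> \<alpha>")
    case True
    have "t powr \<alpha> \<le> b powr \<alpha>" using that ab True by (intro powr_mono2) auto
    then show ?thesis by (simp add: distrib_right add_increasing2)
  next
    case neg: False
    have "t powr \<alpha> \<le> (b/2) powr \<alpha>" using that ab False neg by (intro powr_mono2') auto
    also have "\<dots> = 2 powr (-\<alpha>) * b powr \<alpha>" by (simp add: powr_divide powr_minus_divide)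
    finally show ?thesis by (simp add: distrib_right add_increasing)
  qed
  have "(\<integral>\<^sup>+t\<in>{a..b}. ennreal (\<bar>t\<bar> powr \<alpha>) \<partial>lborel) \<le> (\<integral>\<^sup>+t\<in>{a..b}. ennreal ((1 + 2 powr (-\<alpha>)) * b powr \<alpha>) \<partial>lborel)"
    using ab pt by (intro nn_integral_mono) (auto simp: indicator_def intro!: ennreal_leI)
  also have "\<dots> = ennreal ((1 + 2 powr (-\<alpha>)) * b powr \<alpha>) * ennreal (b - a)"
    using ab by (simp add: nn_integral_cmult_indicator)
  also have "\<dots> = ennreal ((1 + 2 powr (-\<alpha>)) * b powr \<alpha> * (b - a))" using ab by (intro ennreal_mult[symmetric]) auto
  also have "\<dots> \<le> ennreal ((2/(\<alpha>+1) + 1 + 2 powr (-\<alpha>)) * ((b-a) * b powr \<alpha>))"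
  proof (rule ennreal_leI)
    have "(1 + 2 powr (-\<alpha>)) * b powr \<alpha> * (b - a) = (0 + 1 + 2 powr (-\<alpha>)) * ((b-a) * b powr \<alpha>)" by simp
    also have "\<dots> \<le> (2/(\<alpha>+1) + 1 + 2 powr (-\<alpha>)) * ((b-a) * b powr \<alpha>)"
      using ab a by (intro mult_right_mono add_mono) auto
    finally show "(1 + 2 powr (-\<alpha>)) * b powr \<alpha> * (b - a) \<le> (2/(\<alpha>+1) + 1 + 2 powr (-\<alpha>)) * ((b-a) * b powr \<alpha>)" .
  qed
  finally show ?thesis .
qed

lemma nn_integral_powr_shell_le:
  assumes a: "-1 < \<alpha>"
  obtains c where "0 < c" "\<And>a b. 0 \<le> a \<Longrightarrow> a < b \<Longrightarrow>
    (\<integral>\<^sup>+t\<in>shell a b. ennreal (\<bar>t\<bar> powr \<alpha>) \<partial>lborel) \<le> ennreal (c * ((b-a) * b powr \<alpha>))"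
proof -
  define c where "c = 2/(\<alpha>+1) + 1 + 2 powr (-\<alpha>)"
  have c: "0 < c" using a by (simp add: c_def add_pos_pos)
  show thesis
  proof (rule that[of "2*c"])
    show "0 < 2*c" using c by simp
    fix a b :: real assume ab: "0 \<le> a" "a < b"
    let ?g = "\<lambda>t. ennreal (\<bar>t\<bar> powr \<alpha>) * indicator {a..b} t"
    have "(\<integral>\<^sup>+t\<in>shell a b. ennreal (\<bar>t\<bar> powr \<alpha>) \<partial>lborel) \<le> (\<integral>\<^sup>+t. ?g t + ?g (0 + (-1) * t) \<partial>lborel)"
      by (intro nn_integral_mono) (auto simp: indicator_def shell_def abs_if)
    also have "\<dots> = (\<integral>\<^sup>+t. ?g t \<partial>lborel) + (\<integral>\<^sup>+t. ?g (0 + (-1) * t) \<partial>lborel)"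
      by (intro nn_integral_add) auto
    also have "(\<integral>\<^sup>+t. ?g (0 + (-1) * t) \<partial>lborel) = (\<integral>\<^sup>+t. ?g t \<partial>lborel)"
      using nn_integral_real_affine[of ?g "-1" 0] by simp
    also have "(\<integral>\<^sup>+t. ?g t \<partial>lborel) + (\<integral>\<^sup>+t. ?g t \<partial>lborel) \<le> ennreal (c * ((b-a) * b powr \<alpha>)) + ennreal (c * ((b-a) * b powr \<alpha>))"
      using nn_integral_powr_interval_le[OF a ab] unfolding c_def by (intro add_mono)
    also have "\<dots> = ennreal (2*c * ((b-a) * b powr \<alpha>))" 
      using c ab by (subst ennreal_plus[symmetric]) auto
    finally show "(\<integral>\<^sup>+t\<in>shell a b. ennreal (\<bar>t\<bar> powr \<alpha>) \<partial>lborel) \<le> ennreal (2*c * ((b-a) * b powr \<alpha>))" .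
  qed
qed

text \<open>The outer half of the positive part is enough: it has length (b - a)/2, and t >= b/2
  there, which accounts for the factors 2^-1 and 2^(-\<alpha>).\<close>

lemma nn_integral_powr_shell_ge:
  assumes a: "0 \<le> \<alpha>" and ab: "0 \<le> a" "a < b"
  shows "ennreal (2 powr (-\<alpha>-1) * ((b-a) * b powr \<alpha>)) \<le> (\<integral>\<^sup>+t\<in>shell a b. ennreal (\<bar>t\<bar> powr \<alpha>) \<partial>lborel)"
proof -
  have "ennreal (2 powr (-\<alpha>-1) * ((b-a) * b powr \<alpha>)) = ennreal ((b/2) powr \<alpha>) * ennreal (b - (a+b)/2)"
    using ab by (subst ennreal_mult[symmetric]) (auto simp: powr_divide powr_diff powr_minus field_simps)
  also have "\<dots> = (\<integral>\<^sup>+t\<in>{(a+b)/2..b}. ennreal ((b/2) powr \<alpha>) \<partial>lborel)"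
    using ab by (simp add: nn_integral_cmult_indicator)
  also have "\<dots> \<le> (\<integral>\<^sup>+t\<in>shell a b. ennreal (\<bar>t\<bar> powr \<alpha>) \<partial>lborel)"
    using ab a by (intro nn_integral_mono) (auto simp: indicator_def shell_def abs_if intro!: ennreal_leI powr_mono2)
  finally show ?thesis .
qed

lemma sets_power_measure [simp, measurable_cong]: "sets (power_measure k) = sets borel"
  by (simp add: power_measure_def)

lemma space_power_measure [simp]: "space (power_measure k) = UNIV"
  by (simp add: power_measure_def)

lemma nn_integral_power_measure:
  assumes [measurable]: "f \<in> borel_measurable borel"
  shows "(\<integral>\<^sup>+t. f t \<partial>power_measure k) = (\<integral>\<^sup>+t. ennreal (\<bar>t\<bar> powr (2*k)) * f t \<partial>lborel)"
  unfolding power_measure_def by (intro nn_integral_density) auto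

lemma emeasure_power_measure_shell:
  "emeasure (power_measure k) (shell a b) = (\<integral>\<^sup>+t\<in>shell a b. ennreal (\<bar>t\<bar> powr (2*k)) \<partial>lborel)"
  unfolding power_measure_def by (intro emeasure_density) auto

lemma sigma_finite_power_measure: "sigma_finite_measure (power_measure k)"
  unfolding power_measure_def by (subst sigma_finite_measure.sigma_finite_iff_density_finite'[OF sigma_finite_lborel]) auto

lemma power_measure_weight:
  assumes [measurable]: "f \<in> borel_measurable borel"
  shows "(\<integral>\<^sup>+t. f t * ennreal (\<bar>t\<bar> powr (2*b)) \<partial>power_measure a) = (\<integral>\<^sup>+t. f t \<partial>power_measure (a+b))"
proof -
  have "(\<integral>\<^sup>+t. f t * ennreal (\<bar>t\<bar> powr (2*b)) \<partial>power_measure a) = (\<integral>\<^sup>+t. ennreal (\<bar>t\<bar> powr (2*a)) * (f t * ennreal (\<bar>t\<bar> powr (2*b))) \<partial>lborel)"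
    by (intro nn_integral_power_measure) auto
  also have "\<dots> = (\<integral>\<^sup>+t. ennreal (\<bar>t\<bar> powr (2*(a+b))) * f t \<partial>lborel)"
    by (intro nn_integral_cong) (simp add: distrib_left powr_add ennreal_mult mult_ac)
  also have "\<dots> = (\<integral>\<^sup>+t. f t \<partial>power_measure (a+b))"
    by (intro nn_integral_power_measure[symmetric]) auto
  finally show ?thesis .
qed

lemma AE_power_measure_nonzero: "AE t in power_measure k. t \<noteq> 0"
  unfolding power_measure_def using AE_lborel_singleton[of 0] by (subst AE_density) (auto elim: AE_mp)

text \<open>The weight w turns \<open>power_measure k\<close> into the measure with exponent \<tau>,
  and the dual weight s into the one with exponent \<rho>. Local integrability of the two is 2\<tau>
  > -1 and 2\<rho> > -1, and the latter is equivalent to \<tau> < p k + (p-1)/2.\<close>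

theorem vector_valued_maximal_1d:
  assumes p: "1 < p" and k: "0 \<le> k" and t: "-1/2 < \<tau>" "\<tau> < p * k + (p-1)/2"
  obtains C :: real where "0 < C" "\<And>F :: nat \<Rightarrow> real \<Rightarrow> ennreal. (\<And>j. F j \<in> borel_measurable borel) \<Longrightarrow>
      sq_integral_un (power_measure \<tau>) p (\<lambda>j. maxfn (power_measure k) rat_shells (F j))
        \<le> ennreal C * sq_integral_un (power_measure \<tau>) p F"
proof -
  let ?M = "power_measure k"
  define \<rho> where "\<rho> = k - (\<tau> - k)/(p-1)"
  have rho: "-1 < 2*\<rho>" "2*\<rho>*(p-1) = 2*k*p - 2*\<tau>" "\<rho> - k = - (\<tau> - k)/(p-1)"
    using p t by (auto simp: \<rho>_def field_simps)
  define w where "w x = ennreal (\<bar>x\<bar> powr (2*(\<tau>-k)))" for x :: real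
  define s where "s x = ennreal (\<bar>x\<bar> powr (2*(\<rho>-k)))" for x :: real
  have [measurable]: "w \<in> borel_measurable borel" "s \<in> borel_measurable borel" unfolding w_def s_def by measurable
  have Sm: "rat_shells \<subseteq> sets ?M" by (auto simp: rat_shells_def)
  have wI: "(\<integral>\<^sup>+x\<in>shell a b. w x \<partial>?M) = emeasure (power_measure \<tau>) (shell a b)" for a b
    using power_measure_weight[of "indicator (shell a b)" k "\<tau>-k"] by (simp add: w_def mult.commute[of _ "indicator _ _"])
  have sI: "(\<integral>\<^sup>+x\<in>shell a b. s x \<partial>?M) = emeasure (power_measure \<rho>) (shell a b)" for a b
    using power_measure_weight[of "indicator (shell a b)" k "\<rho>-k"] by (simp add: s_def mult.commute[of _ "indicator _ _"])
  obtain c1 where c1: "0 < c1" "\<And>a b. 0 \<le> a \<Longrightarrow> a < b \<Longrightarrow> emeasure (power_measure \<tau>) (shell a b) \<le> ennreal (c1 * ((b-a) * b powr (2*\<tau>)))"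
    unfolding emeasure_power_measure_shell using nn_integral_powr_shell_le[of "2*\<tau>"] t by auto
  obtain c2 where c2: "0 < c2" "\<And>a b. 0 \<le> a \<Longrightarrow> a < b \<Longrightarrow> emeasure (power_measure \<rho>) (shell a b) \<le> ennreal (c2 * ((b-a) * b powr (2*\<rho>)))"
    unfolding emeasure_power_measure_shell using nn_integral_powr_shell_le[of "2*\<rho>"] rho by auto
  obtain c4 where c4: "0 < c4" "\<And>a b. 0 \<le> a \<Longrightarrow> a < b \<Longrightarrow> emeasure ?M (shell a b) \<le> ennreal (c4 * ((b-a) * b powr (2*k)))"
    unfolding emeasure_power_measure_shell using nn_integral_powr_shell_le[of "2*k"] k by auto
  define c3 where "c3 = 2 powr (-2*k-1)"
  have c3: "0 < c3" "\<And>a b. 0 \<le> a \<Longrightarrow> a < b \<Longrightarrow> ennreal (c3 * ((b-a) * b powr (2*k))) \<le> emeasure ?M (shell a b)"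
    unfolding emeasure_power_measure_shell using nn_integral_powr_shell_ge[of "2*k"] k by (auto simp: c3_def)
  \<comment> \<open>Since 2\<tau> + 2\<rho>(p-1) = 2 k p, both sides of the A_p condition on a shell
    are multiples of (b-a)^p b^(2kp); A is the ratio of their constants.\<close>
  define A where "A = ennreal (c1 * c2 powr (p-1) / c3 powr p)"
  obtain C :: real where C: "0 < C" "\<And>F :: nat \<Rightarrow> real \<Rightarrow> ennreal. (\<And>j. F j \<in> borel_measurable ?M) \<Longrightarrow>
      sq_integral ?M p w (\<lambda>j. maxfn ?M rat_shells (F j))
        \<le> ennreal C * sq_integral ?M p w F"
  proof (rule vector_valued_muckenhoupt[OF sigma_finite_power_measure countable_rat_shells Sm thinnable_shells p, of w s A])
    show "w \<in> borel_measurable ?M" "s \<in> borel_measurable ?M" by measurable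
    show "AE x in ?M. 0 < w x \<and> w x < top \<and> 0 < s x \<and> s x < top \<and> w x * enn_powr (s x) (p-1) = 1"
      using AE_power_measure_nonzero[of k]
    proof (elim AE_mp, intro AE_I2 impI)
      fix x :: real assume "x \<noteq> 0"
      have "\<bar>x\<bar> powr (2*(\<tau>-k)) * (\<bar>x\<bar> powr (2*(\<rho>-k))) powr (p-1) = \<bar>x\<bar> powr (2*(\<tau>-k) + 2*(\<rho>-k)*(p-1))"
        by (simp add: powr_powr powr_add)
      also have "2*(\<tau>-k) + 2*(\<rho>-k)*(p-1) = 0" unfolding rho(3) using p by simp
      finally have "\<bar>x\<bar> powr (2*(\<tau>-k)) * (\<bar>x\<bar> powr (2*(\<rho>-k))) powr (p-1) = 1" using \<open>x \<noteq> 0\<close> by simp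
      then show "0 < w x \<and> w x < top \<and> 0 < s x \<and> s x < top \<and> w x * enn_powr (s x) (p-1) = 1"
        using \<open>x \<noteq> 0\<close> by (auto simp: w_def s_def simp flip: ennreal_mult)
    qed
    show "A < top" by (simp add: A_def)
    fix I assume "I \<in> rat_shells"
    then obtain a b where I: "I = shell a b" "0 \<le> a" "a < b" by (auto simp: rat_shells_def)
    have "0 < ennreal (c3 * ((b-a) * b powr (2*k)))" using c3 I by simp
    also note c3(2)[OF I(2,3)]
    finally show "0 < emeasure ?M I \<and> emeasure ?M I < top"
      using c4(2)[OF I(2,3)] I by (auto intro: order.strict_trans1)
    have "(\<integral>\<^sup>+x\<in>I. w x \<partial>?M) * enn_powr (\<integral>\<^sup>+x\<in>I. s x \<partial>?M) (p-1)
      \<le> ennreal (c1 * ((b-a) * b powr (2*\<tau>))) * enn_powr (ennreal (c2 * ((b-a) * b powr (2*\<rho>)))) (p-1)"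
      unfolding I(1) wI sI using p I by (intro mult_mono enn_powr_mono c1 c2) auto
    also have "\<dots> = ennreal (c1 * ((b-a) * b powr (2*\<tau>)) * (c2 * ((b-a) * b powr (2*\<rho>))) powr (p-1))"
      using c1(1) c2(1) I by (subst enn_powr_ennreal, simp, subst ennreal_mult[symmetric]) auto
    also have "c1 * ((b-a) * b powr (2*\<tau>)) * (c2 * ((b-a) * b powr (2*\<rho>))) powr (p-1)
       = c1 * c2 powr (p-1) * (((b-a) powr 1 * (b-a) powr (p-1)) * (b powr (2*\<tau>) * b powr (2*\<rho>*(p-1))))"
      using c1 c2 I by (simp add: powr_mult powr_powr)
    also have "\<dots> = c1 * c2 powr (p-1) * ((b-a) powr p * b powr (2*k*p))"
      by (simp only: powr_add[symmetric]) (simp add: rho)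
    also have "\<dots> = c1 * c2 powr (p-1) / c3 powr p * (c3 * ((b-a) * b powr (2*k))) powr p"
      using c3 I by (simp add: powr_mult powr_powr)
    also have "ennreal \<dots> = A * enn_powr (ennreal (c3 * ((b-a) * b powr (2*k)))) p"
      unfolding A_def using c1 c2 c3 I by (simp add: ennreal_mult[symmetric])
    also have "\<dots> \<le> A * enn_powr (emeasure ?M I) p"
      unfolding I(1) using p I c3 by (intro mult_left_mono enn_powr_mono) auto
    finally show "(\<integral>\<^sup>+x\<in>I. w x \<partial>?M) * enn_powr (\<integral>\<^sup>+x\<in>I. s x \<partial>?M) (p-1) \<le> A * enn_powr (emeasure ?M I) p" .
  qed (rule that; blast)
  have eq: "(\<integral>\<^sup>+x. g x * w x \<partial>?M) = (\<integral>\<^sup>+x. g x \<partial>power_measure \<tau>)" if "g \<in> borel_measurable borel" for g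
    using power_measure_weight[OF that, of k "\<tau>-k"] by (simp add: w_def)
  show thesis
  proof (rule that[OF C(1)])
    fix F :: "nat \<Rightarrow> real \<Rightarrow> ennreal" assume F[measurable]: "\<And>j. F j \<in> borel_measurable borel"
    have [measurable]: "maxfn ?M rat_shells (F j) \<in> borel_measurable borel" for j
      by (rule maxfn_measurable[OF countable_rat_shells Sm]) simp
    show "sq_integral_un (power_measure \<tau>) p (\<lambda>j. maxfn ?M rat_shells (F j))
        \<le> ennreal C * sq_integral_un (power_measure \<tau>) p F"
      using C(2)[of F] by (simp add: eq)
  qed
qed

section \<open>Iterated maximal functions on the coordinate axes\<close>

abbreviation (input) lborel_fun :: "('n \<Rightarrow> real) measure" where
  "lborel_fun \<equiv> PiM UNIV (\<lambda>_. lborel)"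

abbreviation borel_fun :: "('n \<Rightarrow> real) measure" where
  "borel_fun \<equiv> PiM UNIV (\<lambda>_. borel)"

definition power_product :: "('n \<Rightarrow> real) \<Rightarrow> ('n \<Rightarrow> real) measure" where
  "power_product \<tau> = PiM UNIV (\<lambda>i. power_measure (\<tau> i))"

definition maxfn_coord :: "('n \<Rightarrow> real) \<Rightarrow> 'n \<Rightarrow> (('n \<Rightarrow> real) \<Rightarrow> ennreal) \<Rightarrow> ('n \<Rightarrow> real) \<Rightarrow> ennreal" where
  "maxfn_coord \<kappa> i F x = maxfn (power_measure (\<kappa> i)) rat_shells (\<lambda>t. F (x(i := t))) (x i)"

text \<open>The head of the list is the outermost operator, so an induction over the list peels off
  the operator applied last.\<close>

definition maxfn_iter :: "('n \<Rightarrow> real) \<Rightarrow> 'n list \<Rightarrow> (('n \<Rightarrow> real) \<Rightarrow> ennreal) \<Rightarrow> ('n \<Rightarrow> real) \<Rightarrow> ennreal" where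
  "maxfn_iter \<kappa> L F = foldr (maxfn_coord \<kappa>) L F"

lemma sets_power_product [measurable_cong]: "sets (power_product \<tau>) = sets borel_fun"
  unfolding power_product_def by (intro sets_PiM_cong) auto

lemma product_sigma_finite_power: "product_sigma_finite (\<lambda>i. power_measure (\<tau> i))"
  by (intro product_sigma_finite.intro sigma_finite_power_measure)

lemma measurable_fun_upd_UNIV [measurable]:
  "(\<lambda>(x, t). x(i := t)) \<in> borel_fun \<Otimes>\<^sub>M borel \<rightarrow>\<^sub>M borel_fun"
proof -
  have "(\<lambda>\<omega> j. if j = i then snd \<omega> else fst \<omega> j) \<in> borel_fun \<Otimes>\<^sub>M borel \<rightarrow>\<^sub>M borel_fun"
  proof (rule measurable_PiM_single')
    fix j show "(\<lambda>\<omega>. if j = i then snd \<omega> else fst \<omega> j) \<in> borel_measurable (borel_fun \<Otimes>\<^sub>M borel)"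
      by (cases "j = i") auto
  qed auto
  moreover have "(\<lambda>(x, t::real). x(i := t)) = (\<lambda>\<omega> j. if j = i then snd \<omega> else fst \<omega> j)"
    by (auto simp: fun_eq_iff)
  ultimately show ?thesis by simp
qed

lemma measurable_fun_upd_line [measurable]:
  fixes x :: "'n \<Rightarrow> real"
  shows "(\<lambda>t. x(i := t)) \<in> borel \<rightarrow>\<^sub>M borel_fun"
proof -
  have "(\<lambda>t j. if j = i then t else x j) \<in> borel \<rightarrow>\<^sub>M borel_fun"
  proof (rule measurable_PiM_single')
    fix j show "(\<lambda>t. if j = i then t else x j) \<in> borel_measurable borel" by (cases "j = i") auto
  qed auto
  moreover have "(\<lambda>t::real. x(i := t)) = (\<lambda>t j. if j = i then t else x j)" by (auto simp: fun_eq_iff)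
  ultimately show ?thesis by simp
qed

lemma maxfn_coord_measurable:
  assumes [measurable]: "F \<in> borel_measurable borel_fun"
  shows "maxfn_coord \<kappa> i F \<in> borel_measurable borel_fun"
proof -
  interpret sigma_finite_measure "power_measure (\<kappa> i)" by (rule sigma_finite_power_measure)
  have "maxfn_coord \<kappa> i F = (\<lambda>x. SUP A\<in>rat_shells. (\<integral>\<^sup>+t. F (x(i := t)) * indicator A t \<partial>power_measure (\<kappa> i))
      / emeasure (power_measure (\<kappa> i)) A * indicator A (x i))"
    by (simp add: maxfn_coord_def maxfn_eq_SUP_indicator mean_on_def fun_eq_iff)
  also have "\<dots> \<in> borel_measurable borel_fun"
  proof (intro borel_measurable_SUP countable_rat_shells)
    fix A assume "A \<in> rat_shells"
    then have [measurable]: "A \<in> sets borel" by (auto simp: rat_shells_def)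
    have [measurable]: "(\<lambda>(x, t). F (x(i := t))) \<in> borel_measurable (borel_fun \<Otimes>\<^sub>M power_measure (\<kappa> i))"
      using measurable_compose[OF measurable_fun_upd_UNIV assms] 
      by (simp add: case_prod_beta' measurable_cong_sets[OF sets_pair_measure_cong[OF refl sets_power_measure] refl])
    show "(\<lambda>x. (\<integral>\<^sup>+t. F (x(i := t)) * indicator A t \<partial>power_measure (\<kappa> i)) / emeasure (power_measure (\<kappa> i)) A * indicator A (x i))
      \<in> borel_measurable borel_fun"
      by measurable
  qed
  finally show ?thesis .
qed

lemma maxfn_iter_measurable:
  "F \<in> borel_measurable borel_fun \<Longrightarrow> maxfn_iter \<kappa> L F \<in> borel_measurable borel_fun"
  unfolding maxfn_iter_def by (induction L) (auto intro: maxfn_coord_measurable)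

lemma nn_integral_power_product_coord:
  fixes \<tau> :: "'n::finite \<Rightarrow> real"
  assumes F[measurable]: "F \<in> borel_measurable borel_fun"
  shows "(\<integral>\<^sup>+x. F x \<partial>power_product \<tau>) =
    (\<integral>\<^sup>+x. (\<integral>\<^sup>+t. F (x(i := t)) \<partial>power_measure (\<tau> i)) \<partial>PiM (UNIV - {i}) (\<lambda>i. power_measure (\<tau> i)))"
proof -
  interpret product_sigma_finite "\<lambda>i. power_measure (\<tau> i)" by (rule product_sigma_finite_power)
  have "F \<in> borel_measurable (PiM (insert i (UNIV - {i})) (\<lambda>i. power_measure (\<tau> i)))"
    using F by (simp add: insert_absorb power_product_def[symmetric] measurable_cong_sets[OF sets_power_product refl])
  from product_nn_integral_insert[OF _ _ this] show ?thesis by (simp add: insert_absorb power_product_def)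
qed

text \<open>By Tonelli the coordinate of the outermost operator is integrated first, with the others
  frozen; on that line the one-dimensional theorem applies. Its weight involves only this
  coordinate, so the remaining integral has the original form and the constants multiply.\<close>

lemma vector_valued_maxfn_iter:
  fixes \<kappa> \<tau> :: "'n::finite \<Rightarrow> real"
  assumes p: "1 < p" and k: "\<And>i. 0 \<le> \<kappa> i" and t: "\<And>i. -1/2 < \<tau> i" "\<And>i. \<tau> i < p * \<kappa> i + (p-1)/2"
  shows "\<exists>C>0. \<forall>F :: nat \<Rightarrow> ('n \<Rightarrow> real) \<Rightarrow> ennreal. (\<forall>j. F j \<in> borel_measurable borel_fun) \<longrightarrow>
      sq_integral_un (power_product \<tau>) p (\<lambda>j. maxfn_iter \<kappa> L (F j))
        \<le> ennreal C * sq_integral_un (power_product \<tau>) p F"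
proof (induction L)
  case Nil
  show ?case by (rule exI[of _ 1]) (simp add: maxfn_iter_def)
next
  case (Cons i L)
  then obtain C where C: "0 < C" "\<And>F :: nat \<Rightarrow> ('n \<Rightarrow> real) \<Rightarrow> ennreal. (\<And>j. F j \<in> borel_measurable borel_fun) \<Longrightarrow>
      sq_integral_un (power_product \<tau>) p (\<lambda>j. maxfn_iter \<kappa> L (F j))
        \<le> ennreal C * sq_integral_un (power_product \<tau>) p F"
    by blast
  obtain D where D: "0 < D" "\<And>F :: nat \<Rightarrow> real \<Rightarrow> ennreal. (\<And>j. F j \<in> borel_measurable borel) \<Longrightarrow>
      sq_integral_un (power_measure (\<tau> i)) p (\<lambda>j. maxfn (power_measure (\<kappa> i)) rat_shells (F j))
        \<le> ennreal D * sq_integral_un (power_measure (\<tau> i)) p F"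
    using vector_valued_maximal_1d[OF p k t, of i] by blast
  have "sq_integral_un (power_product \<tau>) p (\<lambda>j. maxfn_iter \<kappa> (i # L) (F j))
        \<le> ennreal (D * C) * sq_integral_un (power_product \<tau>) p F"
    if F[measurable]: "\<And>j. F j \<in> borel_measurable borel_fun" for F :: "nat \<Rightarrow> ('n \<Rightarrow> real) \<Rightarrow> ennreal"
  proof -
    define G where "G j = maxfn_iter \<kappa> L (F j)" for j
    have G[measurable]: "G j \<in> borel_measurable borel_fun" for j unfolding G_def by (intro maxfn_iter_measurable F)
    have [measurable]: "maxfn_coord \<kappa> i (G j) \<in> borel_measurable borel_fun" for j by (intro maxfn_coord_measurable G)
    let ?P = "PiM (UNIV - {i}) (\<lambda>i. power_measure (\<tau> i))"
    have "sq_integral_un (power_product \<tau>) p (\<lambda>j. maxfn_iter \<kappa> (i # L) (F j))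
      = sq_integral_un (power_product \<tau>) p (\<lambda>j. maxfn_coord \<kappa> i (G j))"
      by (simp add: maxfn_iter_def G_def)
    also have "\<dots> = (\<integral>\<^sup>+x. (\<integral>\<^sup>+t. enn_powr (\<Sum>j. (maxfn_coord \<kappa> i (G j) (x(i := t)))\<^sup>2) (p/2) \<partial>power_measure (\<tau> i)) \<partial>?P)"
      by (rule nn_integral_power_product_coord) measurable
    also have "\<dots> \<le> (\<integral>\<^sup>+x. ennreal D * (\<integral>\<^sup>+t. enn_powr (\<Sum>j. (G j (x(i := t)))\<^sup>2) (p/2) \<partial>power_measure (\<tau> i)) \<partial>?P)"
    proof (rule nn_integral_mono)
      fix x
      have "(\<lambda>t. G j (x(i := t))) \<in> borel_measurable borel" for j
        using measurable_compose[OF measurable_fun_upd_line G] .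
      from D(2)[OF this] show "(\<integral>\<^sup>+t. enn_powr (\<Sum>j. (maxfn_coord \<kappa> i (G j) (x(i := t)))\<^sup>2) (p/2) \<partial>power_measure (\<tau> i))
        \<le> ennreal D * (\<integral>\<^sup>+t. enn_powr (\<Sum>j. (G j (x(i := t)))\<^sup>2) (p/2) \<partial>power_measure (\<tau> i))"
        by (simp add: maxfn_coord_def)
    qed
    also have "\<dots> = (\<integral>\<^sup>+x. (\<integral>\<^sup>+t. ennreal D * enn_powr (\<Sum>j. (G j (x(i := t)))\<^sup>2) (p/2) \<partial>power_measure (\<tau> i)) \<partial>?P)"
      by (intro nn_integral_cong nn_integral_cmult[symmetric])
        (simp add: measurable_cong_sets[OF sets_power_measure refl])
    also have "\<dots> = (\<integral>\<^sup>+x. ennreal D * sq_fun p G x \<partial>power_product \<tau>)"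
      by (rule nn_integral_power_product_coord[symmetric]) measurable
    also have "\<dots> = ennreal D * sq_integral_un (power_product \<tau>) p G"
      by (rule nn_integral_cmult) measurable
    also have "\<dots> \<le> ennreal D * (ennreal C * sq_integral_un (power_product \<tau>) p F)"
      unfolding G_def by (intro mult_left_mono C F) auto
    also have "\<dots> = ennreal (D * C) * sq_integral_un (power_product \<tau>) p F"
      using C D by (simp add: ennreal_mult mult.assoc)
    finally show ?thesis .
  qed
  then show ?case using C(1) D(1) by (intro exI[of _ "D*C"]) auto
qed

lemma emeasure_rat_shell:
  assumes "0 \<le> k" "I \<in> rat_shells"
  shows "0 < emeasure (power_measure k) I" "emeasure (power_measure k) I < top"
proof -
  obtain a b where I: "I = shell a b" "0 \<le> a" "a < b" using assms(2) by (auto simp: rat_shells_def)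
  have "0 < ennreal (2 powr (-(2*k)-1) * ((b-a) * b powr (2*k)))" using I by simp
  also have "\<dots> \<le> emeasure (power_measure k) I"
    unfolding I(1) emeasure_power_measure_shell using assms I by (intro nn_integral_powr_shell_ge) auto
  finally show "0 < emeasure (power_measure k) I" .
  have "-1 < 2*k" using assms(1) by simp
  from nn_integral_powr_shell_le[OF this] obtain c where "0 < c"
    "\<And>a b. 0 \<le> a \<Longrightarrow> a < b \<Longrightarrow> (\<integral>\<^sup>+t\<in>shell a b. ennreal (\<bar>t\<bar> powr (2*k)) \<partial>lborel) \<le> ennreal (c * ((b-a) * b powr (2*k)))"
    by blast
  from this(2)[OF I(2,3)] show "emeasure (power_measure k) I < top"
    unfolding I(1) emeasure_power_measure_shell by (rule order.strict_trans1) simp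
qed

text \<open>Coordinates in L are averaged while the others stay frozen at x. For the head i, the
  induction hypothesis is used at \<open>x(i := t)\<close> for each t in \<open>A i\<close>; what
  remains is an average over \<open>A i\<close> of the inner iterate along the i-th line, which the
  next one-dimensional maximal function dominates at \<open>x i\<close>.\<close>

lemma box_mean_le_maxfn_iter_aux:
  fixes \<kappa> :: "'n::finite \<Rightarrow> real"
  assumes F[measurable]: "F \<in> borel_measurable borel_fun" and k: "\<And>i. 0 \<le> \<kappa> i"
    and A: "\<And>i. A i \<in> rat_shells"
  shows "distinct L \<Longrightarrow> (\<And>i. i \<in> set L \<Longrightarrow> x i \<in> A i) \<Longrightarrow>
    (\<integral>\<^sup>+y. F (\<lambda>i. if i \<in> set L then y i else x i) * (\<Prod>i\<in>set L. indicator (A i) (y i)) \<partial>PiM (set L) (\<lambda>i. power_measure (\<kappa> i)))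
    \<le> (\<Prod>i\<in>set L. emeasure (power_measure (\<kappa> i)) (A i)) * maxfn_iter \<kappa> L F x"
proof (induction L arbitrary: x)
  case Nil
  interpret product_sigma_finite "\<lambda>i. power_measure (\<kappa> i)" by (rule product_sigma_finite_power)
  \<comment> \<open>The empty product space is one point of mass 1, so integrating over no
    coordinate returns the value itself.\<close>
  have "emeasure (PiM {} (\<lambda>i. power_measure (\<kappa> i))) (space (PiM {} (\<lambda>i. power_measure (\<kappa> i)))) = 1"
    using emeasure_PiM[of "{}" "\<lambda>_. UNIV"] by (simp add: space_PiM)
  then show ?case by (simp add: maxfn_iter_def)
next
  case (Cons i L)
  interpret product_sigma_finite "\<lambda>i. power_measure (\<kappa> i)" by (rule product_sigma_finite_power)
  have [measurable]: "A j \<in> sets borel" for j using A[of j] by (auto simp: rat_shells_def)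
  have i: "i \<notin> set L" "distinct L" using Cons.prems by auto
  define m where "m = (\<Prod>i\<in>set L. emeasure (power_measure (\<kappa> i)) (A i))"
  let ?N = "\<lambda>i. power_measure (\<kappa> i)"
  have meas: "(\<lambda>y. F (\<lambda>j. if j \<in> set (i # L) then y j else x j) * (\<Prod>j\<in>set (i # L). indicator (A j) (y j))) \<in> borel_measurable (PiM (insert i (set L)) ?N)"
  proof (intro borel_measurable_times_ennreal borel_measurable_prod_ennreal)
    have "(\<lambda>y j. if j \<in> set (i # L) then y j else x j) \<in> PiM (insert i (set L)) ?N \<rightarrow>\<^sub>M borel_fun"
    proof (rule measurable_PiM_single')
      fix j
      show "(\<lambda>y. if j \<in> set (i # L) then y j else x j) \<in> borel_measurable (PiM (insert i (set L)) ?N)"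
        using measurable_component_singleton[of j "insert i (set L)" ?N] 
        by (cases "j \<in> set (i # L)") (auto simp: measurable_cong_sets[OF refl sets_power_measure])
    qed auto
    from measurable_compose[OF this F]
    show "(\<lambda>y. F (\<lambda>j. if j \<in> set (i # L) then y j else x j)) \<in> borel_measurable (PiM (insert i (set L)) ?N)" .
    fix j assume "j \<in> set (i # L)"
    then have "(\<lambda>y. y j) \<in> PiM (insert i (set L)) ?N \<rightarrow>\<^sub>M borel"
      using measurable_component_singleton[of j "insert i (set L)" ?N] by (simp add: measurable_cong_sets[OF refl sets_power_measure])
    from measurable_compose[OF this borel_measurable_indicator[of "A j" borel]]
    show "(\<lambda>y. indicator (A j) (y j) :: ennreal) \<in> borel_measurable (PiM (insert i (set L)) ?N)" by simp
  qed
  have "(\<integral>\<^sup>+y. F (\<lambda>j. if j \<in> set (i # L) then y j else x j) * (\<Prod>j\<in>set (i # L). indicator (A j) (y j)) \<partial>PiM (set (i # L)) ?N)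
    = (\<integral>\<^sup>+t. (\<integral>\<^sup>+y. F (\<lambda>j. if j \<in> set (i # L) then (y(i:=t)) j else x j) * (\<Prod>j\<in>set (i # L). indicator (A j) ((y(i:=t)) j)) \<partial>PiM (set L) ?N) \<partial>?N i)"
    using product_nn_integral_insert_rev[OF _ i(1) meas] by simp
  also have "\<dots> \<le> (\<integral>\<^sup>+t. m * (maxfn_iter \<kappa> L F (x(i:=t)) * indicator (A i) t) \<partial>?N i)"
  proof (rule nn_integral_mono)
    fix t
    have "(\<integral>\<^sup>+y. F (\<lambda>j. if j \<in> set (i # L) then (y(i:=t)) j else x j) * (\<Prod>j\<in>set (i # L). indicator (A j) ((y(i:=t)) j)) \<partial>PiM (set L) ?N)
      = (\<integral>\<^sup>+y. indicator (A i) t * (F (\<lambda>j. if j \<in> set L then y j else (x(i:=t)) j) * (\<Prod>j\<in>set L. indicator (A j) (y j))) \<partial>PiM (set L) ?N)"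
    proof (rule nn_integral_cong)
      fix y
      have "(\<lambda>j. if j \<in> set (i # L) then (y(i:=t)) j else x j) = (\<lambda>j. if j \<in> set L then y j else (x(i:=t)) j)"
        using i(1) by (auto simp: fun_eq_iff)
      moreover have "(\<Prod>j\<in>set (i # L). indicator (A j) ((y(i:=t)) j)) = indicator (A i) t * (\<Prod>j\<in>set L. indicator (A j) (y j) :: ennreal)"
      proof -
        have "(\<Prod>j\<in>set L. indicator (A j) ((y(i:=t)) j)) = (\<Prod>j\<in>set L. indicator (A j) (y j) :: ennreal)"
          using i(1) by (intro prod.cong) auto
        then show ?thesis using i(1) by simp
      qed
      ultimately show "F (\<lambda>j. if j \<in> set (i # L) then (y(i:=t)) j else x j) * (\<Prod>j\<in>set (i # L). indicator (A j) ((y(i:=t)) j))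
        = indicator (A i) t * (F (\<lambda>j. if j \<in> set L then y j else (x(i:=t)) j) * (\<Prod>j\<in>set L. indicator (A j) (y j)))"
        by (simp only: mult_ac)
    qed
    also have "\<dots> \<le> m * (maxfn_iter \<kappa> L F (x(i:=t)) * indicator (A i) t)"
    proof (cases "t \<in> A i")
      case True
      have "(\<integral>\<^sup>+y. F (\<lambda>j. if j \<in> set L then y j else (x(i:=t)) j) * (\<Prod>j\<in>set L. indicator (A j) (y j)) \<partial>PiM (set L) ?N)
        \<le> m * maxfn_iter \<kappa> L F (x(i:=t))"
        unfolding m_def using Cons.prems(2) i by (intro Cons.IH) auto
      then show ?thesis using True by simp
    qed simp
    finally show "(\<integral>\<^sup>+y. F (\<lambda>j. if j \<in> set (i # L) then (y(i:=t)) j else x j) * (\<Prod>j\<in>set (i # L). indicator (A j) ((y(i:=t)) j)) \<partial>PiM (set L) ?N)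
      \<le> m * (maxfn_iter \<kappa> L F (x(i:=t)) * indicator (A i) t)" .
  qed
  also have "\<dots> = m * (\<integral>\<^sup>+t\<in>A i. maxfn_iter \<kappa> L F (x(i:=t)) \<partial>?N i)"
  proof (rule nn_integral_cmult)
    have "(\<lambda>t. maxfn_iter \<kappa> L F (x(i:=t))) \<in> borel_measurable borel"
      using measurable_compose[OF measurable_fun_upd_line maxfn_iter_measurable[OF F]] .
    then show "(\<lambda>t. maxfn_iter \<kappa> L F (x(i:=t)) * indicator (A i) t) \<in> borel_measurable (?N i)"
      by (simp add: measurable_cong_sets[OF sets_power_measure refl])
  qed
  also have "(\<integral>\<^sup>+t\<in>A i. maxfn_iter \<kappa> L F (x(i:=t)) \<partial>?N i) = emeasure (?N i) (A i) * mean_on (?N i) (\<lambda>t. maxfn_iter \<kappa> L F (x(i:=t))) (A i)"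
    using emeasure_rat_shell[OF k A, of i i] unfolding mean_on_def
    by (simp add: ennreal_times_divide mult.commute[of "emeasure _ _"] ennreal_mult_divide_eq less_imp_neq)
  also have "m * \<dots> \<le> m * (emeasure (?N i) (A i) * maxfn_iter \<kappa> (i # L) F x)"
    unfolding maxfn_iter_def foldr.simps o_def maxfn_coord_def[of \<kappa> i _ x]
    using A Cons.prems(2) by (intro mult_left_mono mean_le_maxfn) auto
  also have "\<dots> = (\<Prod>i\<in>set (i # L). emeasure (power_measure (\<kappa> i)) (A i)) * maxfn_iter \<kappa> (i # L) F x"
    using i by (simp add: m_def mult_ac)
  finally show ?case .
qed

lemma box_mean_le_maxfn_iter:
  fixes \<kappa> :: "'n::finite \<Rightarrow> real"
  assumes F: "F \<in> borel_measurable borel_fun" and k: "\<And>i. 0 \<le> \<kappa> i"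
    and A: "\<And>i. A i \<in> rat_shells" and L: "distinct L" "set L = UNIV" and x: "\<And>i. x i \<in> A i"
  shows "(\<integral>\<^sup>+y. F y * (\<Prod>i\<in>UNIV. indicator (A i) (y i)) \<partial>power_product \<kappa>)
    \<le> (\<Prod>i\<in>UNIV. emeasure (power_measure (\<kappa> i)) (A i)) * maxfn_iter \<kappa> L F x"
  using box_mean_le_maxfn_iter_aux[OF F k A L(1), of x] x by (simp add: L(2) power_product_def)

section \<open>Transfer from product measures on functions to Lebesgue measure on vectors\<close>

lemma measurable_vec_lambda [measurable]: "(\<lambda>f. \<chi> i. f i) \<in> (borel_fun :: ('n::finite \<Rightarrow> real) measure) \<rightarrow>\<^sub>M borel"
proof (subst borel_measurable_euclidean_space, intro ballI)
  fix b :: "real^'n" assume "b \<in> Basis"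
  then obtain i where "b = axis i 1" by (auto simp: Basis_vec_def)
  then show "(\<lambda>f. (\<chi> i. f i) \<bullet> b) \<in> borel_measurable (borel_fun :: ('n \<Rightarrow> real) measure)"
    by (simp add: inner_axis)
qed

lemma prod_Basis_vec: "(\<Prod>b\<in>Basis. g (x \<bullet> b)) = (\<Prod>i\<in>UNIV. g (x $ i))" for x :: "real^'n"
proof -
  have B: "(Basis :: (real^'n) set) = (\<lambda>i. axis i 1) ` UNIV" by (auto simp: Basis_vec_def)
  have "inj (\<lambda>i::'n. axis i (1::real))" by (auto simp: inj_on_def axis_eq_axis)
  then show ?thesis unfolding B by (subst prod.reindex) (auto simp: inner_axis)
qed

text \<open>Lebesgue measure is determined by its values on open boxes, whose preimages under the
  vector constructor are products of intervals.\<close>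

lemma lborel_vec_eq_distr: "(lborel :: (real^'n) measure) = distr lborel_fun borel (\<lambda>f. \<chi> i. f i)"
proof (rule lborel_eqI)
  interpret product_sigma_finite "\<lambda>_::'n. lborel :: real measure" ..
  have s: "sets (PiM UNIV (\<lambda>_::'n. lborel :: real measure)) = sets borel_fun" by (intro sets_PiM_cong) auto
  fix l u :: "real^'n" assume lu: "\<And>b. b \<in> Basis \<Longrightarrow> l \<bullet> b \<le> u \<bullet> b"
  have lu': "l $ i \<le> u $ i" for i 
  proof -
    have "axis i 1 \<in> (Basis :: (real^'n) set)" by (auto simp: Basis_vec_def)
    from lu[OF this] show ?thesis by (simp add: inner_axis)
  qed
  have "emeasure (distr lborel_fun borel (\<lambda>f. \<chi> i. f i)) (box l u)
    = emeasure (PiM UNIV (\<lambda>_::'n. lborel)) ((\<lambda>f. \<chi> i. f i) -` box l u \<inter> space lborel_fun)"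
    by (intro emeasure_distr) (auto simp: measurable_cong_sets[OF s refl])
  also have "(\<lambda>f. \<chi> i. f i) -` box l u \<inter> space lborel_fun = (\<Pi>\<^sub>E i\<in>UNIV. {l $ i <..< u $ i})"
    by (auto simp: mem_box_cart space_PiM PiE_iff)
  also have "emeasure (PiM UNIV (\<lambda>_::'n. lborel)) \<dots> = (\<Prod>i\<in>UNIV. ennreal (u $ i - l $ i))"
    using lu' by (subst emeasure_PiM) auto
  also have "\<dots> = (\<Prod>b\<in>Basis. ennreal ((u - l) \<bullet> b))"
    using prod_Basis_vec[of ennreal "u - l"] by simp
  also have "\<dots> = ennreal (\<Prod>b\<in>Basis. (u - l) \<bullet> b)"
    using lu by (intro prod_ennreal) (auto simp: inner_diff_left)
  finally show "emeasure (distr lborel_fun borel (\<lambda>f. \<chi> i. f i)) (box l u) = (\<Prod>b\<in>Basis. (u - l) \<bullet> b)" .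
qed simp

lemma power_product_eq_density:
  fixes \<tau> :: "'n::finite \<Rightarrow> real"
  shows "power_product \<tau> = density lborel_fun (\<lambda>x. \<Prod>i\<in>UNIV. ennreal (\<bar>x i\<bar> powr (2 * \<tau> i)))"
proof -
  interpret L: product_sigma_finite "\<lambda>_::'n. lborel :: real measure" ..
  interpret product_sigma_finite "\<lambda>i. power_measure (\<tau> i)" by (rule product_sigma_finite_power)
  have s: "sets (PiM UNIV (\<lambda>_::'n. lborel :: real measure)) = sets borel_fun" by (intro sets_PiM_cong) auto
  show ?thesis unfolding power_product_def
  proof (rule PiM_eqI[symmetric])
    show "sets (density lborel_fun (\<lambda>x. \<Prod>i\<in>UNIV. ennreal (\<bar>x i\<bar> powr (2 * \<tau> i)))) = sets (PiM UNIV (\<lambda>i. power_measure (\<tau> i)))"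
      using sets_power_product[of \<tau>] s by (simp add: power_product_def)
    fix A :: "'n \<Rightarrow> real set" assume "\<And>i. i \<in> UNIV \<Longrightarrow> A i \<in> sets (power_measure (\<tau> i))"
    then have A[measurable]: "A i \<in> sets borel" for i by simp
    have "Pi\<^sub>E UNIV A \<in> sets lborel_fun" by (intro sets_PiM_I_finite) auto
    then have "emeasure (density lborel_fun (\<lambda>x. \<Prod>i\<in>UNIV. ennreal (\<bar>x i\<bar> powr (2 * \<tau> i)))) (Pi\<^sub>E UNIV A)
      = (\<integral>\<^sup>+x. (\<Prod>i\<in>UNIV. ennreal (\<bar>x i\<bar> powr (2 * \<tau> i))) * indicator (Pi\<^sub>E UNIV A) x \<partial>lborel_fun)"
      by (intro emeasure_density) auto
    also have "\<dots> = (\<integral>\<^sup>+x. (\<Prod>i\<in>UNIV. ennreal (\<bar>x i\<bar> powr (2 * \<tau> i)) * indicator (A i) (x i)) \<partial>lborel_fun)"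
    proof (intro nn_integral_cong)
      fix x :: "'n \<Rightarrow> real"
      have "indicator (Pi\<^sub>E UNIV A) x = (\<Prod>i\<in>UNIV. indicator (A i) (x i) :: ennreal)"
        by (auto simp: indicator_def PiE_def Pi_def)
      then show "(\<Prod>i\<in>UNIV. ennreal (\<bar>x i\<bar> powr (2 * \<tau> i))) * indicator (Pi\<^sub>E UNIV A) x
        = (\<Prod>i\<in>UNIV. ennreal (\<bar>x i\<bar> powr (2 * \<tau> i)) * indicator (A i) (x i))"
        by (simp add: prod.distrib)
    qed
    also have "\<dots> = (\<Prod>i\<in>UNIV. \<integral>\<^sup>+t. ennreal (\<bar>t\<bar> powr (2 * \<tau> i)) * indicator (A i) t \<partial>lborel)"
      by (rule L.product_nn_integral_prod) auto
    also have "\<dots> = (\<Prod>i\<in>UNIV. emeasure (power_measure (\<tau> i)) (A i))"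
      unfolding power_measure_def by (intro prod.cong refl emeasure_density[symmetric]) auto
    finally show "emeasure (density lborel_fun (\<lambda>x. \<Prod>i\<in>UNIV. ennreal (\<bar>x i\<bar> powr (2 * \<tau> i)))) (Pi\<^sub>E UNIV A)
      = (\<Prod>i\<in>UNIV. emeasure (power_measure (\<tau> i)) (A i))" .
  qed simp
qed

lemma hw_sq: "ennreal ((hw \<tau> x)\<^sup>2) = (\<Prod>i\<in>UNIV. ennreal (\<bar>x $ i\<bar> powr (2 * \<tau> $ i)))"
proof -
  have "(hw \<tau> x)\<^sup>2 = (\<Prod>i\<in>UNIV. \<bar>x $ i\<bar> powr (2 * \<tau> $ i))"
    unfolding hw_def prod_power_distrib by (intro prod.cong refl) (simp add: power2_eq_square flip: powr_add)
  then show ?thesis by (simp add: prod_ennreal)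
qed

lemma nn_integral_power_product_vec:
  fixes \<tau> :: "real^'n" and g :: "real^'n \<Rightarrow> ennreal"
  assumes [measurable]: "g \<in> borel_measurable borel"
  shows "(\<integral>\<^sup>+x. g (\<chi> i. x i) \<partial>power_product (\<lambda>i. \<tau> $ i)) = (\<integral>\<^sup>+x. g x * ennreal ((hw \<tau> x)\<^sup>2) \<partial>lborel)"
proof -
  have s: "sets (PiM UNIV (\<lambda>_::'n. lborel :: real measure)) = sets borel_fun" by (intro sets_PiM_cong) auto
  have [measurable]: "(\<lambda>f. \<chi> i. f i) \<in> (PiM UNIV (\<lambda>_::'n. lborel :: real measure)) \<rightarrow>\<^sub>M borel"
    by (simp add: measurable_cong_sets[OF s refl])
  have [measurable]: "(\<lambda>x. ennreal ((hw \<tau> x)\<^sup>2)) \<in> borel_measurable borel"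
    unfolding hw_sq by measurable
  have "(\<integral>\<^sup>+x. g x * ennreal ((hw \<tau> x)\<^sup>2) \<partial>lborel) = (\<integral>\<^sup>+x. g (\<chi> i. x i) * ennreal ((hw \<tau> (\<chi> i. x i))\<^sup>2) \<partial>lborel_fun)"
    unfolding lborel_vec_eq_distr by (subst nn_integral_distr) auto
  also have "\<dots> = (\<integral>\<^sup>+x. g (\<chi> i. x i) \<partial>power_product (\<lambda>i. \<tau> $ i))"
    unfolding power_product_eq_density by (subst nn_integral_density) (auto simp: hw_sq mult.commute)
  finally show ?thesis by simp
qed

section \<open>The measures defining the intertwining operator\<close>

abbreviation (input) Z_density :: "real \<Rightarrow> real \<Rightarrow> real" where
  "Z_density k t \<equiv> indicator {-1..1} t * ((1 + t) * (1 - t^2) powr (k - 1))"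

text \<open>The unnormalised mass as a nonnegative integral, meaningful before the density is known
  to be integrable.\<close>

definition Z_mass :: "real \<Rightarrow> real set \<Rightarrow> ennreal" where
  "Z_mass k A = (\<integral>\<^sup>+t\<in>A. ennreal (Z_density k t) \<partial>lborel)"

text \<open>Separates the endpoints: near 1 only (1-t)^(k-1) matters, possibly singular but
  integrable for k > 0, while at -1 the density vanishes like (1+t)^k.\<close>

lemma Zk_density_eq:
  fixes t :: real
  assumes "-1 < t" "t < 1"
  shows "(1 + t) * (1 - t^2) powr (k - 1) = (1 + t) powr k * (1 - t) powr (k - 1)"
proof -
  have "(1 - t^2) = (1+t) * (1-t)" by (simp add: power2_eq_square algebra_simps)
  then have "(1 + t) * (1 - t^2) powr (k - 1) = ((1+t) powr 1 * (1+t) powr (k-1)) * (1 - t) powr (k - 1)"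
    using assms by (simp add: powr_mult)
  also have "(1+t) powr 1 * (1+t) powr (k-1) = (1+t) powr k" by (simp only: powr_add[symmetric]) simp
  finally show ?thesis .
qed

lemma nn_integral_powr_reflect:
  assumes "0 < k" "0 \<le> u"
  shows "(\<integral>\<^sup>+t\<in>{1-u..1}. ennreal ((1-t) powr (k-1)) \<partial>lborel) = ennreal (u powr k / k)"
proof -
  have "(\<integral>\<^sup>+t\<in>{1-u..1}. ennreal ((1-t) powr (k-1)) \<partial>lborel)
    = (\<integral>\<^sup>+t. ennreal ((1-(1 + (-1)*t)) powr (k-1)) * indicator {1-u..1} (1 + (-1)*t) \<partial>lborel)"
    using nn_integral_real_affine[of "\<lambda>t. ennreal ((1-t) powr (k-1)) * indicator {1-u..1} t" "-1" 1] by simp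
  also have "\<dots> = (\<integral>\<^sup>+t\<in>{0..u}. ennreal (t powr (k-1)) \<partial>lborel)"
    by (intro nn_integral_cong) (auto simp: indicator_def)
  also have "\<dots> = ennreal (u powr k / k)" using nn_integral_powr_0[of "k-1" u] assms by simp
  finally show ?thesis .
qed

text \<open>For u <= 1 the interval lies in [0,1], where (1+t)^k is between 1 and 2^k; the other
  factor integrates to u^k / k.\<close>

lemma Z_mass_right:
  assumes "0 < k" "0 < u" "u \<le> 1"
  shows "Z_mass k {1-u..1} \<le> ennreal (2 powr k / k * u powr k)" "ennreal (u powr k / k) \<le> Z_mass k {1-u..1}"
proof -
  have "Z_mass k {1-u..1} \<le> (\<integral>\<^sup>+t. ennreal (2 powr k) * (ennreal ((1-t) powr (k-1)) * indicator {1-u..1} t) \<partial>lborel)"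
    unfolding Z_mass_def
  proof (rule nn_integral_mono)
    fix t :: real
    have "(1 + t) * (1 - t^2) powr (k - 1) \<le> 2 powr k * (1-t) powr (k-1)" if "1-u \<le> t" "t < 1"
      using that assms by (subst Zk_density_eq) (auto intro!: mult_right_mono powr_mono2)
    then show "ennreal (Z_density k t) * indicator {1-u..1} t
      \<le> ennreal (2 powr k) * (ennreal ((1-t) powr (k-1)) * indicator {1-u..1} t)"
      by (cases "t = 1") (auto simp: indicator_def ennreal_mult[symmetric] intro!: ennreal_leI)
  qed
  also have "\<dots> = ennreal (2 powr k) * ennreal (u powr k / k)"
    using assms nn_integral_powr_reflect[of k u] by (subst nn_integral_cmult) auto
  also have "\<dots> = ennreal (2 powr k / k * u powr k)" using assms by (simp add: ennreal_mult[symmetric])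
  finally show "Z_mass k {1-u..1} \<le> ennreal (2 powr k / k * u powr k)" .
  have "ennreal (u powr k / k) = (\<integral>\<^sup>+t\<in>{1-u..1}. ennreal ((1-t) powr (k-1)) \<partial>lborel)"
    using assms by (simp add: nn_integral_powr_reflect)
  also have "\<dots> \<le> Z_mass k {1-u..1}"
    unfolding Z_mass_def
  proof (rule nn_integral_mono)
    fix t :: real
    have "1 * (1-t) powr (k-1) \<le> (1 + t) * (1 - t^2) powr (k - 1)" if "1-u \<le> t" "t < 1"
      using that assms by (subst Zk_density_eq) (auto intro!: mult_right_mono ge_one_powr_ge_zero)
    then show "ennreal ((1-t) powr (k-1)) * indicator {1-u..1} t
      \<le> ennreal (Z_density k t) * indicator {1-u..1} t"
      using assms by (cases "t = 1") (auto simp: indicator_def intro!: ennreal_leI)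
  qed
  finally show "ennreal (u powr k / k) \<le> Z_mass k {1-u..1}" .
qed

text \<open>Here 1 - t >= 1, so (1-t)^(k-1) <= (1-t)^k <= 2^k. A factor u <= 1 from the length of
  the interval is given away so that both endpoints share the order u^k.\<close>

lemma Z_mass_left:
  assumes "0 < k" "0 < u" "u \<le> 1"
  shows "Z_mass k {-1..-1+u} \<le> ennreal (2 powr k * u powr k)"
proof -
  have "Z_mass k {-1..-1+u} \<le> (\<integral>\<^sup>+t. ennreal (2 powr k * u powr k) * indicator {-1..-1+u} t \<partial>lborel)"
    unfolding Z_mass_def
  proof (rule nn_integral_mono)
    fix t :: real
    have "(1 + t) * (1 - t^2) powr (k - 1) \<le> 2 powr k * u powr k" if "-1 < t" "t \<le> -1+u"
    proof (cases "t < 1")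
      case True
      have "(1 - t) powr (k-1) \<le> (1-t) powr k" using that assms by (intro powr_mono) auto
      also have "\<dots> \<le> 2 powr k" using that assms by (intro powr_mono2) auto
      finally have "(1 + t) powr k * (1 - t) powr (k - 1) \<le> u powr k * 2 powr k"
        using that assms by (intro mult_mono powr_mono2) auto
      then show ?thesis using that True by (simp add: Zk_density_eq mult.commute)
    next
      case False
      then have "t = 1" using that assms by simp
      then show ?thesis by simp
    qed
    then show "ennreal (Z_density k t) * indicator {-1..-1+u} t
      \<le> ennreal (2 powr k * u powr k) * indicator {-1..-1+u} t"
      by (cases "t = -1") (auto simp: indicator_def intro!: ennreal_leI)
  qed
  also have "\<dots> = ennreal (2 powr k * u powr k * u)"
    using assms by (simp add: nn_integral_cmult_indicator ennreal_mult)
  also have "\<dots> \<le> ennreal (2 powr k * u powr k)" using assms by (intro ennreal_leI) (simp add: mult_left_le)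
  finally show ?thesis .
qed

lemma Z_mass_mono: "A \<subseteq> B \<Longrightarrow> Z_mass k A \<le> Z_mass k B"
  unfolding Z_mass_def by (intro nn_integral_mono) (auto simp: indicator_def)

lemma Zk_density_measurable [measurable]:
  "(\<lambda>t::real. Z_density k t) \<in> borel_measurable borel"
  by measurable

text \<open>\<open>Zk\<close> is a Bochner integral and would be 0 by default for a non-integrable
  density. Splitting [-1,1] at 0 and using the endpoint bounds with u = 1 gives integrability, after
  which both notions of mass agree.\<close>

lemma Z_mass_UNIV:
  assumes "0 < k"
  shows "0 < Zk k" "Z_mass k UNIV = ennreal (Zk k)"
proof -
  let ?g = "\<lambda>t::real. Z_density k t"
  have nn: "0 \<le> ?g t" for t by (auto simp: indicator_def)
  have "Z_mass k UNIV \<le> Z_mass k {1-1..1} + Z_mass k {-1..-1+1}"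
    unfolding Z_mass_def by (subst nn_integral_add[symmetric]) (auto simp: indicator_def intro!: nn_integral_mono)
  also have "\<dots> \<le> ennreal (2 powr k / k * 1 powr k) + ennreal (2 powr k * 1 powr k)"
    using assms by (intro add_mono Z_mass_right Z_mass_left) auto
  also have "\<dots> < top" by simp
  finally have fin: "Z_mass k UNIV < top" .
  have int: "integrable lborel ?g"
    using fin nn by (intro integrableI_nonneg) (auto simp: Z_mass_def)
  show eq: "Z_mass k UNIV = ennreal (Zk k)"
    unfolding Zk_def using nn_integral_eq_integral[OF int] nn by (simp add: Z_mass_def)
  have "0 < ennreal (1 powr k / k)" using assms by simp
  also have "\<dots> \<le> Z_mass k {1-1..1}" using assms by (intro Z_mass_right) auto
  also have "\<dots> \<le> Z_mass k UNIV" by (rule Z_mass_mono) simp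
  finally show "0 < Zk k" unfolding eq by simp
qed

lemma sets_mu_k [simp, measurable_cong]: "sets (mu_k k) = sets borel"
  by (simp add: mu_k_def)

lemma space_mu_k [simp]: "space (mu_k k) = UNIV"
  by (simp add: mu_k_def)

lemma emeasure_mu_k:
  assumes "0 < k" and [measurable]: "A \<in> sets borel"
  shows "emeasure (mu_k k) A = Z_mass k A / ennreal (Zk k)"
proof -
  let ?g = "\<lambda>t::real. Z_density k t"
  have nn: "0 \<le> ?g t" for t by (auto simp: indicator_def)
  have "emeasure (mu_k k) A = (\<integral>\<^sup>+t\<in>A. ennreal (?g t / Zk k) \<partial>lborel)"
    unfolding mu_k_def using assms(1) by (simp add: emeasure_density)
  also have "\<dots> = (\<integral>\<^sup>+t. (ennreal (?g t) * indicator A t) / ennreal (Zk k) \<partial>lborel)"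
  proof (rule nn_integral_cong)
    fix t
    have "ennreal (?g t / Zk k) = ennreal (?g t) / ennreal (Zk k)"
      using Z_mass_UNIV(1)[OF assms(1)] nn[of t] by (simp add: divide_ennreal)
    then show "ennreal (?g t / Zk k) * indicator A t = (ennreal (?g t) * indicator A t) / ennreal (Zk k)"
      by (auto simp: indicator_def)
  qed
  also have "\<dots> = Z_mass k A / ennreal (Zk k)"
    unfolding Z_mass_def by (intro nn_integral_divide) auto
  finally show ?thesis .
qed

lemma mu_k_0: "A \<in> sets borel \<Longrightarrow> measure (mu_k 0) A = measure (pmf_of_set {-1, 1::real}) A"
  unfolding mu_k_def by (simp add: measure_distr)

lemma prob_space_mu_k: "0 \<le> k \<Longrightarrow> prob_space (mu_k k)"
proof (cases "k = 0")
  case True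
  then show ?thesis unfolding mu_k_def by (auto intro!: prob_space.prob_space_distr measure_pmf.prob_space_axioms)
next
  case False
  assume "0 \<le> k"
  with False have k: "0 < k" by simp
  show ?thesis
    using Z_mass_UNIV[OF k] by (intro prob_spaceI) (simp add: emeasure_mu_k k)
qed

lemma measure_mu_k_interval: 
  assumes k: "0 \<le> k"
  shows "measure (mu_k k) {-1..1} = 1"
proof (cases "k = 0")
  case True
  have "measure (measure_pmf (pmf_of_set {-1, 1::real})) {-1..1} = 1"
    by (subst measure_pmf_of_set) (auto simp: Int_absorb2)
  then show ?thesis using True mu_k_0[of "{-1..1}"] by simp
next
  case False
  with k have k: "0 < k" by simp
  have "Z_mass k {-1..1} = Z_mass k UNIV"
    unfolding Z_mass_def by (intro nn_integral_cong) (auto simp: indicator_def)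
  then have "emeasure (mu_k k) {-1..1} = 1" using Z_mass_UNIV[OF k] k by (simp add: emeasure_mu_k)
  then show ?thesis by (simp add: measure_def)
qed

text \<open>For u > 1 the bound 1 <= u^k takes over from the endpoint estimates, so one constant C
  >= 1 serves all u. At k = 0 the total mass 1 is the bound.\<close>

lemma mu_k_upper:
  assumes k: "0 \<le> k"
  obtains C where "1 \<le> C" "\<And>u. 0 < u \<Longrightarrow> measure (mu_k k) {1-u..1} \<le> C * u powr k"
    "\<And>u. 0 < u \<Longrightarrow> measure (mu_k k) {-1..-1+u} \<le> C * u powr k"
proof (cases "k = 0")
  case True
  interpret prob_space "mu_k k" using k by (rule prob_space_mu_k)
  show thesis by (rule that[of 1]) (use True prob_le_1 in auto)
next
  case False
  with k have k: "0 < k" by simp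
  interpret prob_space "mu_k k" using k by (intro prob_space_mu_k) simp
  define z where "z = Zk k"
  have z: "0 < z" using Z_mass_UNIV[OF k] by (simp add: z_def)
  define C where "C = 1 + 2 powr k / k / z + 2 powr k / z"
  have C: "1 \<le> C" "2 powr k / k / z \<le> C" "2 powr k / z \<le> C" using k z by (auto simp: C_def)
  have gen: "measure (mu_k k) A \<le> C * u powr k" if "0 < u" "A \<in> sets borel"
    and "u \<le> 1 \<Longrightarrow> Z_mass k A \<le> ennreal (c * u powr k)" "0 \<le> c" "c / z \<le> C" for A u c
  proof (cases "u \<le> 1")
    case True
    have "emeasure (mu_k k) A \<le> ennreal (c * u powr k) / ennreal z"
      using that True k by (simp add: emeasure_mu_k z_def divide_right_mono_ennreal)
    also have "\<dots> = ennreal (c * u powr k / z)" using that z by (simp add: divide_ennreal)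
    finally have "measure (mu_k k) A \<le> c * u powr k / z"
      using that z by (simp add: emeasure_eq_measure)
    also have "\<dots> = c / z * u powr k" by simp
    also have "\<dots> \<le> C * u powr k" using that by (intro mult_right_mono) auto
    finally show ?thesis .
  next
    case False
    have "measure (mu_k k) A \<le> 1" by simp
    also have "1 \<le> 1 * u powr k" using False k by (simp add: ge_one_powr_ge_zero)
    also have "\<dots> \<le> C * u powr k" using C by (intro mult_right_mono) auto
    finally show ?thesis .
  qed
  show thesis
  proof (rule that[OF C(1)])
    fix u :: real assume u: "0 < u"
    show "measure (mu_k k) {1-u..1} \<le> C * u powr k"
      by (rule gen[OF u _ Z_mass_right(1)[OF k u] _ C(2)]) (use k in auto)
    show "measure (mu_k k) {-1..-1+u} \<le> C * u powr k"
      by (rule gen[OF u _ Z_mass_left[OF k u] _ C(3)]) (use k in auto)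
  qed
qed

text \<open>Only the endpoint 1 is treated, because the lower bound for \<open>V_kappa\<close>
  concerns points whose coordinates share signs. At k = 0 the atom at 1 contributes 1/2.\<close>

lemma mu_k_lower:
  assumes k: "0 \<le> k"
  obtains c where "0 < c" "\<And>u. 0 < u \<Longrightarrow> u \<le> 1 \<Longrightarrow> c * u powr k \<le> measure (mu_k k) {1-u..1}"
proof (cases "k = 0")
  case True
  have "1/2 * u powr k \<le> measure (mu_k k) {1-u..1}" if "0 < u" "u \<le> 1" for u :: real
  proof -
    have "{-1, 1} \<inter> {1-u..1} = {1::real}" using that by auto
    then have "measure (measure_pmf (pmf_of_set {-1, 1::real})) {1-u..1} = 1/2"
      by (subst measure_pmf_of_set) auto
    then show ?thesis using True that mu_k_0[of "{1-u..1}"] by simp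
  qed
  then show thesis using that[of "1/2"] by simp
next
  case False
  with k have k: "0 < k" by simp
  interpret prob_space "mu_k k" using k by (intro prob_space_mu_k) simp
  define z where "z = Zk k"
  have z: "0 < z" using Z_mass_UNIV[OF k] by (simp add: z_def)
  show thesis
  proof (rule that[of "1/(k*z)"])
    show "0 < 1/(k*z)" using k z by simp
    fix u :: real assume u: "0 < u" "u \<le> 1"
    have "ennreal (u powr k / k / z) = ennreal (u powr k / k) / ennreal z"
      using z k by (simp add: divide_ennreal)
    also have "\<dots> \<le> emeasure (mu_k k) {1-u..1}"
      using k u by (simp add: emeasure_mu_k z_def divide_right_mono_ennreal Z_mass_right)
    finally show "1/(k*z) * u powr k \<le> measure (mu_k k) {1-u..1}"
      by (simp add: emeasure_eq_measure)
  qed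
qed

section \<open>Two-sided estimates of the intertwining operator on indicators of balls\<close>

abbreviation (input) decay :: "real^'n \<Rightarrow> real^'n \<Rightarrow> real \<Rightarrow> real" where
  "decay \<kappa> x \<theta> \<equiv> (\<Prod>i\<in>UNIV. (\<theta> / (\<bar>x $ i\<bar> + \<theta>)) powr (2 * \<kappa> $ i))"

text \<open>If |a| >= 2\<theta>, then |b| >= |a|/2 and |a| + \<theta> <= 3|a|. The condition
  confines t to within u = \<theta>^2 / (2|ab|) of the sign of ab, and u is at most 9
  (\<theta>/(|a|+\<theta>))^2. If |a| < 2\<theta>, the ratio \<theta>/(|a|+\<theta>) exceeds 1/3 and
  the total mass 1 is already small enough. Both cases lead to the factor 9^k.\<close>

lemma mu_k_upper_product:
  assumes k: "0 \<le> k"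
  obtains C where "1 \<le> C" "\<And>a b \<theta>. 0 < \<theta> \<Longrightarrow> \<bar>\<bar>a\<bar> - \<bar>b\<bar>\<bar> \<le> \<theta> \<Longrightarrow>
    measure (mu_k k) {t\<in>{-1..1}. \<bar>a * b\<bar> - a * b * t \<le> \<theta>\<^sup>2 / 2} \<le> C * (\<theta> / (\<bar>a\<bar> + \<theta>)) powr (2 * k)"
proof -
  interpret prob_space "mu_k k" using k by (rule prob_space_mu_k)
  obtain C where C: "1 \<le> C" "\<And>u. 0 < u \<Longrightarrow> measure (mu_k k) {1-u..1} \<le> C * u powr k"
    "\<And>u. 0 < u \<Longrightarrow> measure (mu_k k) {-1..-1+u} \<le> C * u powr k"
    using mu_k_upper[OF k] by metis
  show thesis
  proof (rule that)
    have "1 * 1 \<le> C * 9 powr k" using C k by (intro mult_mono ge_one_powr_ge_zero) auto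
    then show "1 \<le> C * 9 powr k" by simp
    fix a b \<theta> :: real assume t: "0 < \<theta>" and ab: "\<bar>\<bar>a\<bar> - \<bar>b\<bar>\<bar> \<le> \<theta>"
    let ?A = "{t\<in>{-1..1}. \<bar>a * b\<bar> - a * b * t \<le> \<theta>\<^sup>2 / 2}"
    define v where "v = \<theta> / (\<bar>a\<bar> + \<theta>)"
    have v: "0 < v" using t by (simp add: v_def add_nonneg_pos)
    have v2: "(v\<^sup>2) powr k = v powr (2*k)" using v by (simp add: powr_powr flip: powr_numeral)
    have "measure (mu_k k) ?A \<le> C * 9 powr k * v powr (2*k)"
    proof (cases "2 * \<theta> \<le> \<bar>a\<bar>")
      case True
      define u where "u = \<theta>\<^sup>2 / (2 * \<bar>a * b\<bar>)"
      have b: "\<bar>a\<bar> / 2 \<le> \<bar>b\<bar>" using True ab by linarith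
      have pos: "0 < \<bar>a\<bar>" "0 < \<bar>a * b\<bar>" using True t b by (auto simp: abs_mult)
      have u: "0 < u" using t pos by (simp add: u_def)
      have sub: "?A \<subseteq> (if 0 < a * b then {1-u..1} else {-1..-1+u})"
      proof (cases "0 < a * b")
        case True
        have "1 - u \<le> t" if "a * b - a * b * t \<le> \<theta>\<^sup>2 / 2" for t
        proof -
          define m where "m = a * b"
          have m: "0 < m" "\<bar>a * b\<bar> = m" "a * b = m" using True by (auto simp: m_def)
          have "m - m * t \<le> \<theta>\<^sup>2 / 2" using that by (simp add: m)
          then show ?thesis using m(1) unfolding u_def m(2) by (simp add: field_simps)
        qed
        then show ?thesis using True by auto
      next
        case False
        have "t \<le> -1 + u" if "- (a * b) - a * b * t \<le> \<theta>\<^sup>2 / 2" for t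
        proof -
          define m where "m = - (a * b)"
          have m: "0 < m" "\<bar>a * b\<bar> = m" "a * b = - m" using False pos by (auto simp: m_def)
          have "m + m * t \<le> \<theta>\<^sup>2 / 2" using that by (simp add: m)
          then show ?thesis using m(1) unfolding u_def m(2) by (simp add: field_simps)
        qed
        then show ?thesis using False by auto
      qed
      have "measure (mu_k k) ?A \<le> measure (mu_k k) (if 0 < a * b then {1-u..1} else {-1..-1+u})"
        using sub by (intro finite_measure_mono) auto
      also have "\<dots> \<le> C * u powr k" using C(2,3)[OF u] by auto
      also have "\<dots> \<le> C * (9 * v\<^sup>2) powr k"
      proof (intro mult_left_mono powr_mono2)
        have "\<bar>a\<bar> * \<bar>a\<bar> / 2 \<le> \<bar>a * b\<bar>" using mult_left_mono[OF b, of "\<bar>a\<bar>"] by (simp add: abs_mult)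
        then have "u \<le> \<theta>\<^sup>2 / (\<bar>a\<bar> * \<bar>a\<bar>)" unfolding u_def using pos by (intro divide_left_mono) (auto simp: zero_less_mult_iff)
        also have "\<dots> \<le> \<theta>\<^sup>2 / ((\<bar>a\<bar> + \<theta>)\<^sup>2 / 9)"
        proof (rule divide_left_mono)
          have "(\<bar>a\<bar> + \<theta>)\<^sup>2 \<le> (3 * \<bar>a\<bar>)\<^sup>2" using True t by (intro power_mono) auto
          then show "(\<bar>a\<bar> + \<theta>)\<^sup>2 / 9 \<le> \<bar>a\<bar> * \<bar>a\<bar>" by (simp add: power2_eq_square)
        qed (use t pos in \<open>auto simp: zero_less_mult_iff add_nonneg_pos\<close>)
        also have "\<dots> = 9 * v\<^sup>2" by (simp add: v_def power_divide)
        finally show "u \<le> 9 * v\<^sup>2" .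
      qed (use k u C in auto)
      also have "\<dots> = C * 9 powr k * v powr (2*k)" using v2 by (simp add: powr_mult)
      finally show ?thesis .
    next
      case False
      have "measure (mu_k k) ?A \<le> 1" by (rule prob_le_1)
      also have "1 \<le> C * (9 * v\<^sup>2) powr k"
      proof -
        have "1/3 \<le> v" using False t by (simp add: v_def field_simps)
        then have "(1/3)\<^sup>2 \<le> v\<^sup>2" by (intro power_mono) auto
        then have "1 \<le> 9 * v\<^sup>2" by (simp add: power2_eq_square)
        then have "1 \<le> (9 * v\<^sup>2) powr k" using k by (rule ge_one_powr_ge_zero)
        then have "1 * 1 \<le> C * (9 * v\<^sup>2) powr k" using C by (intro mult_mono) auto
        then show ?thesis by simp
      qed
      also have "\<dots> = C * 9 powr k * v powr (2*k)" using v2 by (simp add: powr_mult)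
      finally show ?thesis .
    qed
    then show "measure (mu_k k) ?A \<le> C * 9 powr k * (\<theta> / (\<bar>a\<bar> + \<theta>)) powr (2 * k)" by (simp add: v_def)
  qed
qed

text \<open>Since a b <= (|a|+\<theta>)^2, every t within u = e (\<theta>/(|a|+\<theta>))^2 of 1
  satisfies the condition. The parameter e is the share of the total error allotted to one
  coordinate.\<close>

lemma mu_k_lower_product:
  assumes k: "0 \<le> k" and e: "0 < e" "e \<le> 1"
  obtains c where "0 < c" "\<And>a b \<theta>. 0 < \<theta> \<Longrightarrow> 0 \<le> a * b \<Longrightarrow> \<bar>b\<bar> \<le> \<bar>a\<bar> + \<theta> \<Longrightarrow>
    c * (\<theta> / (\<bar>a\<bar> + \<theta>)) powr (2 * k) \<le> measure (mu_k k) {t\<in>{-1..1}. a * b * (1 - t) \<le> e * \<theta>\<^sup>2}"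
proof -
  interpret prob_space "mu_k k" using k by (rule prob_space_mu_k)
  obtain c where c: "0 < c" "\<And>u. 0 < u \<Longrightarrow> u \<le> 1 \<Longrightarrow> c * u powr k \<le> measure (mu_k k) {1-u..1}"
    using mu_k_lower[OF k] by metis
  show thesis
  proof (rule that)
    show "0 < c * e powr k" using c e by simp
    fix a b \<theta> :: real assume t: "0 < \<theta>" and ab: "0 \<le> a * b" and b: "\<bar>b\<bar> \<le> \<bar>a\<bar> + \<theta>"
    define v where "v = \<theta> / (\<bar>a\<bar> + \<theta>)"
    have v: "0 < v" "v \<le> 1" using t by (auto simp: v_def add_nonneg_pos)
    have v2: "(v\<^sup>2) powr k = v powr (2*k)" using v by (simp add: powr_powr flip: powr_numeral)
    define u where "u = e * v\<^sup>2"
    have u: "0 < u" "u \<le> 1" using v e by (auto simp: u_def mult_le_one power_le_one)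
    have "c * e powr k * v powr (2*k) = c * u powr k" using v2 e by (simp add: u_def powr_mult)
    also have "\<dots> \<le> measure (mu_k k) {1-u..1}" by (rule c(2)[OF u])
    also have "\<dots> \<le> measure (mu_k k) {t\<in>{-1..1}. a * b * (1 - t) \<le> e * \<theta>\<^sup>2}"
    proof (intro finite_measure_mono subsetI)
      fix t assume t': "t \<in> {1-u..1}"
      have "a * b * (1 - t) \<le> a * b * u" using t' ab by (intro mult_left_mono) auto
      also have "a * b \<le> (\<bar>a\<bar> + \<theta>)\<^sup>2"
      proof -
        have "a * b = \<bar>a\<bar> * \<bar>b\<bar>" using ab by (simp flip: abs_mult)
        also have "\<dots> \<le> (\<bar>a\<bar> + \<theta>) * (\<bar>a\<bar> + \<theta>)" using b t by (intro mult_mono) auto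
        finally show ?thesis by (simp add: power2_eq_square)
      qed
      then have "a * b * u \<le> (\<bar>a\<bar> + \<theta>)\<^sup>2 * u" using u by (intro mult_right_mono) auto
      also have "(\<bar>a\<bar> + \<theta>)\<^sup>2 * u = e * \<theta>\<^sup>2" using t by (simp add: u_def v_def power_divide)
      finally show "t \<in> {t\<in>{-1..1}. a * b * (1 - t) \<le> e * \<theta>\<^sup>2}" using t' u by simp
    qed simp
    finally show "c * e powr k * (\<theta> / (\<bar>a\<bar> + \<theta>)) powr (2 * k) \<le> measure (mu_k k) {t\<in>{-1..1}. a * b * (1 - t) \<le> e * \<theta>\<^sup>2}"
      by (simp add: v_def)
  qed
qed

context
  fixes \<kappa> :: "real^'n" assumes \<kappa>: "\<forall>i. 0 \<le> \<kappa> $ i"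
begin

abbreviation "Pk \<equiv> PiM UNIV (\<lambda>i. mu_k (\<kappa> $ i))"

lemma sets_Pk: "sets Pk = sets borel_fun"
  by (intro sets_PiM_cong) auto

lemma space_Pk: "space Pk = UNIV"
  by (simp add: space_PiM PiE_UNIV_domain)

lemma prob_space_Pk: "prob_space Pk"
  using \<kappa> by (intro prob_space_PiM prob_space_mu_k) auto

lemma measure_Pk_box:
  assumes "\<And>i. A i \<in> sets borel"
  shows "measure Pk (Pi\<^sub>E UNIV A) = (\<Prod>i\<in>UNIV. measure (mu_k (\<kappa> $ i)) (A i))"
proof -
  interpret P: prob_space Pk by (rule prob_space_Pk)
  interpret product_sigma_finite "\<lambda>i. mu_k (\<kappa> $ i)"
    using \<kappa> prob_space_mu_k by (intro product_sigma_finite.intro prob_space_imp_sigma_finite) auto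
  have "ennreal (measure Pk (Pi\<^sub>E UNIV A)) = (\<Prod>i\<in>UNIV. emeasure (mu_k (\<kappa> $ i)) (A i))"
    unfolding P.emeasure_eq_measure[symmetric] using assms by (intro emeasure_PiM) auto
  also have "\<dots> = (\<Prod>i\<in>UNIV. ennreal (measure (mu_k (\<kappa> $ i)) (A i)))"
    using \<kappa> prob_space_mu_k by (intro prod.cong refl finite_measure.emeasure_eq_measure prob_space.finite_measure) auto
  also have "\<dots> = ennreal (\<Prod>i\<in>UNIV. measure (mu_k (\<kappa> $ i)) (A i))" by (intro prod_ennreal) auto
  finally show ?thesis by (simp add: prod_nonneg)
qed

lemma box_measurable_Pk: "(\<And>i. A i \<in> sets borel) \<Longrightarrow> Pi\<^sub>E UNIV A \<in> sets Pk"
  by (intro sets_PiM_I_finite) auto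

lemma Bset_borel: "Bset x \<theta> \<in> sets borel"
proof -
  have "closed (Bset x \<theta>)"
    unfolding Bset_def by (intro closed_Collect_conj closed_Collect_le continuous_intros)
  then show ?thesis by simp
qed

text \<open>The value is a probability: independent t_i with laws \<open>mu_k\<close> scale the
  coordinates of y, and the scaled point must lie in the ball.\<close>

lemma V_kappa_eq_measure:
  "V_kappa \<kappa> (indicator (Bset x \<theta>)) y = measure Pk {t. (\<chi> i. y $ i * t i) \<in> Bset x \<theta>}"
proof -
  have "(\<lambda>t. indicator (Bset x \<theta>) (\<chi> i. y $ i * t i) :: real) = indicator {t. (\<chi> i. y $ i * t i) \<in> Bset x \<theta>}"
    by (auto simp: indicator_def fun_eq_iff)
  then show ?thesis unfolding V_kappa_def by (simp add: space_Pk)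
qed

lemma V_set_measurable: "{t. (\<chi> i. y $ i * t i) \<in> Bset x \<theta>} \<in> sets Pk"
proof -
  have "(\<lambda>t i. y $ i * t i) \<in> borel_fun \<rightarrow>\<^sub>M borel_fun"
    by (intro measurable_PiM_single') auto
  from measurable_compose[OF this measurable_vec_lambda]
  have "(\<lambda>t. \<chi> i. y $ i * t i) \<in> Pk \<rightarrow>\<^sub>M borel" by (simp add: measurable_cong_sets[OF sets_Pk refl])
  from measurable_sets[OF this Bset_borel, of x \<theta>] show ?thesis by (simp add: space_Pk vimage_def)
qed

text \<open>For t in the cube each deficit |x_i y_i| - x_i y_i t_i is nonnegative. Their sum is at
  most 1 - cos \<theta> <= \<theta>^2/2, because the sum of |x_i y_i| is at most 1. Bounding every
  deficit by the whole sum encloses the event in a product set. Likewise the sum of (|x_i|-|y_i|)^2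
  is 2 minus twice the sum of |x_i y_i|, hence at most \<theta>^2; this gives the vanishing.\<close>

lemma V_kappa_upper:
  obtains C where "0 < C" "\<And>x y \<theta>. norm x = 1 \<Longrightarrow> norm y = 1 \<Longrightarrow> 0 < \<theta> \<Longrightarrow> \<theta> \<le> pi \<Longrightarrow>
    V_kappa \<kappa> (indicator (Bset x \<theta>)) y \<le>
      (if \<forall>i. \<bar>\<bar>x $ i\<bar> - \<bar>y $ i\<bar>\<bar> \<le> \<theta> then C * decay \<kappa> x \<theta> else 0)"
proof -
  interpret P: prob_space Pk by (rule prob_space_Pk)
  have "\<forall>i. \<exists>C\<ge>1. \<forall>a b \<theta>. 0 < \<theta> \<longrightarrow> \<bar>\<bar>a\<bar> - \<bar>b\<bar>\<bar> \<le> \<theta> \<longrightarrow>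
    measure (mu_k (\<kappa> $ i)) {t\<in>{-1..1}. \<bar>a * b\<bar> - a * b * t \<le> \<theta>\<^sup>2 / 2} \<le> C * (\<theta> / (\<bar>a\<bar> + \<theta>)) powr (2 * \<kappa> $ i)"
  proof
    fix i
    have "0 \<le> \<kappa> $ i" using \<kappa> by simp
    from mu_k_upper_product[OF this] obtain C where "1 \<le> C" "\<And>a b \<theta>. 0 < \<theta> \<Longrightarrow> \<bar>\<bar>a\<bar> - \<bar>b\<bar>\<bar> \<le> \<theta> \<Longrightarrow>
      measure (mu_k (\<kappa> $ i)) {t\<in>{-1..1}. \<bar>a * b\<bar> - a * b * t \<le> \<theta>\<^sup>2 / 2} \<le> C * (\<theta> / (\<bar>a\<bar> + \<theta>)) powr (2 * \<kappa> $ i)"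
      by blast
    then show "\<exists>C\<ge>1. \<forall>a b \<theta>. 0 < \<theta> \<longrightarrow> \<bar>\<bar>a\<bar> - \<bar>b\<bar>\<bar> \<le> \<theta> \<longrightarrow>
      measure (mu_k (\<kappa> $ i)) {t\<in>{-1..1}. \<bar>a * b\<bar> - a * b * t \<le> \<theta>\<^sup>2 / 2} \<le> C * (\<theta> / (\<bar>a\<bar> + \<theta>)) powr (2 * \<kappa> $ i)"
      by blast
  qed
  from choice[OF this] obtain C where C: "\<And>i. 1 \<le> C i" "\<And>i a b \<theta>. 0 < \<theta> \<Longrightarrow> \<bar>\<bar>a\<bar> - \<bar>b\<bar>\<bar> \<le> \<theta> \<Longrightarrow>
    measure (mu_k (\<kappa> $ i)) {t\<in>{-1..1}. \<bar>a * b\<bar> - a * b * t \<le> \<theta>\<^sup>2 / 2} \<le> C i * (\<theta> / (\<bar>a\<bar> + \<theta>)) powr (2 * \<kappa> $ i)"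
    by blast
  show thesis
  proof (rule that)
    have "0 < C i" for i using C(1)[of i] by linarith
    then show "0 < (\<Prod>i\<in>UNIV. C i)" by (intro prod_pos) auto
    fix x y :: "real^'n" and \<theta> assume x: "norm x = 1" and y: "norm y = 1" and t: "0 < \<theta>" "\<theta> \<le> pi"
    \<comment> \<open>The product measure lives on the full space; outside the cube the deficits
      need not be nonnegative, but that part is a null set.\<close>
    define N where "N = UNIV - Pi\<^sub>E UNIV (\<lambda>_::'n. {-1..1::real})"
    have N: "N \<in> sets Pk" "measure Pk N = 0"
    proof -
      have b: "Pi\<^sub>E UNIV (\<lambda>_::'n. {-1..1::real}) \<in> sets Pk" by (intro box_measurable_Pk) auto
      then show "N \<in> sets Pk" unfolding N_def using sets.compl_sets[OF b] by (simp add: space_Pk)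
      have "measure Pk N = 1 - measure Pk (Pi\<^sub>E UNIV (\<lambda>_::'n. {-1..1::real}))"
        unfolding N_def using P.prob_compl[OF b] by (simp add: space_Pk)
      also have "measure Pk (Pi\<^sub>E UNIV (\<lambda>_::'n. {-1..1::real})) = 1"
        using \<kappa> by (subst measure_Pk_box) (auto simp: measure_mu_k_interval)
      finally show "measure Pk N = 0" by simp
    qed
    have cs: "1 - cos \<theta> \<le> \<theta>\<^sup>2 / 2"
    proof -
      have "\<bar>sin (\<theta>/2)\<bar> \<le> \<bar>\<theta>/2\<bar>" by (rule abs_sin_x_le_abs_x)
      then have "(sin (\<theta>/2))\<^sup>2 \<le> (\<theta>/2)\<^sup>2" by (subst (asm) abs_le_square_iff)
      moreover have "cos \<theta> = 1 - 2 * (sin (\<theta>/2))\<^sup>2" using cos_double_sin[of "\<theta>/2"] by simp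
      ultimately show ?thesis by (simp add: power2_eq_square)
    qed
    have sq: "(\<Sum>i\<in>UNIV. (z $ i)\<^sup>2) = 1" if "norm z = 1" for z :: "real^'n"
      using that by (simp add: norm_vec_def L2_set_def)
    have key: "(\<Sum>i\<in>UNIV. (\<bar>x $ i\<bar> - \<bar>y $ i\<bar>)\<^sup>2) = 2 - 2 * (\<Sum>i\<in>UNIV. \<bar>x $ i * y $ i\<bar>)"
    proof -
      have "(\<Sum>i\<in>UNIV. (\<bar>x $ i\<bar> - \<bar>y $ i\<bar>)\<^sup>2) = (\<Sum>i\<in>UNIV. (x $ i)\<^sup>2 + (y $ i)\<^sup>2 - 2 * \<bar>x $ i * y $ i\<bar>)"
        by (intro sum.cong refl) (simp add: power2_diff abs_mult)
      then show ?thesis using sq[OF x] sq[OF y] by (simp add: sum.distrib sum_subtractf sum_distrib_left)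
    qed
    define A where "A i = {t\<in>{-1..1}. \<bar>x $ i * y $ i\<bar> - x $ i * y $ i * t \<le> \<theta>\<^sup>2 / 2}" for i
    have Am: "A i \<in> sets borel" for i unfolding A_def by measurable
    let ?E = "{t. (\<chi> i. y $ i * t i) \<in> Bset x \<theta>}"
    have inE: "(\<forall>i. \<bar>\<bar>x $ i\<bar> - \<bar>y $ i\<bar>\<bar> \<le> \<theta>) \<and> t \<in> Pi\<^sub>E UNIV A" if "t \<in> ?E" "t \<notin> N" for t
    proof -
      have t1: "\<bar>t i\<bar> \<le> 1" for i using that(2) by (auto simp: N_def PiE_iff abs_le_iff dest: spec[of _ i])
      have ip: "cos \<theta> \<le> (\<Sum>i\<in>UNIV. x $ i * y $ i * t i)"
        using that(1) by (simp add: Bset_def inner_vec_def mult.assoc)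
      have le1: "x $ i * y $ i * t i \<le> \<bar>x $ i * y $ i\<bar>" for i
        using mult_left_mono[OF t1[of i], of "\<bar>x $ i * y $ i\<bar>"] abs_ge_self[of "x $ i * y $ i * t i"] by (simp add: abs_mult)
      have S: "cos \<theta> \<le> (\<Sum>i\<in>UNIV. \<bar>x $ i * y $ i\<bar>)" using ip sum_mono[of UNIV "\<lambda>i. x $ i * y $ i * t i" "\<lambda>i. \<bar>x $ i * y $ i\<bar>"] le1 by (meson order.trans)
      have S1: "(\<Sum>i\<in>UNIV. \<bar>x $ i * y $ i\<bar>) \<le> 1" using key sum_nonneg[of UNIV "\<lambda>i. (\<bar>x $ i\<bar> - \<bar>y $ i\<bar>)\<^sup>2"] by simp
      have "\<bar>\<bar>x $ i\<bar> - \<bar>y $ i\<bar>\<bar> \<le> \<theta>" for i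
      proof -
        have "(\<bar>x $ i\<bar> - \<bar>y $ i\<bar>)\<^sup>2 \<le> (\<Sum>i\<in>UNIV. (\<bar>x $ i\<bar> - \<bar>y $ i\<bar>)\<^sup>2)" by (intro member_le_sum) auto
        also have "\<dots> \<le> \<theta>\<^sup>2" using key S cs by linarith
        finally show ?thesis using t(1) by (simp add: abs_le_square_iff[symmetric])
      qed
      moreover have "t i \<in> A i" for i
      proof -
        have "\<bar>x $ i * y $ i\<bar> - x $ i * y $ i * t i \<le> (\<Sum>i\<in>UNIV. \<bar>x $ i * y $ i\<bar> - x $ i * y $ i * t i)"
          using le1 by (intro member_le_sum) auto
        also have "\<dots> \<le> 1 - cos \<theta>" using ip S1 by (simp add: sum_subtractf)
        also note cs
        finally show ?thesis using t1[of i] by (simp add: A_def abs_le_iff)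
      qed
      ultimately show ?thesis by auto
    qed
    show "V_kappa \<kappa> (indicator (Bset x \<theta>)) y \<le>
      (if \<forall>i. \<bar>\<bar>x $ i\<bar> - \<bar>y $ i\<bar>\<bar> \<le> \<theta> then (\<Prod>i\<in>UNIV. C i) * decay \<kappa> x \<theta> else 0)"
    proof (cases "\<forall>i. \<bar>\<bar>x $ i\<bar> - \<bar>y $ i\<bar>\<bar> \<le> \<theta>")
      case True
      have "measure Pk ?E \<le> measure Pk (Pi\<^sub>E UNIV A \<union> N)"
        using inE N box_measurable_Pk[OF Am] by (intro P.finite_measure_mono) auto
      also have "\<dots> \<le> measure Pk (Pi\<^sub>E UNIV A) + measure Pk N"
        using N box_measurable_Pk[OF Am] by (intro measure_Un_le)
      also have "\<dots> = (\<Prod>i\<in>UNIV. measure (mu_k (\<kappa> $ i)) (A i))" using N measure_Pk_box[OF Am] by simp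
      also have "\<dots> \<le> (\<Prod>i\<in>UNIV. C i * (\<theta> / (\<bar>x $ i\<bar> + \<theta>)) powr (2 * \<kappa> $ i))"
        unfolding A_def using True t(1) by (intro prod_mono conjI C(2) measure_nonneg) auto
      finally show ?thesis using True by (simp add: V_kappa_eq_measure prod.distrib)
    next
      case False
      have "measure Pk ?E \<le> measure Pk N"
        using inE N False by (intro P.finite_measure_mono) blast+
      then show ?thesis unfolding V_kappa_eq_measure if_not_P[OF False] using N(2) by simp
    qed
  qed
qed

text \<open>Taylor's formula gives sin t >= t - t^3/6 >= t/3 on [0,2], which contains \<theta>/2;
  then 1 - cos \<theta> = 2 sin^2(\<theta>/2) >= 2 (\<theta>/6)^2.\<close>

lemma one_minus_cos_ge:
  assumes "0 \<le> \<theta>" "\<theta> \<le> pi"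
  shows "\<theta>\<^sup>2 / 18 \<le> 1 - cos \<theta>"
proof -
  define t where "t = \<theta>/2"
  have t: "0 \<le> t" "t \<le> 2" using assms pi_less_4 by (auto simp: t_def)
  have "\<bar>sin t - (\<Sum>m<3. sin_coeff m * t ^ m)\<bar> \<le> inverse (fact 3) * \<bar>t\<bar> ^ 3" by (rule Maclaurin_sin_bound)
  then have "\<bar>sin t - t\<bar> \<le> t^3 / 6" using t by (simp add: eval_nat_numeral sin_coeff_def fact_numeral)
  then have "t - t^3/6 \<le> sin t" by linarith
  moreover have "t^3 \<le> 4 * t"
  proof -
    have "t * t \<le> 2 * 2" using t by (intro mult_mono) auto
    then have "t * (t * t) \<le> t * 4" using t by (intro mult_left_mono) auto
    then show ?thesis by (simp add: power3_eq_cube)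
  qed
  ultimately have "t/3 \<le> sin t" by simp
  then have "(t/3)\<^sup>2 \<le> (sin t)\<^sup>2" using t by (intro power_mono) auto
  moreover have "cos \<theta> = 1 - 2 * (sin t)\<^sup>2" using cos_double_sin[of t] by (simp add: t_def)
  ultimately show ?thesis by (simp add: t_def power2_eq_square)
qed

text \<open>The admissible loss in the inner product is 1 - cos \<theta> >= \<theta>^2/18. Half of
  it is spent on x . y, the other half on the factors t_i, so requiring each coordinate to lose
  little gives a product event inside the ball. The norm condition is automatic since |t_i| <=
  1.\<close>

lemma V_kappa_lower:
  obtains c where "0 < c" "\<And>x y \<theta>. norm x = 1 \<Longrightarrow> norm y = 1 \<Longrightarrow> 0 < \<theta> \<Longrightarrow> \<theta> \<le> pi \<Longrightarrow>
    (\<And>i. 0 \<le> x $ i * y $ i) \<Longrightarrow> (\<And>i. \<bar>y $ i\<bar> \<le> \<bar>x $ i\<bar> + \<theta>) \<Longrightarrow> 1 - \<theta>\<^sup>2 / 36 \<le> x \<bullet> y \<Longrightarrow>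
    c * decay \<kappa> x \<theta> \<le> V_kappa \<kappa> (indicator (Bset x \<theta>)) y"
proof -
  interpret P: prob_space Pk by (rule prob_space_Pk)
  \<comment> \<open>The loss \<theta>^2/36 left for the factors t_i is divided equally among the
    coordinates.\<close>
  define e where "e = 1 / (36 * real CARD('n))"
  have "1 \<le> real CARD('n)" by (simp add: Suc_le_eq)
  then have e: "0 < e" "e \<le> 1" unfolding e_def by (simp, subst divide_le_eq_1_pos) linarith+
  have "\<forall>i. \<exists>c>0. \<forall>a b \<theta>. 0 < \<theta> \<longrightarrow> 0 \<le> a * b \<longrightarrow> \<bar>b\<bar> \<le> \<bar>a\<bar> + \<theta> \<longrightarrow>
    c * (\<theta> / (\<bar>a\<bar> + \<theta>)) powr (2 * \<kappa> $ i) \<le> measure (mu_k (\<kappa> $ i)) {t\<in>{-1..1}. a * b * (1 - t) \<le> e * \<theta>\<^sup>2}"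
  proof
    fix i
    have "0 \<le> \<kappa> $ i" using \<kappa> by simp
    from mu_k_lower_product[OF this e] obtain c where "0 < c" "\<And>a b \<theta>. 0 < \<theta> \<Longrightarrow> 0 \<le> a * b \<Longrightarrow> \<bar>b\<bar> \<le> \<bar>a\<bar> + \<theta> \<Longrightarrow>
      c * (\<theta> / (\<bar>a\<bar> + \<theta>)) powr (2 * \<kappa> $ i) \<le> measure (mu_k (\<kappa> $ i)) {t\<in>{-1..1}. a * b * (1 - t) \<le> e * \<theta>\<^sup>2}"
      by blast
    then show "\<exists>c>0. \<forall>a b \<theta>. 0 < \<theta> \<longrightarrow> 0 \<le> a * b \<longrightarrow> \<bar>b\<bar> \<le> \<bar>a\<bar> + \<theta> \<longrightarrow>
      c * (\<theta> / (\<bar>a\<bar> + \<theta>)) powr (2 * \<kappa> $ i) \<le> measure (mu_k (\<kappa> $ i)) {t\<in>{-1..1}. a * b * (1 - t) \<le> e * \<theta>\<^sup>2}"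
      by blast
  qed
  from choice[OF this] obtain c where c: "\<And>i. 0 < c i" "\<And>i a b \<theta>. 0 < \<theta> \<Longrightarrow> 0 \<le> a * b \<Longrightarrow> \<bar>b\<bar> \<le> \<bar>a\<bar> + \<theta> \<Longrightarrow>
    c i * (\<theta> / (\<bar>a\<bar> + \<theta>)) powr (2 * \<kappa> $ i) \<le> measure (mu_k (\<kappa> $ i)) {t\<in>{-1..1}. a * b * (1 - t) \<le> e * \<theta>\<^sup>2}"
    by blast
  show thesis
  proof (rule that)
    show "0 < (\<Prod>i\<in>UNIV. c i)" using c(1) by (intro prod_pos) auto
    fix x y :: "real^'n" and \<theta> assume x: "norm x = 1" and y: "norm y = 1" and t: "0 < \<theta>" "\<theta> \<le> pi"
      and xy: "\<And>i. 0 \<le> x $ i * y $ i" and yx: "\<And>i. \<bar>y $ i\<bar> \<le> \<bar>x $ i\<bar> + \<theta>" and ip: "1 - \<theta>\<^sup>2 / 36 \<le> x \<bullet> y"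
    define A where "A i = {t\<in>{-1..1}. x $ i * y $ i * (1 - t) \<le> e * \<theta>\<^sup>2}" for i
    have Am: "A i \<in> sets borel" for i unfolding A_def by measurable
    let ?E = "{t. (\<chi> i. y $ i * t i) \<in> Bset x \<theta>}"
    have "(\<Prod>i\<in>UNIV. c i) * decay \<kappa> x \<theta>
      = (\<Prod>i\<in>UNIV. c i * (\<theta> / (\<bar>x $ i\<bar> + \<theta>)) powr (2 * \<kappa> $ i))" by (simp add: prod.distrib)
    also have "\<dots> \<le> (\<Prod>i\<in>UNIV. measure (mu_k (\<kappa> $ i)) (A i))"
    proof (intro prod_mono conjI)
      fix i
      show "0 \<le> c i * (\<theta> / (\<bar>x $ i\<bar> + \<theta>)) powr (2 * \<kappa> $ i)" using c(1)[of i] by simp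
      show "c i * (\<theta> / (\<bar>x $ i\<bar> + \<theta>)) powr (2 * \<kappa> $ i) \<le> measure (mu_k (\<kappa> $ i)) (A i)"
        unfolding A_def by (intro c(2) t xy yx)
    qed
    also have "\<dots> = measure Pk (Pi\<^sub>E UNIV A)" using measure_Pk_box[OF Am] by simp
    also have "\<dots> \<le> measure Pk ?E"
    proof (intro P.finite_measure_mono V_set_measurable subsetI)
      fix t assume "t \<in> Pi\<^sub>E UNIV A"
      then have tA: "t i \<in> A i" for i by (auto simp: PiE_iff)
      have t1: "\<bar>t i\<bar> \<le> 1" for i using tA[of i] by (auto simp: A_def)
      have "norm (\<chi> i. y $ i * t i) \<le> norm y"
      proof (rule norm_le_componentwise_cart)
        fix i show "norm ((\<chi> i. y $ i * t i) $ i) \<le> norm (y $ i)"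
          using mult_left_mono[OF t1[of i], of "\<bar>y $ i\<bar>"] by (simp add: abs_mult)
      qed
      moreover have "cos \<theta> \<le> x \<bullet> (\<chi> i. y $ i * t i)"
      proof -
        have "x \<bullet> (\<chi> i. y $ i * t i) = x \<bullet> y - (\<Sum>i\<in>UNIV. x $ i * y $ i * (1 - t i))"
          by (simp add: inner_vec_def sum_subtractf[symmetric] algebra_simps)
        moreover have "(\<Sum>i\<in>UNIV. x $ i * y $ i * (1 - t i)) \<le> (\<Sum>i\<in>(UNIV::'n set). e * \<theta>\<^sup>2)"
          using tA by (intro sum_mono) (auto simp: A_def)
        moreover have "(\<Sum>i\<in>(UNIV::'n set). e * \<theta>\<^sup>2) = \<theta>\<^sup>2 / 36" by (simp add: e_def)
        moreover have "\<theta>\<^sup>2 / 18 \<le> 1 - cos \<theta>" using t by (intro one_minus_cos_ge) auto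
        ultimately show ?thesis using ip by linarith
      qed
      ultimately show "t \<in> ?E" using y by (simp add: Bset_def)
    qed
    finally show "(\<Prod>i\<in>UNIV. c i) * decay \<kappa> x \<theta> \<le> V_kappa \<kappa> (indicator (Bset x \<theta>)) y"
      by (simp add: V_kappa_eq_measure)
  qed
qed

end

section \<open>Lifting from the sphere to annuli\<close>

definition proj :: "real^'n \<Rightarrow> real^'n" where
  "proj x = x /\<^sub>R norm x"

lemma norm_proj: "x \<noteq> 0 \<Longrightarrow> norm (proj x) = 1"
  by (simp add: proj_def)

lemma proj_component: "proj x $ i = x $ i / norm x"
  by (simp add: proj_def divide_inverse)

lemma proj_scaleR: "0 < c \<Longrightarrow> proj (c *\<^sub>R x) = proj x"
  by (simp add: proj_def)

lemma sets_sph [measurable_cong]: "sets (sph_measure :: (real^'n) measure) = sets (restrict_space borel (sphere 0 1))"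
  by (simp add: sph_measure_def)

lemma space_sph: "space (sph_measure :: (real^'n) measure) = sphere 0 1"
  by (simp add: sph_measure_def space_restrict_space)

lemma proj_measurable: "proj \<in> restrict_space borel (- {0}) \<rightarrow>\<^sub>M (sph_measure :: (real^'n) measure)"
proof -
  have "proj \<in> restrict_space borel (- {0}) \<rightarrow>\<^sub>M restrict_space borel (sphere (0::real^'n) 1)"
  proof (rule measurable_restrict_space2)
    show "proj \<in> space (restrict_space borel (- {0})) \<rightarrow> sphere (0::real^'n) 1"
      by (auto simp: space_restrict_space norm_proj)
    show "proj \<in> restrict_space borel (- {0}) \<rightarrow>\<^sub>M (borel :: (real^'n) measure)"
      unfolding proj_def by (intro measurable_restrict_space1) measurable
  qed
  then show ?thesis by (simp add: measurable_cong_sets[OF refl sets_sph])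
qed

text \<open>G is measurable only on the sphere and \<open>proj\<close> lands there only away from 0;
  the indicator of a set avoiding 0 yields a Borel function on the whole space.\<close>

lemma homogeneous_measurable:
  fixes G :: "real^'n \<Rightarrow> ennreal"
  assumes "G \<in> borel_measurable sph_measure" "A \<in> sets borel" "0 \<notin> A"
  shows "(\<lambda>x. G (proj x) * indicator A x) \<in> borel_measurable borel"
proof -
  have "(\<lambda>x. G (proj x)) \<in> borel_measurable (restrict_space borel (- {0}))"
    using measurable_compose[OF proj_measurable assms(1)] .
  then have "(\<lambda>x. G (proj x) * indicator (- {0}) x) \<in> borel_measurable borel"
    by (subst (asm) borel_measurable_restrict_space_iff_ennreal) auto
  from borel_measurable_times_ennreal[OF this borel_measurable_indicator[OF assms(2)]]
  have "(\<lambda>x. (G (proj x) * indicator (- {0}) x) * indicator A x) \<in> borel_measurable borel" .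
  moreover have "(\<lambda>x. G (proj x) * indicator A x) = (\<lambda>x. (G (proj x) * indicator (- {0}) x) * indicator A x)"
    using assms(3) by (auto simp: indicator_def fun_eq_iff)
  ultimately show ?thesis by simp
qed

lemma nn_integral_sph:
  fixes G :: "real^'n \<Rightarrow> ennreal"
  assumes G: "G \<in> borel_measurable sph_measure"
  shows "(\<integral>\<^sup>+x. G x \<partial>sph_measure) = ennreal (real CARD('n)) * (\<integral>\<^sup>+x. G (proj x) * indicator (cball 0 1 - {0}) x \<partial>lborel)"
proof -
  let ?R = "restrict_space lborel (cball 0 1 - {0}) :: (real^'n) measure"
  have s: "sets ?R = sets (restrict_space (restrict_space borel (- {0})) (cball 0 1 - {0}))"
    by (subst sets_restrict_restrict_space) (auto simp: sets_restrict_space intro!: arg_cong2[where f="\<lambda>a b. (\<inter>) a ` b"])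
  have pm: "(\<lambda>x. x /\<^sub>R norm x) \<in> density ?R (\<lambda>_. ennreal (real CARD('n))) \<rightarrow>\<^sub>M restrict_space borel (sphere 0 1)"
    using measurable_restrict_space1[OF proj_measurable, of "cball 0 1 - {0}"]
    by (simp add: measurable_cong_sets[OF refl sets_sph] measurable_cong_sets[OF s refl] proj_def[abs_def])
  have Gm: "G \<in> borel_measurable (restrict_space borel (sphere 0 1))"
    using G by (simp add: measurable_cong_sets[OF sets_sph refl])
  have GR: "(\<lambda>x. G (proj x)) \<in> borel_measurable ?R"
    using measurable_compose[OF pm Gm] by (simp add: proj_def)
  have "(\<integral>\<^sup>+x. G x \<partial>sph_measure) = (\<integral>\<^sup>+x. G (x /\<^sub>R norm x) \<partial>density ?R (\<lambda>_. ennreal (real CARD('n))))"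
    unfolding sph_measure_def using Gm by (subst nn_integral_distr[OF pm]) auto
  also have "\<dots> = (\<integral>\<^sup>+x. ennreal (real CARD('n)) * G (proj x) \<partial>?R)"
    using GR by (subst nn_integral_density) (auto simp: proj_def)
  also have "\<dots> = ennreal (real CARD('n)) * (\<integral>\<^sup>+x. G (proj x) \<partial>?R)"
    using GR by (rule nn_integral_cmult)
  also have "(\<integral>\<^sup>+x. G (proj x) \<partial>?R) = (\<integral>\<^sup>+x. G (proj x) * indicator (cball 0 1 - {0}) x \<partial>lborel)"
    by (rule nn_integral_restrict_space) auto
  finally show ?thesis .
qed

text \<open>Half-open, so that concentric annuli are adjacent without overlap and
  \<open>annulus 0 r\<close> is the punctured ball.\<close>

definition annulus :: "real \<Rightarrow> real \<Rightarrow> (real^'n) set" where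
  "annulus a b = {x. a < norm x \<and> norm x \<le> b}"

lemma annulus_borel [measurable]: "annulus a b \<in> sets borel"
  unfolding annulus_def by measurable

text \<open>\<open>G (proj x)\<close> is invariant under dilation, so only the Jacobian r^n of the
  scaling to the unit ball appears.\<close>

lemma nn_integral_punctured_ball:
  fixes G :: "real^'n \<Rightarrow> ennreal"
  assumes G: "G \<in> borel_measurable sph_measure" and r: "0 < r"
  shows "ennreal (real CARD('n)) * (\<integral>\<^sup>+x. G (proj x) * indicator (annulus 0 r) x \<partial>lborel) = ennreal (r ^ CARD('n)) * (\<integral>\<^sup>+x. G x \<partial>sph_measure)"
proof -
  have m: "(\<lambda>x. G (proj x) * indicator (annulus 0 r) x) \<in> borel_measurable borel"
    using G by (intro homogeneous_measurable) (auto simp: annulus_def[of 0])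
  have eq: "G (proj (r *\<^sub>R x)) * indicator (annulus 0 r) (r *\<^sub>R x) = G (proj x) * indicator (cball 0 1 - {0}) x" for x :: "real^'n"
    using r by (auto simp: proj_scaleR indicator_def annulus_def)
  have m1: "(\<lambda>x. G (proj x) * indicator (cball 0 1 - {0}) x) \<in> borel_measurable borel"
    using G by (intro homogeneous_measurable) auto
  have "(\<integral>\<^sup>+x. G (proj x) * indicator (annulus 0 r) x \<partial>lborel)
    = (\<integral>\<^sup>+x. G (proj x) * indicator (annulus 0 r) x \<partial>density (distr lborel borel (\<lambda>x. 0 + r *\<^sub>R x)) (\<lambda>_. ennreal (\<bar>r\<bar> ^ DIM(real^'n))))"
    using lborel_affine[of r "0 :: real^'n"] r by simp
  also have "\<dots> = ennreal (r ^ CARD('n)) * (\<integral>\<^sup>+x. G (proj x) * indicator (annulus 0 r) x \<partial>distr lborel borel (\<lambda>x. 0 + r *\<^sub>R x))"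
    using m r by (subst nn_integral_density) (auto simp: nn_integral_cmult)
  also have "(\<integral>\<^sup>+x. G (proj x) * indicator (annulus 0 r) x \<partial>distr lborel borel (\<lambda>x. 0 + r *\<^sub>R x)) = (\<integral>\<^sup>+x. G (proj x) * indicator (cball 0 1 - {0}) x \<partial>lborel)"
    using m by (subst nn_integral_distr) (auto simp: eq)
  finally show ?thesis by (simp add: nn_integral_sph[OF G] mult_ac)
qed

lemma emeasure_sph_finite: "emeasure (sph_measure :: (real^'n) measure) (space sph_measure) < top"
proof -
  have "emeasure (sph_measure :: (real^'n) measure) (space sph_measure) = (\<integral>\<^sup>+x. 1 \<partial>(sph_measure :: (real^'n) measure))" by simp
  also have "\<dots> = ennreal (real CARD('n)) * (\<integral>\<^sup>+x. 1 * indicator (cball 0 1 - {0}) (x::real^'n) \<partial>lborel)"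
    by (rule nn_integral_sph) simp
  finally have eq: "emeasure (sph_measure :: (real^'n) measure) (space sph_measure) = ennreal (real CARD('n)) * (\<integral>\<^sup>+x. 1 * indicator (cball 0 1 - {0}) (x::real^'n) \<partial>lborel)" .
  have "(\<integral>\<^sup>+x. 1 * indicator (cball 0 1 - {0}) (x::real^'n) \<partial>lborel) \<le> emeasure lborel (cball (0::real^'n) 1)"
    by (simp add: nn_integral_indicator emeasure_mono)
  also have "\<dots> < top" using emeasure_lborel_cball_finite by (simp add: less_top)
  finally show ?thesis unfolding eq by (simp add: ennreal_mult_less_top)
qed

text \<open>Subtracts two punctured balls. Cancellation requires finite integrals, hence the detour
  through min(G, m), which is integrable because the surface measure is finite, followed by monotone
  convergence.\<close>

lemma nn_integral_annulus:
  fixes G :: "real^'n \<Rightarrow> ennreal"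
  assumes G: "G \<in> borel_measurable sph_measure" and ab: "0 < a" "a < b"
  shows "ennreal (real CARD('n)) * (\<integral>\<^sup>+x. G (proj x) * indicator (annulus a b) x \<partial>lborel) = ennreal (b ^ CARD('n) - a ^ CARD('n)) * (\<integral>\<^sup>+x. G x \<partial>sph_measure)"
proof -
  let ?n = "CARD('n)"
  have bounded: "ennreal (real ?n) * (\<integral>\<^sup>+x. G (proj x) * indicator (annulus a b) x \<partial>lborel) = ennreal (b ^ ?n - a ^ ?n) * (\<integral>\<^sup>+x. G x \<partial>sph_measure)"
    if G: "G \<in> borel_measurable sph_measure" and fin: "(\<integral>\<^sup>+x. G x \<partial>sph_measure) < top" for G :: "real^'n \<Rightarrow> ennreal"
  proof -
    let ?J = "\<lambda>A. (\<integral>\<^sup>+x. G (proj x) * indicator A x \<partial>lborel)"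
    have m: "(\<lambda>x. G (proj x) * indicator (annulus c d) x) \<in> borel_measurable borel" if "0 \<le> c" for c d
      using G that by (intro homogeneous_measurable) (auto simp: annulus_def[of c])
    have "?J (annulus 0 b) = (\<integral>\<^sup>+x. G (proj x) * indicator (annulus 0 a) x + G (proj x) * indicator (annulus a b) x \<partial>lborel)"
      using ab by (intro nn_integral_cong) (auto simp: indicator_def annulus_def)
    also have "\<dots> = ?J (annulus 0 a) + ?J (annulus a b)"
      using m[of 0 a] m[of a b] ab by (intro nn_integral_add) auto
    finally have "ennreal (b ^ ?n) * (\<integral>\<^sup>+x. G x \<partial>sph_measure)
        = ennreal (a ^ ?n) * (\<integral>\<^sup>+x. G x \<partial>sph_measure) + ennreal (real ?n) * ?J (annulus a b)"
      using nn_integral_punctured_ball[OF G, of a] nn_integral_punctured_ball[OF G, of b] ab by (simp add: distrib_left)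
    moreover have "ennreal (b ^ ?n) = ennreal (a ^ ?n) + ennreal (b ^ ?n - a ^ ?n)"
      using ab by (subst ennreal_plus[symmetric]) (auto intro: power_mono)
    ultimately have "ennreal (a ^ ?n) * (\<integral>\<^sup>+x. G x \<partial>sph_measure) + ennreal (b ^ ?n - a ^ ?n) * (\<integral>\<^sup>+x. G x \<partial>sph_measure)
        = ennreal (a ^ ?n) * (\<integral>\<^sup>+x. G x \<partial>sph_measure) + ennreal (real ?n) * ?J (annulus a b)"
      by (simp add: distrib_right)
    moreover have "ennreal (a ^ ?n) * (\<integral>\<^sup>+x. G x \<partial>sph_measure) < top" using fin by (simp add: ennreal_mult_less_top)
    ultimately show ?thesis by (auto simp: ennreal_add_left_cancel)
  qed
  define T where "T m x = min (G x) (of_nat m)" for m x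
  have Tm: "T m \<in> borel_measurable sph_measure" for m unfolding T_def using G by measurable
  have sup: "(SUP m. T m x) = G x" for x
    unfolding T_def by (simp add: inf_min[symmetric] flip: inf_SUP) (simp add: ennreal_SUP_of_nat_eq_top inf_min)
  have inc: "T m x \<le> T (Suc m) x" for m x unfolding T_def by (intro min.mono order_refl of_nat_mono) simp
  have fin: "(\<integral>\<^sup>+x. T m x \<partial>sph_measure) < top" for m
  proof -
    have "(\<integral>\<^sup>+x. T m x \<partial>sph_measure) \<le> (\<integral>\<^sup>+x. of_nat m \<partial>(sph_measure :: (real^'n) measure))"
      by (intro nn_integral_mono) (auto simp: T_def)
    also have "\<dots> < top" using emeasure_sph_finite[where 'n='n] by (simp add: ennreal_mult_less_top of_nat_less_top)
    finally show ?thesis .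
  qed
  have "(\<integral>\<^sup>+x. G (proj x) * indicator (annulus a b) x \<partial>lborel) = (\<integral>\<^sup>+x. (SUP m. T m (proj x) * indicator (annulus a b) x) \<partial>lborel)"
    by (simp add: sup flip: SUP_mult_right_ennreal)
  also have "\<dots> = (SUP m. \<integral>\<^sup>+x. T m (proj x) * indicator (annulus a b) x \<partial>lborel)"
  proof (rule nn_integral_monotone_convergence_SUP)
    show "incseq (\<lambda>m x. T m (proj x) * indicator (annulus a b) x)"
      by (intro incseq_SucI le_funI mult_right_mono inc) auto
    show "(\<lambda>x. T m (proj x) * indicator (annulus a b) x) \<in> borel_measurable lborel" for m
      using homogeneous_measurable[OF Tm, of "annulus a b"] ab by (auto simp: annulus_def)
  qed
  finally have 1: "ennreal (real ?n) * (\<integral>\<^sup>+x. G (proj x) * indicator (annulus a b) x \<partial>lborel)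
    = (SUP m. ennreal (b ^ ?n - a ^ ?n) * (\<integral>\<^sup>+x. T m x \<partial>sph_measure))"
    by (simp add: SUP_mult_left_ennreal bounded[OF Tm fin])
  have "(\<integral>\<^sup>+x. G x \<partial>sph_measure) = (SUP m. \<integral>\<^sup>+x. T m x \<partial>sph_measure)"
    unfolding sup[symmetric] using Tm inc
    by (intro nn_integral_monotone_convergence_SUP incseq_SucI le_funI)
  then show ?thesis unfolding 1 by (simp add: SUP_mult_left_ennreal)
qed

text \<open>The nonnegative integral of a non-measurable function is its lower integral, so measurability of
  the left-hand side of the main theorem is not an issue.\<close>

lemma nn_integral_le_of_measurable_le:
  assumes "\<And>g. g \<in> borel_measurable M \<Longrightarrow> (\<And>x. g x \<le> f x) \<Longrightarrow> (\<integral>\<^sup>+x. g x \<partial>M) \<le> C"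
  shows "(\<integral>\<^sup>+x. f x \<partial>M) \<le> C"
  unfolding nn_integral_def
proof (rule SUP_least)
  fix g assume "g \<in> {g. simple_function M g \<and> g \<le> f}"
  then have g: "simple_function M g" "\<And>x. g x \<le> f x" by (auto simp: le_fun_def)
  have "integral\<^sup>S M g = (\<integral>\<^sup>+x. g x \<partial>M)" using g(1) by (rule nn_integral_eq_simple_integral[symmetric])
  also have "\<dots> \<le> C" using g by (intro assms) (auto dest: borel_measurable_simple_function)
  finally show "integral\<^sup>S M g \<le> C" .
qed

lemma hw_proj_sq:
  assumes "x \<noteq> 0"
  shows "(hw \<tau> (proj x))\<^sup>2 = norm x powr (- 2 * (\<Sum>i\<in>UNIV. \<tau> $ i)) * (hw \<tau> x)\<^sup>2"
proof -
  have "hw \<tau> (proj x) = (\<Prod>i\<in>UNIV. norm x powr (- \<tau> $ i) * \<bar>x $ i\<bar> powr (\<tau> $ i))"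
    unfolding hw_def using assms
    by (intro prod.cong refl) (simp add: proj_component powr_divide powr_minus_divide)
  also have "\<dots> = norm x powr (- (\<Sum>i\<in>UNIV. \<tau> $ i)) * hw \<tau> x"
    using assms by (simp add: hw_def prod.distrib powr_sum[symmetric] sum_negf)
  finally have "(hw \<tau> (proj x))\<^sup>2 = (norm x powr (- (\<Sum>i\<in>UNIV. \<tau> $ i)))\<^sup>2 * (hw \<tau> x)\<^sup>2" by (simp add: power_mult_distrib)
  also have "(norm x powr (- (\<Sum>i\<in>UNIV. \<tau> $ i)))\<^sup>2 = norm x powr (- 2 * (\<Sum>i\<in>UNIV. \<tau> $ i))"
    by (simp add: power2_eq_square flip: powr_add)
  finally show ?thesis .
qed

section \<open>Pointwise domination by the strong maximal function\<close>

text \<open>Multiplied by \<theta>^n with n the number of coordinates, this is the order of the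
  h_\<kappa>^2 dx measure of a box of side \<theta> around x; on the sphere one factor \<theta> is
  missing.\<close>

abbreviation (input) spread :: "real^'n \<Rightarrow> real^'n \<Rightarrow> real \<Rightarrow> real" where
  "spread \<kappa> x \<theta> \<equiv> (\<Prod>i\<in>UNIV. (\<bar>x $ i\<bar> + \<theta>) powr (2 * \<kappa> $ i))"

abbreviation (input) M_num :: "real^'n \<Rightarrow> (real^'n \<Rightarrow> real) \<Rightarrow> real^'n \<Rightarrow> real \<Rightarrow> ennreal" where
  "M_num \<kappa> f x \<theta> \<equiv> (\<integral>\<^sup>+y. ennreal (\<bar>f y\<bar> * V_kappa \<kappa> (indicator (Bset x \<theta>)) y * (hw \<kappa> y)^2) \<partial>sph_measure)"

abbreviation (input) M_den :: "real^'n \<Rightarrow> real^'n \<Rightarrow> real \<Rightarrow> ennreal" where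
  "M_den \<kappa> x \<theta> \<equiv> (\<integral>\<^sup>+y. ennreal (V_kappa \<kappa> (indicator (Bset x \<theta>)) y * (hw \<kappa> y)^2) \<partial>sph_measure)"

definition coord_list :: "'n::finite list" where
  "coord_list = (SOME L. distinct L \<and> set L = UNIV)"

lemma coord_list: "distinct (coord_list :: 'n::finite list)" "set (coord_list :: 'n list) = UNIV"
proof -
  have "\<exists>L :: 'n list. distinct L \<and> set L = UNIV" using finite_distinct_list[of "UNIV :: 'n set"] by auto
  then have "distinct (coord_list :: 'n list) \<and> set (coord_list :: 'n list) = UNIV"
    unfolding coord_list_def by (rule someI_ex)
  then show "distinct (coord_list :: 'n list)" "set (coord_list :: 'n list) = UNIV" by auto
qed

text \<open>Not a supremum over boxes, but an iterated operator that dominates all box averages; in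
  this form Fubini applies. The order of the coordinates in \<open>coord_list\<close> is
  arbitrary.\<close>

definition strong_max :: "real^'n \<Rightarrow> (real^'n \<Rightarrow> ennreal) \<Rightarrow> real^'n \<Rightarrow> ennreal" where
  "strong_max \<kappa> F x = maxfn_iter (\<lambda>i. \<kappa> $ i) coord_list (\<lambda>g. F (\<chi> i. g i)) (\<lambda>i. x $ i)"

lemma vec_fun_measurable:
  fixes F :: "real^'n \<Rightarrow> ennreal"
  assumes "F \<in> borel_measurable borel"
  shows "(\<lambda>g. F (\<chi> i. g i)) \<in> borel_measurable borel_fun"
  using measurable_compose[OF measurable_vec_lambda assms] .

lemma strong_max_measurable:
  assumes "F \<in> borel_measurable borel"
  shows "strong_max \<kappa> F \<in> borel_measurable borel"
proof -
  have "(\<lambda>x i. x $ i) \<in> (borel :: (real^'n) measure) \<rightarrow>\<^sub>M borel_fun"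
    by (intro measurable_PiM_single') (auto intro!: borel_measurable_continuous_onI continuous_intros)
  from measurable_compose[OF this maxfn_iter_measurable[OF vec_fun_measurable[OF assms]]]
  show ?thesis unfolding strong_max_def[abs_def] .
qed

lemma strong_max_vector_valued:
  fixes \<kappa> \<tau> :: "real^'n"
  assumes p: "1 < p" and k: "\<And>i. 0 \<le> \<kappa> $ i" and t: "\<And>i. -1/2 < \<tau> $ i" "\<And>i. \<tau> $ i < p * \<kappa> $ i + (p-1)/2"
  obtains C where "0 < C" "\<And>F :: nat \<Rightarrow> real^'n \<Rightarrow> ennreal. (\<And>j. F j \<in> borel_measurable borel) \<Longrightarrow>
      sq_integral lborel p (\<lambda>x. ennreal ((hw \<tau> x)\<^sup>2)) (\<lambda>j. strong_max \<kappa> (F j))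
        \<le> ennreal C * sq_integral lborel p (\<lambda>x. ennreal ((hw \<tau> x)\<^sup>2)) F"
proof -
  obtain C where C: "0 < C" "\<And>F :: nat \<Rightarrow> ('n \<Rightarrow> real) \<Rightarrow> ennreal. (\<And>j. F j \<in> borel_measurable borel_fun) \<Longrightarrow>
      sq_integral_un (power_product (\<lambda>i. \<tau> $ i)) p (\<lambda>j. maxfn_iter (\<lambda>i. \<kappa> $ i) coord_list (F j))
        \<le> ennreal C * sq_integral_un (power_product (\<lambda>i. \<tau> $ i)) p F"
    using vector_valued_maxfn_iter[OF p, of "\<lambda>i. \<kappa> $ i" "\<lambda>i. \<tau> $ i" coord_list] k t by blast
  show thesis
  proof (rule that[OF C(1)])
    fix F :: "nat \<Rightarrow> real^'n \<Rightarrow> ennreal" assume F[measurable]: "\<And>j. F j \<in> borel_measurable borel"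
    have [measurable]: "strong_max \<kappa> (F j) \<in> borel_measurable borel" for j by (intro strong_max_measurable F)
    have "sq_integral lborel p (\<lambda>x. ennreal ((hw \<tau> x)\<^sup>2)) (\<lambda>j. strong_max \<kappa> (F j))
      = (\<integral>\<^sup>+x. enn_powr (\<Sum>j. (strong_max \<kappa> (F j) (\<chi> i. x i))\<^sup>2) (p/2) \<partial>power_product (\<lambda>i. \<tau> $ i))"
      by (rule nn_integral_power_product_vec[symmetric]) measurable
    also have "\<dots> \<le> ennreal C * (\<integral>\<^sup>+x. enn_powr (\<Sum>j. (F j (\<chi> i. x i))\<^sup>2) (p/2) \<partial>power_product (\<lambda>i. \<tau> $ i))"
      using C(2)[of "\<lambda>j g. F j (\<chi> i. g i)"] vec_fun_measurable[OF F] by (simp add: strong_max_def)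
    also have "(\<integral>\<^sup>+x. enn_powr (\<Sum>j. (F j (\<chi> i. x i))\<^sup>2) (p/2) \<partial>power_product (\<lambda>i. \<tau> $ i))
      = sq_integral lborel p (\<lambda>x. ennreal ((hw \<tau> x)\<^sup>2)) F"
      by (rule nn_integral_power_product_vec) measurable
    finally show "sq_integral lborel p (\<lambda>x. ennreal ((hw \<tau> x)\<^sup>2)) (\<lambda>j. strong_max \<kappa> (F j))
        \<le> ennreal C * sq_integral lborel p (\<lambda>x. ennreal ((hw \<tau> x)\<^sup>2)) F" .
  qed
qed

lemma strong_max_box:
  fixes \<kappa> :: "real^'n"
  assumes F: "F \<in> borel_measurable borel" and k: "\<And>i. 0 \<le> \<kappa> $ i"
    and A: "\<And>i. A i \<in> rat_shells" and x: "\<And>i. x $ i \<in> A i"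
  shows "(\<integral>\<^sup>+y. F y * (\<Prod>i\<in>UNIV. indicator (A i) (y $ i)) * ennreal ((hw \<kappa> y)\<^sup>2) \<partial>lborel)
    \<le> (\<Prod>i\<in>UNIV. emeasure (power_measure (\<kappa> $ i)) (A i)) * strong_max \<kappa> F x"
proof -
  have [measurable]: "A i \<in> sets borel" for i using A[of i] by (auto simp: rat_shells_def)
  have [measurable]: "(\<lambda>y. y $ i) \<in> (borel :: (real^'n) measure) \<rightarrow>\<^sub>M borel" for i
    by (intro borel_measurable_continuous_onI continuous_intros)
  have [measurable]: "(\<lambda>y::real^'n. indicator (A i) (y $ i) :: ennreal) \<in> borel_measurable borel" for i
    by measurable
  have pm: "(\<lambda>y::real^'n. \<Prod>i\<in>UNIV. indicator (A i) (y $ i) :: ennreal) \<in> borel_measurable borel"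
    by (intro borel_measurable_prod_ennreal) measurable
  have "(\<integral>\<^sup>+y. F y * (\<Prod>i\<in>UNIV. indicator (A i) (y $ i)) * ennreal ((hw \<kappa> y)\<^sup>2) \<partial>lborel)
    = (\<integral>\<^sup>+y. F (\<chi> i. y i) * (\<Prod>i\<in>UNIV. indicator (A i) ((\<chi> i. y i) $ i)) \<partial>power_product (\<lambda>i. \<kappa> $ i))"
    by (intro nn_integral_power_product_vec[symmetric] borel_measurable_times_ennreal[OF F pm])
  also have "\<dots> \<le> (\<Prod>i\<in>UNIV. emeasure (power_measure (\<kappa> $ i)) (A i)) * strong_max \<kappa> F x"
    using box_mean_le_maxfn_iter[OF vec_fun_measurable[OF F], of "\<lambda>i. \<kappa> $ i" A coord_list "\<lambda>i. x $ i"] k A x coord_list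
    by (simp add: strong_max_def)
  finally show ?thesis .
qed

lemma prod_mono_enn:
  fixes f g :: "'a \<Rightarrow> ennreal"
  assumes "\<And>i. f i \<le> g i"
  shows "prod f A \<le> prod g A"
  by (induction A rule: infinite_finite_induct) (auto intro!: mult_mono assms)

text \<open>The tolerance 12\<theta> is the coordinate displacement found in the numerator estimate.
  Rounding the endpoints to rationals takes place between 12\<theta> and 14\<theta>, so the length
  is at most 28\<theta> and the outer end at most 14(s+\<theta>). The inner end is 0 if s <=
  12\<theta>.\<close>

lemma rat_shell_cover:
  assumes k: "0 \<le> k"
  obtains C where "0 < C" "\<And>s \<theta>. 0 \<le> s \<Longrightarrow> 0 < \<theta> \<Longrightarrow>
    \<exists>A\<in>rat_shells. (\<forall>t. \<bar>\<bar>t\<bar> - s\<bar> \<le> 12 * \<theta> \<longrightarrow> t \<in> A) \<and> emeasure (power_measure k) A \<le> ennreal (C * (\<theta> * (s + \<theta>) powr (2*k)))"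
proof -
  have "-1 < 2*k" using k by simp
  from nn_integral_powr_shell_le[OF this] obtain c where c: "0 < c"
    "\<And>a b. 0 \<le> a \<Longrightarrow> a < b \<Longrightarrow> emeasure (power_measure k) (shell a b) \<le> ennreal (c * ((b-a) * b powr (2*k)))"
    unfolding emeasure_power_measure_shell by blast
  show thesis
  proof (rule that)
    show "0 < c * (28 * 14 powr (2*k))" using c by simp
    fix s \<theta> :: real assume s: "0 \<le> s" and t: "0 < \<theta>"
    obtain b where b: "b \<in> \<rat>" "s + 12 * \<theta> < b" "b < s + 14 * \<theta>"
      using Rats_dense_in_real[of "s + 12 * \<theta>" "s + 14 * \<theta>"] t by auto
    obtain a where a: "a \<in> \<rat>" "0 \<le> a" "s - 14 * \<theta> \<le> a" "a \<le> max 0 (s - 12 * \<theta>)"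
    proof (cases "s - 12 * \<theta> \<le> 0")
      case True
      then show thesis using t by (intro that[of 0]) auto
    next
      case False
      obtain a where "a \<in> \<rat>" "max 0 (s - 14 * \<theta>) < a" "a < s - 12 * \<theta>"
        using Rats_dense_in_real[of "max 0 (s - 14 * \<theta>)" "s - 12 * \<theta>"] False t by auto
      then show thesis by (intro that[of a]) auto
    qed
    have ab: "a < b" using a b s t by (auto simp: max_def split: if_splits)
    have "shell a b \<in> rat_shells" unfolding rat_shells_def using a b ab by blast
    moreover have "t \<in> shell a b" if "\<bar>\<bar>t\<bar> - s\<bar> \<le> 12 * \<theta>" for t
      using that a b by (auto simp: shell_def max_def split: if_splits)
    moreover have "emeasure (power_measure k) (shell a b) \<le> ennreal (c * (28 * 14 powr (2*k)) * (\<theta> * (s + \<theta>) powr (2*k)))"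
    proof -
      have "b powr (2*k) \<le> (14 * (s + \<theta>)) powr (2*k)" using a b ab s t k by (intro powr_mono2) auto
      also have "\<dots> = 14 powr (2*k) * (s + \<theta>) powr (2*k)" by (rule powr_mult)
      finally have "(b - a) * b powr (2*k) \<le> (28 * \<theta>) * (14 powr (2*k) * (s + \<theta>) powr (2*k))"
        using a b ab s t by (intro mult_mono) auto
      then have "c * ((b - a) * b powr (2*k)) \<le> c * ((28 * \<theta>) * (14 powr (2*k) * (s + \<theta>) powr (2*k)))"
        using c by (intro mult_left_mono) auto
      also have "\<dots> = c * (28 * 14 powr (2*k)) * (\<theta> * (s + \<theta>) powr (2*k))" by simp
      finally show ?thesis using c(2)[OF a(2) ab] by (meson ennreal_leI order.trans)
    qed
    ultimately show "\<exists>A\<in>rat_shells. (\<forall>t. \<bar>\<bar>t\<bar> - s\<bar> \<le> 12 * \<theta> \<longrightarrow> t \<in> A) \<and>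
      emeasure (power_measure k) A \<le> ennreal (c * (28 * 14 powr (2*k)) * (\<theta> * (s + \<theta>) powr (2*k)))" by blast
  qed
qed

section \<open>Comparison of numerator and denominator with integrals over thin annuli\<close>

lemma borel_measurable_sph: "g \<in> borel_measurable borel \<Longrightarrow> g \<in> borel_measurable (sph_measure :: (real^'n) measure)"
  by (simp add: measurable_cong_sets[OF sets_sph refl] measurable_restrict_space1)

lemma vec_nth_borel [measurable]: "(\<lambda>y::real^'n. y $ i) \<in> borel_measurable borel"
  by (intro borel_measurable_continuous_onI continuous_intros)

lemma hw_borel [measurable]: "hw \<tau> \<in> borel_measurable borel"
  unfolding hw_def[abs_def] by measurable

text \<open>The volume factor of an annulus of relative thickness \<theta> is of order n \<theta>:
  Bernoulli's inequality from below, an induction replacing the mean value theorem from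
  above.\<close>

lemma power_annulus_bounds:
  fixes r \<theta> :: real
  assumes r: "1 \<le> r" "r * (1 + \<theta>) \<le> 10" and t: "0 < \<theta>"
  shows "real n * \<theta> \<le> (r * (1 + \<theta>)) ^ n - r ^ n" "(r * (1 + \<theta>)) ^ n - r ^ n \<le> real n * \<theta> * 10 ^ n"
proof -
  have B: "1 + real n * \<theta> \<le> (1 + \<theta>) ^ n" using t by (intro Bernoulli_inequality) auto
  have "1 * (real n * \<theta>) \<le> r ^ n * ((1 + \<theta>) ^ n - 1)"
    using B r t by (intro mult_mono) auto
  then show "real n * \<theta> \<le> (r * (1 + \<theta>)) ^ n - r ^ n" by (simp only: power_mult_distrib) (simp add: right_diff_distrib)
  have U: "(1 + \<theta>) ^ n - 1 \<le> real n * \<theta> * (1 + \<theta>) ^ n"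
  proof (induction n)
    case (Suc n)
    have "(1 + \<theta>) ^ Suc n - 1 = (1 + \<theta>) * ((1 + \<theta>) ^ n - 1) + \<theta> * 1" by (simp add: algebra_simps)
    also have "\<dots> \<le> (1 + \<theta>) * (real n * \<theta> * (1 + \<theta>) ^ n) + \<theta> * (1 + \<theta>) ^ Suc n"
      using Suc t by (intro add_mono mult_left_mono one_le_power) auto
    also have "\<dots> = real (Suc n) * \<theta> * (1 + \<theta>) ^ Suc n" by (simp add: algebra_simps)
    finally show ?case .
  qed simp
  have "r ^ n * ((1 + \<theta>) ^ n - 1) \<le> r ^ n * (real n * \<theta> * (1 + \<theta>) ^ n)"
    using U r by (intro mult_left_mono) auto
  also have "\<dots> = real n * \<theta> * (r * (1 + \<theta>)) ^ n" by (simp add: power_mult_distrib)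
  also have "\<dots> \<le> real n * \<theta> * 10 ^ n" using r t by (intro mult_left_mono power_mono) auto
  finally show "(r * (1 + \<theta>)) ^ n - r ^ n \<le> real n * \<theta> * 10 ^ n" by (simp only: power_mult_distrib) (simp add: right_diff_distrib)
qed

text \<open>Origin of the outer radius 10: base points have norm at most 2, and \<theta> <= pi <
  4.\<close>

lemma annulus_radius:
  fixes r \<theta> :: real
  assumes "r \<le> 2" "0 < \<theta>" "\<theta> \<le> pi"
  shows "r * (1 + \<theta>) \<le> 10"
proof -
  have "r * (1 + \<theta>) \<le> 2 * (1 + 4)" using assms pi_less_4 by (intro mult_mono) auto
  then show ?thesis by simp
qed

text \<open>The cutoff contains all thin annuli starting at radii between 1 and 2, and confines the
  degree-0 extension to a bounded region away from 0, where weighted integrals are comparable to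
  those on the sphere.\<close>

definition lift :: "(real^'n \<Rightarrow> real) \<Rightarrow> real^'n \<Rightarrow> ennreal" where
  "lift f y = ennreal \<bar>f (proj y)\<bar> * indicator (annulus 1 10) y"

lemma lift_measurable:
  assumes "f \<in> borel_measurable sph_measure"
  shows "lift f \<in> borel_measurable borel"
  unfolding lift_def[abs_def] using assms
  by (intro homogeneous_measurable[where G="\<lambda>x. ennreal \<bar>f x\<bar>"]) (auto simp: annulus_def)

text \<open>The bound on \<open>V_kappa\<close> reduces the numerator to the integral of the
  weighted |f| over E. Thickening it to the annulus from r to r(1+\<theta>) places it inside a
  product of shells around x, where the iterated maximal function bounds the box integral.\<close>

lemma M_kappa_numerator:
  fixes \<kappa> :: "real^'n"
  assumes k: "\<forall>i. 0 \<le> \<kappa> $ i"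
  obtains C where "0 < C" "\<And>f x \<theta>. f \<in> borel_measurable sph_measure \<Longrightarrow> 1 < norm x \<Longrightarrow> norm x \<le> 2 \<Longrightarrow> 0 < \<theta> \<Longrightarrow> \<theta> \<le> pi \<Longrightarrow>
    M_num \<kappa> f (proj x) \<theta>
    \<le> ennreal (C * decay \<kappa> (proj x) \<theta> * (\<theta> ^ (CARD('n) - 1) * spread \<kappa> (proj x) \<theta>))
      * strong_max \<kappa> (lift f) x"
proof -
  obtain C1 where C1: "0 < C1" "\<And>x y \<theta>. norm x = 1 \<Longrightarrow> norm y = 1 \<Longrightarrow> 0 < \<theta> \<Longrightarrow> \<theta> \<le> pi \<Longrightarrow>
    V_kappa \<kappa> (indicator (Bset x \<theta>)) y \<le>
      (if \<forall>i. \<bar>\<bar>x $ i\<bar> - \<bar>y $ i\<bar>\<bar> \<le> \<theta> then C1 * decay \<kappa> x \<theta> else 0)"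
    using V_kappa_upper[OF k] by blast
  have "\<forall>i. \<exists>C>0. \<forall>s \<theta>. 0 \<le> s \<longrightarrow> 0 < \<theta> \<longrightarrow>
    (\<exists>A\<in>rat_shells. (\<forall>t. \<bar>\<bar>t\<bar> - s\<bar> \<le> 12 * \<theta> \<longrightarrow> t \<in> A) \<and> emeasure (power_measure (\<kappa> $ i)) A \<le> ennreal (C * (\<theta> * (s + \<theta>) powr (2 * \<kappa> $ i))))"
  proof
    fix i
    have "0 \<le> \<kappa> $ i" using k by simp
    from rat_shell_cover[OF this] show "\<exists>C>0. \<forall>s \<theta>. 0 \<le> s \<longrightarrow> 0 < \<theta> \<longrightarrow>
      (\<exists>A\<in>rat_shells. (\<forall>t. \<bar>\<bar>t\<bar> - s\<bar> \<le> 12 * \<theta> \<longrightarrow> t \<in> A) \<and> emeasure (power_measure (\<kappa> $ i)) A \<le> ennreal (C * (\<theta> * (s + \<theta>) powr (2 * \<kappa> $ i))))"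
      by metis
  qed
  from choice[OF this] obtain C2 where C2: "\<And>i. 0 < C2 i" "\<And>i s \<theta>. 0 \<le> s \<Longrightarrow> 0 < \<theta> \<Longrightarrow>
    (\<exists>A\<in>rat_shells. (\<forall>t. \<bar>\<bar>t\<bar> - s\<bar> \<le> 12 * \<theta> \<longrightarrow> t \<in> A) \<and> emeasure (power_measure (\<kappa> $ i)) A \<le> ennreal (C2 i * (\<theta> * (s + \<theta>) powr (2 * \<kappa> $ i))))"
    by blast
  define C3 where "C3 = (\<Prod>i\<in>UNIV. C2 i * 2 powr (2 * \<kappa> $ i))"
  have C3: "0 < C3" unfolding C3_def using C2(1) by (intro prod_pos) auto
  show thesis
  proof (rule that)
    show "0 < C1 * C3" using C1 C3 by simp
    fix f :: "real^'n \<Rightarrow> real" and x :: "real^'n" and \<theta>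
    assume f: "f \<in> borel_measurable sph_measure" and x: "1 < norm x" "norm x \<le> 2" and t: "0 < \<theta>" "\<theta> \<le> pi"
    define r where "r = norm x"
    define x' where "x' = proj x"
    have r: "1 < r" "r \<le> 2" "r * (1 + \<theta>) \<le> 10" using x t annulus_radius by (auto simp: r_def)
    have x0: "x \<noteq> 0" using x by auto
    then have nx: "norm x' = 1" unfolding x'_def by (rule norm_proj)
    have xi: "x $ i = r * x' $ i" for i using x0 by (simp add: x'_def proj_component r_def)
    have x1: "\<bar>x' $ i\<bar> \<le> 1" for i using component_le_norm_cart[of x' i] nx by simp
    define b where "b = decay \<kappa> x' \<theta>"
    have b: "0 \<le> b" unfolding b_def by (intro prod_nonneg) auto
    define P where "P = spread \<kappa> x' \<theta>"
    have P: "0 \<le> P" unfolding P_def by (intro prod_nonneg) auto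
    have "\<forall>i. \<exists>A. A \<in> rat_shells \<and> (\<forall>t. \<bar>\<bar>t\<bar> - \<bar>x $ i\<bar>\<bar> \<le> 12 * \<theta> \<longrightarrow> t \<in> A) \<and> emeasure (power_measure (\<kappa> $ i)) A \<le> ennreal (C2 i * (\<theta> * (\<bar>x $ i\<bar> + \<theta>) powr (2 * \<kappa> $ i)))"
      using C2(2)[OF abs_ge_zero t(1)] by blast
    from choice[OF this] obtain A where A: "\<And>i. A i \<in> rat_shells" "\<And>i t. \<bar>\<bar>t\<bar> - \<bar>x $ i\<bar>\<bar> \<le> 12 * \<theta> \<Longrightarrow> t \<in> A i"
      "\<And>i. emeasure (power_measure (\<kappa> $ i)) (A i) \<le> ennreal (C2 i * (\<theta> * (\<bar>x $ i\<bar> + \<theta>) powr (2 * \<kappa> $ i)))"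
      by blast
    define E where "E = {y :: real^'n. \<forall>i. \<bar>\<bar>x' $ i\<bar> - \<bar>y $ i\<bar>\<bar> \<le> \<theta>}"
    have E[measurable]: "E \<in> sets borel" unfolding E_def by measurable
    define G where "G y = ennreal \<bar>f y\<bar> * (ennreal ((hw \<kappa> y)\<^sup>2) * indicator E y)" for y
    have G: "G \<in> borel_measurable sph_measure"
    proof -
      have "(\<lambda>y. ennreal ((hw \<kappa> y)\<^sup>2) * indicator E y) \<in> borel_measurable borel" by measurable
      from borel_measurable_times_ennreal[OF _ borel_measurable_sph[OF this], of "\<lambda>y. ennreal \<bar>f y\<bar>"]
      show ?thesis unfolding G_def using f by measurable
    qed
    have "M_num \<kappa> f x' \<theta>
      \<le> (\<integral>\<^sup>+y. ennreal (C1 * b) * G y \<partial>sph_measure)"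
    proof (rule nn_integral_mono)
      fix y :: "real^'n" assume "y \<in> space sph_measure"
      then have y: "norm y = 1" by (simp add: space_sph)
      have "\<bar>f y\<bar> * V_kappa \<kappa> (indicator (Bset x' \<theta>)) y * (hw \<kappa> y)^2 \<le> \<bar>f y\<bar> * (C1 * b * indicator E y) * (hw \<kappa> y)^2"
      proof (intro mult_right_mono mult_left_mono)
        show "V_kappa \<kappa> (indicator (Bset x' \<theta>)) y \<le> C1 * b * indicator E y"
          using C1(2)[OF nx y t] by (cases "y \<in> E") (auto simp: b_def E_def split: if_splits)
      qed auto
      also have "\<dots> = (C1 * b) * (\<bar>f y\<bar> * ((hw \<kappa> y)\<^sup>2 * indicator E y))" by simp
      finally have "ennreal (\<bar>f y\<bar> * V_kappa \<kappa> (indicator (Bset x' \<theta>)) y * (hw \<kappa> y)^2) \<le> ennreal ((C1 * b) * (\<bar>f y\<bar> * ((hw \<kappa> y)\<^sup>2 * indicator E y)))"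
        by (rule ennreal_leI)
      also have "\<dots> = ennreal (C1 * b) * (ennreal \<bar>f y\<bar> * (ennreal ((hw \<kappa> y)\<^sup>2) * ennreal (indicator E y)))"
        using C1 b by (subst ennreal_mult, simp, simp, subst ennreal_mult, simp, simp, subst ennreal_mult) auto
      also have "\<dots> = ennreal (C1 * b) * G y" by (simp add: G_def ennreal_indicator)
      finally show "ennreal (\<bar>f y\<bar> * V_kappa \<kappa> (indicator (Bset x' \<theta>)) y * (hw \<kappa> y)^2) \<le> ennreal (C1 * b) * G y" .
    qed
    also have "\<dots> = ennreal (C1 * b) * (\<integral>\<^sup>+y. G y \<partial>sph_measure)" using G by (rule nn_integral_cmult)
    finally have 1: "M_num \<kappa> f x' \<theta>
      \<le> ennreal (C1 * b) * (\<integral>\<^sup>+y. G y \<partial>sph_measure)" .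
    \<comment> \<open>Thickening: the volume factor of the annulus is at least n \<theta>, and n
      cancels.\<close>
    have "ennreal (real CARD('n)) * (ennreal \<theta> * (\<integral>\<^sup>+y. G y \<partial>sph_measure)) = ennreal (real CARD('n) * \<theta>) * (\<integral>\<^sup>+y. G y \<partial>sph_measure)"
      using t by (simp add: ennreal_mult mult.assoc)
    also have "\<dots> \<le> ennreal ((r * (1 + \<theta>)) ^ CARD('n) - r ^ CARD('n)) * (\<integral>\<^sup>+y. G y \<partial>sph_measure)"
      using power_annulus_bounds(1)[of r \<theta> "CARD('n)"] r t by (intro mult_right_mono ennreal_leI) auto
    also have "\<dots> = ennreal (real CARD('n)) * (\<integral>\<^sup>+y. G (proj y) * indicator (annulus r (r * (1 + \<theta>))) y \<partial>lborel)"
      using r t by (intro nn_integral_annulus[symmetric] G) (auto simp: algebra_simps)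
    finally have "ennreal \<theta> * (\<integral>\<^sup>+y. G y \<partial>sph_measure) \<le> (\<integral>\<^sup>+y. G (proj y) * indicator (annulus r (r * (1 + \<theta>))) y \<partial>lborel)"
      by (subst (asm) ennreal_mult_le_mult_iff) auto
    also have "\<dots> \<le> (\<integral>\<^sup>+y. lift f y * (\<Prod>i\<in>UNIV. indicator (A i) (y $ i)) * ennreal ((hw \<kappa> y)\<^sup>2) \<partial>lborel)"
    proof (rule nn_integral_mono)
      fix y :: "real^'n"
      show "G (proj y) * indicator (annulus r (r * (1 + \<theta>))) y \<le> lift f y * (\<Prod>i\<in>UNIV. indicator (A i) (y $ i)) * ennreal ((hw \<kappa> y)\<^sup>2)"
      proof (cases "y \<in> annulus r (r * (1 + \<theta>)) \<and> proj y \<in> E")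
        case False
        then show ?thesis by (auto simp: G_def indicator_def)
      next
        case True
        then have y: "r < norm y" "norm y \<le> r * (1 + \<theta>)" and pE: "\<And>i. \<bar>\<bar>x' $ i\<bar> - \<bar>proj y $ i\<bar>\<bar> \<le> \<theta>"
          by (auto simp: annulus_def E_def)
        have y0: "y \<noteq> 0" using y r by auto
        have "y $ i \<in> A i" for i
        \<comment> \<open>Inwards the displacement is at most r \<theta> <= 2\<theta>, by r < norm
          y. Outwards it consists of norm y * \<theta> <= 10\<theta> and the radial gain r \<theta>
          |x'_i| <= 2\<theta>.\<close>
        proof (rule A(2))
          define u where "u = \<bar>proj y $ i\<bar>"
          have yu: "\<bar>y $ i\<bar> = norm y * u" using y0 by (simp add: u_def proj_component)
          have xu: "\<bar>x $ i\<bar> = r * \<bar>x' $ i\<bar>" using xi[of i] r by (simp add: abs_mult)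
          have u: "\<bar>x' $ i\<bar> \<le> u + \<theta>" "u \<le> \<bar>x' $ i\<bar> + \<theta>" "0 \<le> u" using pE[of i] by (auto simp: u_def)
          have "r * \<bar>x' $ i\<bar> \<le> r * (u + \<theta>)" using u r by (intro mult_left_mono) auto
          also have "\<dots> \<le> norm y * u + 2 * \<theta>" unfolding distrib_left using u y r t by (intro add_mono mult_right_mono) auto
          finally have a: "\<bar>x $ i\<bar> - \<bar>y $ i\<bar> \<le> 2 * \<theta>" unfolding yu xu by simp
          have "norm y * u \<le> norm y * (\<bar>x' $ i\<bar> + \<theta>)" using u by (intro mult_left_mono) auto
          also have "\<dots> = norm y * \<bar>x' $ i\<bar> + norm y * \<theta>" by (simp add: distrib_left)
          also have "\<dots> \<le> r * (1 + \<theta>) * \<bar>x' $ i\<bar> + 10 * \<theta>" using y r t by (intro add_mono mult_right_mono) auto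
          also have "\<dots> = r * \<bar>x' $ i\<bar> + r * (\<theta> * \<bar>x' $ i\<bar>) + 10 * \<theta>" by (simp add: algebra_simps)
          also have "\<dots> \<le> r * \<bar>x' $ i\<bar> + 2 * (\<theta> * 1) + 10 * \<theta>" using r t x1[of i] by (intro add_mono mult_mono) auto
          finally have "\<bar>y $ i\<bar> - \<bar>x $ i\<bar> \<le> 12 * \<theta>" unfolding yu xu by simp
          with a show "\<bar>\<bar>y $ i\<bar> - \<bar>x $ i\<bar>\<bar> \<le> 12 * \<theta>" using t by simp
        qed
        then have ind: "(\<Prod>i\<in>UNIV. indicator (A i) (y $ i)) = (1 :: ennreal)" by simp
        \<comment> \<open>The weight is homogeneous of nonnegative degree, so moving y inwards to
          the sphere does not increase it.\<close>
        have "(hw \<kappa> (proj y))\<^sup>2 \<le> 1 * (hw \<kappa> y)\<^sup>2"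
          unfolding hw_proj_sq[OF y0]
        proof (intro mult_right_mono)
          have "norm y powr (- 2 * (\<Sum>i\<in>UNIV. \<kappa> $ i)) \<le> norm y powr 0"
            using y r k sum_nonneg[of UNIV "\<lambda>i. \<kappa> $ i"] by (intro powr_mono) auto
          then show "norm y powr (- 2 * (\<Sum>i\<in>UNIV. \<kappa> $ i)) \<le> 1" using y0 by simp
        qed simp
        moreover have "lift f y = ennreal \<bar>f (proj y)\<bar>" using y r by (simp add: lift_def annulus_def)
        ultimately show ?thesis using True unfolding ind by (simp add: G_def mult_left_mono ennreal_leI)
      qed
    qed
    also have "\<dots> \<le> (\<Prod>i\<in>UNIV. emeasure (power_measure (\<kappa> $ i)) (A i)) * strong_max \<kappa> (lift f) x"
      using k t by (intro strong_max_box lift_measurable f A) auto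
    also have "\<dots> \<le> ennreal (C3 * (\<theta> ^ CARD('n) * P)) * strong_max \<kappa> (lift f) x"
    proof (rule mult_right_mono)
      have "(\<Prod>i\<in>UNIV. emeasure (power_measure (\<kappa> $ i)) (A i)) \<le> (\<Prod>i\<in>UNIV. ennreal (C2 i * 2 powr (2 * \<kappa> $ i) * (\<theta> * (\<bar>x' $ i\<bar> + \<theta>) powr (2 * \<kappa> $ i))))"
      proof (rule prod_mono_enn)
        fix i
        have "(\<bar>x $ i\<bar> + \<theta>) powr (2 * \<kappa> $ i) \<le> (2 * (\<bar>x' $ i\<bar> + \<theta>)) powr (2 * \<kappa> $ i)"
        proof (rule powr_mono2)
          have "r * \<bar>x' $ i\<bar> \<le> 2 * \<bar>x' $ i\<bar>" using r by (intro mult_right_mono) auto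
          then show "\<bar>x $ i\<bar> + \<theta> \<le> 2 * (\<bar>x' $ i\<bar> + \<theta>)" using xi[of i] r t by (simp add: abs_mult)
        qed (use k t in auto)
        also have "\<dots> = 2 powr (2 * \<kappa> $ i) * (\<bar>x' $ i\<bar> + \<theta>) powr (2 * \<kappa> $ i)" by (rule powr_mult)
        finally have "C2 i * (\<theta> * (\<bar>x $ i\<bar> + \<theta>) powr (2 * \<kappa> $ i)) \<le> C2 i * (\<theta> * (2 powr (2 * \<kappa> $ i) * (\<bar>x' $ i\<bar> + \<theta>) powr (2 * \<kappa> $ i)))"
          using C2(1)[of i] t by (intro mult_left_mono) auto
        also have "\<dots> = C2 i * 2 powr (2 * \<kappa> $ i) * (\<theta> * (\<bar>x' $ i\<bar> + \<theta>) powr (2 * \<kappa> $ i))" by simp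
        finally show "emeasure (power_measure (\<kappa> $ i)) (A i) \<le> ennreal (C2 i * 2 powr (2 * \<kappa> $ i) * (\<theta> * (\<bar>x' $ i\<bar> + \<theta>) powr (2 * \<kappa> $ i)))"
          using A(3)[of i] by (meson ennreal_leI order.trans)
      qed
      also have "\<dots> = ennreal (\<Prod>i\<in>UNIV. C2 i * 2 powr (2 * \<kappa> $ i) * (\<theta> * (\<bar>x' $ i\<bar> + \<theta>) powr (2 * \<kappa> $ i)))"
        using C2(1) t by (intro prod_ennreal) (auto simp: less_imp_le)
      also have "(\<Prod>i\<in>UNIV. C2 i * 2 powr (2 * \<kappa> $ i) * (\<theta> * (\<bar>x' $ i\<bar> + \<theta>) powr (2 * \<kappa> $ i))) = C3 * (\<theta> ^ CARD('n) * P)"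
        by (simp add: C3_def P_def prod.distrib)
      finally show "(\<Prod>i\<in>UNIV. emeasure (power_measure (\<kappa> $ i)) (A i)) \<le> ennreal (C3 * (\<theta> ^ CARD('n) * P))" .
    qed simp
    finally have 2: "ennreal \<theta> * (\<integral>\<^sup>+y. G y \<partial>sph_measure) \<le> ennreal (C3 * (\<theta> ^ CARD('n) * P)) * strong_max \<kappa> (lift f) x" .
    have "(\<integral>\<^sup>+y. G y \<partial>sph_measure) = ennreal (1/\<theta>) * (ennreal \<theta> * (\<integral>\<^sup>+y. G y \<partial>sph_measure))"
      using t by (simp add: mult.assoc[symmetric] ennreal_mult[symmetric])
    also have "\<dots> \<le> ennreal (1/\<theta>) * (ennreal (C3 * (\<theta> ^ CARD('n) * P)) * strong_max \<kappa> (lift f) x)"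
      by (intro mult_left_mono 2) auto
    also have "\<dots> = ennreal (1/\<theta> * (C3 * (\<theta> ^ CARD('n) * P))) * strong_max \<kappa> (lift f) x"
      using t by (simp add: mult.assoc[symmetric] ennreal_mult'[symmetric])
    also have "1/\<theta> * (C3 * (\<theta> ^ CARD('n) * P)) = C3 * (\<theta> ^ (CARD('n) - 1) * P)"
    proof -
      have "\<theta> ^ CARD('n) = \<theta> * \<theta> ^ (CARD('n) - 1)" by (simp flip: power_Suc)
      then show ?thesis using t by simp
    qed
    finally have 3: "(\<integral>\<^sup>+y. G y \<partial>sph_measure) \<le> ennreal (C3 * (\<theta> ^ (CARD('n) - 1) * P)) * strong_max \<kappa> (lift f) x" .
    have "ennreal (C1 * b) * (\<integral>\<^sup>+y. G y \<partial>sph_measure) \<le> ennreal (C1 * b) * (ennreal (C3 * (\<theta> ^ (CARD('n) - 1) * P)) * strong_max \<kappa> (lift f) x)"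
      by (intro mult_left_mono 3) auto
    also have "\<dots> = ennreal (C1 * C3 * b * (\<theta> ^ (CARD('n) - 1) * P)) * strong_max \<kappa> (lift f) x"
      using C1 C3 b P t by (simp add: mult.assoc[symmetric] ennreal_mult'[symmetric]) (simp add: mult_ac)
    finally show "M_num \<kappa> f (proj x) \<theta>
      \<le> ennreal (C1 * C3 * decay \<kappa> (proj x) \<theta> * (\<theta> ^ (CARD('n) - 1) * spread \<kappa> (proj x) \<theta>))
        * strong_max \<kappa> (lift f) x"
      using 1 unfolding b_def P_def x'_def by (rule order.trans[rotated])
  qed
qed

text \<open>A cube of side d \<theta> near x, in a closed orthant containing x but pushed away from
  all coordinate hyperplanes, projects into the set where the lower bound for \<open>V_kappa\<close>
  holds. On it |y_i| >= |x_i| + d \<theta>, so the weight is at least a multiple of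
  \<open>spread\<close>, even where x lies on a hyperplane.\<close>

lemma M_kappa_denominator:
  fixes \<kappa> :: "real^'n"
  assumes k: "\<forall>i. 0 \<le> \<kappa> $ i"
  obtains c where "0 < c" "\<And>x \<theta>. 1 < norm x \<Longrightarrow> norm x \<le> 2 \<Longrightarrow> 0 < \<theta> \<Longrightarrow> \<theta> \<le> pi \<Longrightarrow>
    ennreal (c * decay \<kappa> (proj x) \<theta> * (\<theta> ^ (CARD('n) - 1) * spread \<kappa> (proj x) \<theta>))
    \<le> M_den \<kappa> (proj x) \<theta>"
proof -
  let ?n = "CARD('n)"
  obtain c1 where c1: "0 < c1" "\<And>x y \<theta>. norm x = 1 \<Longrightarrow> norm y = 1 \<Longrightarrow> 0 < \<theta> \<Longrightarrow> \<theta> \<le> pi \<Longrightarrow>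
    (\<And>i. 0 \<le> x $ i * y $ i) \<Longrightarrow> (\<And>i. \<bar>y $ i\<bar> \<le> \<bar>x $ i\<bar> + \<theta>) \<Longrightarrow> 1 - \<theta>\<^sup>2 / 36 \<le> x \<bullet> y \<Longrightarrow>
    c1 * decay \<kappa> x \<theta> \<le> V_kappa \<kappa> (indicator (Bset x \<theta>)) y"
    using V_kappa_lower[OF k] by blast
  define s where "s = (\<Sum>i\<in>UNIV. \<kappa> $ i)"
  have s: "0 \<le> s" unfolding s_def using k by (intro sum_nonneg) auto
  \<comment> \<open>Makes the l1 distance from x to any point of the cube at most n * 2 d \<theta> =
    \<theta>/10.\<close>
  define d where "d = 1 / (20 * real ?n)"
  have n1: "1 \<le> real ?n" by (simp add: Suc_le_eq)
  have d: "0 < d" "d \<le> 1" "real ?n * (2 * d) = 1/10"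
    unfolding d_def using n1 by (simp, subst divide_le_eq_1_pos) (linarith, linarith, simp)
  define c2 where "c2 = c1 * (10 powr (- 2 * s) * (d powr (2 * s)) * d ^ ?n)"
  have c2: "0 < c2" using c1 d by (simp add: c2_def)
  show thesis
  proof (rule that)
    show "0 < c2 / 10 ^ ?n" using c2 by simp
    fix x :: "real^'n" and \<theta>
    assume x: "1 < norm x" "norm x \<le> 2" and t: "0 < \<theta>" "\<theta> \<le> pi"
    define r where "r = norm x"
    define x' where "x' = proj x"
    have r: "1 < r" "r \<le> 2" "r * (1 + \<theta>) \<le> 10" using x t annulus_radius by (auto simp: r_def)
    have x0: "x \<noteq> 0" using x by auto
    then have nx: "norm x' = 1" unfolding x'_def by (rule norm_proj)
    have xi: "x $ i = r * x' $ i" for i using x0 by (simp add: x'_def proj_component r_def)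
    define b where "b = decay \<kappa> x' \<theta>"
    have b: "0 \<le> b" unfolding b_def by (intro prod_nonneg) auto
    define P where "P = spread \<kappa> x' \<theta>"
    have P: "0 \<le> P" unfolding P_def by (intro prod_nonneg) auto
    define E where "E = {y :: real^'n. (\<forall>i. 0 \<le> x' $ i * y $ i) \<and> (\<forall>i. \<bar>y $ i\<bar> \<le> \<bar>x' $ i\<bar> + \<theta>) \<and> 1 - \<theta>\<^sup>2 / 36 \<le> x' \<bullet> y}"
    have E[measurable]: "E \<in> sets borel" unfolding E_def by measurable
    define G where "G y = ennreal ((hw \<kappa> y)\<^sup>2) * indicator E y" for y
    have G: "G \<in> borel_measurable sph_measure"
      unfolding G_def by (rule borel_measurable_sph) measurable
    define l u where "l = (\<chi> i. if 0 \<le> x $ i then x $ i + d * \<theta> else x $ i - 2 * d * \<theta>)"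
      and "u = (\<chi> i. if 0 \<le> x $ i then x $ i + 2 * d * \<theta> else x $ i - d * \<theta>)"
    have Q: "y \<in> annulus r (r * (1 + \<theta>))" "proj y \<in> E" "d powr (2 * s) * P \<le> (hw \<kappa> y)\<^sup>2" if "y \<in> cbox l u" for y
    proof -
      have dt: "0 < d * \<theta>" using d t by simp
      have yi: "(if 0 \<le> x $ i then x $ i + d * \<theta> \<le> y $ i \<and> y $ i \<le> x $ i + 2 * d * \<theta>
          else x $ i - 2 * d * \<theta> \<le> y $ i \<and> y $ i \<le> x $ i - d * \<theta>)" for i
        using that unfolding mem_box_cart l_def u_def by (auto dest: spec[of _ i])
      have y1: "\<bar>x $ i\<bar> + d * \<theta> \<le> \<bar>y $ i\<bar>" and y2: "\<bar>y $ i - x $ i\<bar> \<le> 2 * d * \<theta>" and y3: "0 \<le> x $ i * y $ i" for i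
        using yi[of i] dt by (auto split: if_splits intro: mult_nonneg_nonneg mult_nonpos_nonpos)
      have "norm (y - x) \<le> (\<Sum>i\<in>UNIV. \<bar>(y - x) $ i\<bar>)" by (rule norm_le_l1_cart)
      also have "\<dots> \<le> (\<Sum>i\<in>(UNIV :: 'n set). 2 * d * \<theta>)" using y2 by (intro sum_mono) auto
      also have "\<dots> = (real ?n * (2 * d)) * \<theta>" by simp
      finally have yx: "norm (y - x) \<le> \<theta> / 10" unfolding d(3) by simp
      \<comment> \<open>Every coordinate grows in absolute value, so y lies strictly outside the
        sphere of radius r, as membership in the annulus demands.\<close>
      have "(\<Sum>i\<in>UNIV. (x $ i)\<^sup>2) < (\<Sum>i\<in>UNIV. (y $ i)\<^sup>2)"
      proof (rule sum_strict_mono)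
        fix i
        have "\<bar>x $ i\<bar> < \<bar>y $ i\<bar>" using y1[of i] dt by linarith
        then have "\<bar>x $ i\<bar>\<^sup>2 < \<bar>y $ i\<bar>\<^sup>2" by (intro power_strict_mono) auto
        then show "(x $ i)\<^sup>2 < (y $ i)\<^sup>2" by simp
      qed auto
      then have ry: "r < norm y" unfolding r_def norm_vec_def L2_set_def by (simp add: real_sqrt_less_mono)
      have "norm y \<le> r + norm (y - x)" unfolding r_def using norm_triangle_ineq[of x "y - x"] by simp
      also have "\<dots> \<le> r + r * \<theta>" 
      proof -
        have "\<theta> / 10 \<le> 1 * \<theta>" using t by simp
        also have "\<dots> \<le> r * \<theta>" using r t by (intro mult_right_mono) auto
        finally show ?thesis using yx by simp
      qed
      finally show "y \<in> annulus r (r * (1 + \<theta>))" using ry by (simp add: annulus_def distrib_left)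
      have y0: "y \<noteq> 0" using ry r by auto
      have ny: "norm (proj y) = 1" using y0 by (rule norm_proj)
      \<comment> \<open>Scaling y - x by 1/r and renormalising y each cost at most norm(y - x),
        because r > 1; twice \<theta>/10 is \<theta>/5.\<close>
      have pd: "norm (proj y - x') \<le> \<theta> / 5"
      proof -
        have "proj y - x' = (y - x) /\<^sub>R r + (1 / norm y - 1 / r) *\<^sub>R y"
          by (simp add: proj_def x'_def r_def algebra_simps divide_inverse)
        then have "norm (proj y - x') \<le> norm ((y - x) /\<^sub>R r) + norm ((1 / norm y - 1 / r) *\<^sub>R y)"
          by (metis norm_triangle_ineq)
        also have "norm ((1 / norm y - 1 / r) *\<^sub>R y) = \<bar>r - norm y\<bar> / r"
        proof -
          have "(1 / norm y - 1 / r) * norm y = (r - norm y) / r" using y0 r by (simp add: field_simps)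
          then have "\<bar>1 / norm y - 1 / r\<bar> * norm y = \<bar>(r - norm y) / r\<bar>" by (metis abs_mult abs_norm_cancel)
          then show ?thesis using r by simp
        qed
        also have "\<bar>r - norm y\<bar> \<le> norm (y - x)" unfolding r_def by (metis norm_minus_commute norm_triangle_ineq3)
        then have "norm ((y - x) /\<^sub>R r) + \<bar>r - norm y\<bar> / r \<le> norm (y - x) / r + norm (y - x) / r"
          using r by (intro add_mono divide_right_mono) (auto simp: divide_inverse mult.commute)
        also have "\<dots> = 2 * norm (y - x) / r" by simp
        also have "\<dots> \<le> 2 * norm (y - x) / 1" using r by (intro divide_left_mono) auto
        finally show ?thesis using yx by simp
      qed
      have "(norm (proj y - x'))\<^sup>2 = 2 - 2 * (x' \<bullet> proj y)"
        using nx ny by (simp add: power2_norm_eq_inner inner_diff_left inner_diff_right inner_commute norm_eq_1)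
      then have ip: "x' \<bullet> proj y = 1 - (norm (proj y - x'))\<^sup>2 / 2" by argo
      have "(norm (proj y - x'))\<^sup>2 \<le> (\<theta>/5)\<^sup>2" using pd by (intro power_mono) auto
      then have "(norm (proj y - x'))\<^sup>2 \<le> \<theta>\<^sup>2 / 25" by (simp add: power_divide)
      \<comment> \<open>For unit vectors the deficit of the inner product is half the squared
        distance, here at most \<theta>^2/50, within the allowance \<theta>^2/36.\<close>
      then have e3: "1 - \<theta>\<^sup>2 / 36 \<le> x' \<bullet> proj y"
        unfolding ip using zero_le_power2[of "\<theta>"] by argo
      have e2: "\<bar>proj y $ i\<bar> \<le> \<bar>x' $ i\<bar> + \<theta>" for i
        using component_le_norm_cart[of "proj y - x'" i] pd t by simp
      have e1: "0 \<le> x' $ i * proj y $ i" for i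
        using y3[of i] by (simp add: x'_def proj_component zero_le_divide_iff) 
      show "proj y \<in> E" unfolding E_def using e1 e2 e3 by blast
      have "d powr (2 * s) * P = (\<Prod>i\<in>UNIV. (d * (\<bar>x' $ i\<bar> + \<theta>)) powr (2 * \<kappa> $ i))"
        using d t by (simp add: P_def s_def powr_mult prod.distrib powr_sum sum_distrib_left)
      also have "\<dots> \<le> (\<Prod>i\<in>UNIV. \<bar>y $ i\<bar> powr (2 * \<kappa> $ i))"
      proof (intro prod_mono conjI powr_mono2)
        fix i
        have "d * \<bar>x' $ i\<bar> \<le> 1 * \<bar>x' $ i\<bar>" using d by (intro mult_right_mono) auto
        also have "\<dots> \<le> r * \<bar>x' $ i\<bar>" using r by (intro mult_right_mono) auto
        also have "\<dots> = \<bar>x $ i\<bar>" using xi[of i] r by (simp add: abs_mult)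
        finally show "d * (\<bar>x' $ i\<bar> + \<theta>) \<le> \<bar>y $ i\<bar>" using y1[of i] by (simp add: distrib_left)
      qed (use k d t in auto)
      also have "\<dots> = (hw \<kappa> y)\<^sup>2"
        unfolding hw_def prod_power_distrib by (intro prod.cong refl) (simp add: power2_eq_square flip: powr_add)
      finally show "d powr (2 * s) * P \<le> (hw \<kappa> y)\<^sup>2" .
    qed
    have vol: "emeasure lborel (cbox l u) = ennreal ((d * \<theta>) ^ ?n)"
    proof -
      have le: "l $ i \<le> u $ i" and diff: "(u - l) $ i = d * \<theta>" for i using d t by (auto simp: l_def u_def)
      have "emeasure lborel (cbox l u) = (\<Prod>b\<in>Basis. (u - l) \<bullet> b)"
        using le by (intro emeasure_lborel_cbox) (auto simp: Basis_vec_def inner_axis)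
      also have "(\<Prod>b\<in>Basis. (u - l) \<bullet> b) = (\<Prod>i\<in>(UNIV::'n set). d * \<theta>)"
        using prod_Basis_vec[of "\<lambda>z. z" "u - l"] diff by simp
      finally show ?thesis by simp
    qed
    have "ennreal (10 powr (-2 * s) * (d powr (2 * s) * P) * (d * \<theta>) ^ ?n) = (\<integral>\<^sup>+y. ennreal (10 powr (-2 * s) * (d powr (2 * s) * P)) * indicator (cbox l u) y \<partial>lborel)"
      using P d t by (simp add: nn_integral_cmult_indicator vol ennreal_mult)
    also have "\<dots> \<le> (\<integral>\<^sup>+y. G (proj y) * indicator (annulus r (r * (1 + \<theta>))) y \<partial>lborel)"
    proof (rule nn_integral_mono)
      fix y :: "real^'n"
      show "ennreal (10 powr (-2 * s) * (d powr (2 * s) * P)) * indicator (cbox l u) y \<le> G (proj y) * indicator (annulus r (r * (1 + \<theta>))) y"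
      proof (cases "y \<in> cbox l u")
        case True
        note q = Q[OF True]
        have y: "1 < norm y" "norm y \<le> 10" using q(1) r by (auto simp: annulus_def)
        then have y0: "y \<noteq> 0" by auto
        \<comment> \<open>Projecting to the sphere divides the squared weight by norm y to the power
          2s, and norm y <= 10.\<close>
        have "10 powr (-2 * s) \<le> norm y powr (-2 * s)" using y s by (intro powr_mono2') auto
        then have "10 powr (-2 * s) * (d powr (2 * s) * P) \<le> norm y powr (-2 * s) * (hw \<kappa> y)\<^sup>2"
          using q(3) P by (intro mult_mono) auto
        also have "\<dots> = (hw \<kappa> (proj y))\<^sup>2" unfolding hw_proj_sq[OF y0] s_def ..
        finally show ?thesis using True q(1,2) by (simp add: G_def ennreal_leI)
      qed simp
    qed
    finally have 1: "ennreal (10 powr (-2 * s) * (d powr (2 * s) * P) * (d * \<theta>) ^ ?n) \<le> (\<integral>\<^sup>+y. G (proj y) * indicator (annulus r (r * (1 + \<theta>))) y \<partial>lborel)" .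
    have "ennreal (real ?n) * (\<integral>\<^sup>+y. G (proj y) * indicator (annulus r (r * (1 + \<theta>))) y \<partial>lborel)
      = ennreal ((r * (1 + \<theta>)) ^ ?n - r ^ ?n) * (\<integral>\<^sup>+y. G y \<partial>sph_measure)"
      using r t by (intro nn_integral_annulus G) (auto simp: algebra_simps)
    also have "\<dots> \<le> ennreal (real ?n * \<theta> * 10 ^ ?n) * (\<integral>\<^sup>+y. G y \<partial>sph_measure)"
      using power_annulus_bounds(2)[of r \<theta> ?n] r t by (intro mult_right_mono ennreal_leI) auto
    also have "\<dots> = ennreal (real ?n) * (ennreal (\<theta> * 10 ^ ?n) * (\<integral>\<^sup>+y. G y \<partial>sph_measure))"
      using t by (simp add: mult.assoc[symmetric] ennreal_mult'[symmetric])
    finally have 2: "(\<integral>\<^sup>+y. G (proj y) * indicator (annulus r (r * (1 + \<theta>))) y \<partial>lborel) \<le> ennreal (\<theta> * 10 ^ ?n) * (\<integral>\<^sup>+y. G y \<partial>sph_measure)"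
      by (subst (asm) ennreal_mult_le_mult_iff) auto
    have "ennreal (c2 / 10 ^ ?n * b * (\<theta> ^ (?n - 1) * P)) = ennreal (c1 * b) * (ennreal (1 / (\<theta> * 10 ^ ?n)) * ennreal (10 powr (-2 * s) * (d powr (2 * s) * P) * (d * \<theta>) ^ ?n))"
    proof -
      have tn: "\<theta> ^ ?n = \<theta> * \<theta> ^ (?n - 1)" by (simp flip: power_Suc)
      have "c2 / 10 ^ ?n * b * (\<theta> ^ (?n - 1) * P) = (c1 * b) * (1 / (\<theta> * 10 ^ ?n) * (10 powr (-2 * s) * (d powr (2 * s) * P) * (d * \<theta>) ^ ?n))"
        unfolding power_mult_distrib tn c2_def using t by (simp add: field_simps)
      then show ?thesis using c1 b P t d by (simp add: ennreal_mult'[symmetric])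
    qed
    also have "\<dots> \<le> ennreal (c1 * b) * (ennreal (1 / (\<theta> * 10 ^ ?n)) * (ennreal (\<theta> * 10 ^ ?n) * (\<integral>\<^sup>+y. G y \<partial>sph_measure)))"
      by (intro mult_left_mono order.trans[OF 1 2]) auto
    also have "\<dots> = ennreal (c1 * b) * (\<integral>\<^sup>+y. G y \<partial>sph_measure)"
      using t by (simp add: mult.assoc[symmetric] ennreal_mult'[symmetric])
    also have "\<dots> = (\<integral>\<^sup>+y. ennreal (c1 * b) * G y \<partial>sph_measure)" using G by (rule nn_integral_cmult[symmetric])
    also have "\<dots> \<le> M_den \<kappa> x' \<theta>"
    proof (rule nn_integral_mono)
      fix y :: "real^'n" assume "y \<in> space sph_measure"
      then have y: "norm y = 1" by (simp add: space_sph)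
      show "ennreal (c1 * b) * G y \<le> ennreal (V_kappa \<kappa> (indicator (Bset x' \<theta>)) y * (hw \<kappa> y)^2)"
      proof (cases "y \<in> E")
        case True
        have "c1 * b \<le> V_kappa \<kappa> (indicator (Bset x' \<theta>)) y"
          unfolding b_def using True by (intro c1(2) nx y t) (auto simp: E_def)
        then have "c1 * b * (hw \<kappa> y)\<^sup>2 \<le> V_kappa \<kappa> (indicator (Bset x' \<theta>)) y * (hw \<kappa> y)^2" by (rule mult_right_mono) simp
        then show ?thesis using True c1 b by (simp add: G_def ennreal_mult'[symmetric] ennreal_leI)
      qed (simp add: G_def)
    qed
    finally show "ennreal (c2 / 10 ^ ?n * decay \<kappa> (proj x) \<theta> * (\<theta> ^ (CARD('n) - 1) * spread \<kappa> (proj x) \<theta>))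
      \<le> M_den \<kappa> (proj x) \<theta>"
      unfolding b_def P_def x'_def .
  qed
qed

text \<open>Numerator and denominator are bounded by the same expression in \<theta> and x, so it
  cancels and the constant C / c is uniform in \<theta>.\<close>

lemma M_kappa_le_strong_max:
  fixes \<kappa> :: "real^'n"
  assumes k: "\<forall>i. 0 \<le> \<kappa> $ i"
  obtains C where "0 < C" "\<And>f x. f \<in> borel_measurable sph_measure \<Longrightarrow> 1 < norm x \<Longrightarrow> norm x \<le> 2 \<Longrightarrow>
    M_kappa \<kappa> f (proj x) \<le> ennreal C * strong_max \<kappa> (lift f) x"
proof -
  obtain C where C: "0 < C" "\<And>f x \<theta>. f \<in> borel_measurable sph_measure \<Longrightarrow> 1 < norm x \<Longrightarrow> norm x \<le> 2 \<Longrightarrow> 0 < \<theta> \<Longrightarrow> \<theta> \<le> pi \<Longrightarrow>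
    M_num \<kappa> f (proj x) \<theta>
    \<le> ennreal (C * decay \<kappa> (proj x) \<theta> * (\<theta> ^ (CARD('n) - 1) * spread \<kappa> (proj x) \<theta>))
      * strong_max \<kappa> (lift f) x"
    using M_kappa_numerator[OF k] by blast
  obtain c where c: "0 < c" "\<And>x \<theta>. 1 < norm x \<Longrightarrow> norm x \<le> 2 \<Longrightarrow> 0 < \<theta> \<Longrightarrow> \<theta> \<le> pi \<Longrightarrow>
    ennreal (c * decay \<kappa> (proj x) \<theta> * (\<theta> ^ (CARD('n) - 1) * spread \<kappa> (proj x) \<theta>))
    \<le> M_den \<kappa> (proj x) \<theta>"
    using M_kappa_denominator[OF k] by blast
  show thesis
  proof (rule that)
    show "0 < C / c" using C c by simp
    fix f :: "real^'n \<Rightarrow> real" and x :: "real^'n"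
    assume f: "f \<in> borel_measurable sph_measure" and x: "1 < norm x" "norm x \<le> 2"
    show "M_kappa \<kappa> f (proj x) \<le> ennreal (C / c) * strong_max \<kappa> (lift f) x"
      unfolding M_kappa_def
    proof (rule SUP_least)
      fix \<theta> :: real assume "\<theta> \<in> {0<..pi}"
      then have t: "0 < \<theta>" "\<theta> \<le> pi" by auto
      define b P where "b = decay \<kappa> (proj x) \<theta>"
        and "P = \<theta> ^ (CARD('n) - 1) * spread \<kappa> (proj x) \<theta>"
      have pos: "0 < \<bar>proj x $ i\<bar> + \<theta>" for i using t by (intro add_nonneg_pos) auto
      have b: "0 < b" unfolding b_def using t pos by (intro prod_pos) (simp add: less_imp_neq[symmetric])
      have P: "0 < P" unfolding P_def using t pos by (intro mult_pos_pos prod_pos) (auto simp: less_imp_neq[symmetric])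
      define N D where "N = M_num \<kappa> f (proj x) \<theta>"
        and "D = M_den \<kappa> (proj x) \<theta>"
      have N: "N \<le> ennreal (C * b * P) * strong_max \<kappa> (lift f) x" unfolding N_def b_def P_def by (intro C(2) f x t)
      have D: "ennreal (c * b * P) \<le> D" unfolding D_def b_def P_def by (intro c(2) x t)
      have "ennreal (C * b * P) = ennreal (C / c) * ennreal (c * b * P)"
        using C c b P by (subst ennreal_mult[symmetric]) auto
      then have "N \<le> ennreal (C / c) * ennreal (c * b * P) * strong_max \<kappa> (lift f) x" using N by simp
      also have "\<dots> = (ennreal (C / c) * strong_max \<kappa> (lift f) x) * ennreal (c * b * P)" by (simp only: mult_ac)
      also have "\<dots> \<le> (ennreal (C / c) * strong_max \<kappa> (lift f) x) * D" using D by (rule mult_left_mono) simp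
      finally have "N / D \<le> (ennreal (C / c) * strong_max \<kappa> (lift f) x) * D / D" by (rule divide_right_mono_ennreal)
      also have "\<dots> = (ennreal (C / c) * strong_max \<kappa> (lift f) x) * (D / D)" by (simp add: ennreal_times_divide)
      \<comment> \<open>If D were top, the quotient D / D would be 0 rather than 1; the inequality
        covers this as well.\<close>
      also have "\<dots> \<le> (ennreal (C / c) * strong_max \<kappa> (lift f) x) * 1" by (intro mult_left_mono ennreal_divide_self_le_1) auto
      finally show "M_num \<kappa> f (proj x) \<theta>
        / M_den \<kappa> (proj x) \<theta>
        \<le> ennreal (C / c) * strong_max \<kappa> (lift f) x" by (simp add: N_def D_def)
    qed
  qed
qed

text \<open>The left side is spread over the annulus 1 < |x| <= 2, where the pointwise bound holds.
  The maximal theorem is applied on the whole space to the lifts, and their support 1 < |x| <= 10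
  brings the right side back to the sphere. Homogeneity makes the weights at x and
  \<open>proj x\<close> comparable on these annuli.\<close>

theorem theorem3p8:
  fixes \<kappa> \<tau> :: "real^'n" and p :: real
  assumes "CARD('n) \<ge> 2" and "1 < p"
    and "\<forall>i. 0 \<le> \<kappa> $ i"
    and "\<forall>i. -1/2 < \<tau> $ i \<and> \<tau> $ i < p * \<kappa> $ i + (p - 1) / 2"
  shows "\<exists>c::real. \<forall>f :: nat \<Rightarrow> real^'n \<Rightarrow> real.
           (\<forall>j. f j \<in> borel_measurable sph_measure) \<longrightarrow>
           wnorm \<tau> p (\<lambda>x. enn_powr (\<Sum>j. (M_kappa \<kappa> (f j) x)^2) (1/2))
             \<le> ennreal c * wnorm \<tau> p (\<lambda>x. enn_powr (\<Sum>j. ennreal ((f j x)^2)) (1/2))"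
proof -
  let ?n = "CARD('n)"
  note p = \<open>1 < p\<close>
  obtain C1 where C1: "0 < C1" "\<And>f x. f \<in> borel_measurable sph_measure \<Longrightarrow> 1 < norm x \<Longrightarrow> norm x \<le> 2 \<Longrightarrow>
    M_kappa \<kappa> f (proj x) \<le> ennreal C1 * strong_max \<kappa> (lift f) x"
    using M_kappa_le_strong_max[OF assms(3)] by blast
  obtain C2 where C2: "0 < C2" "\<And>F :: nat \<Rightarrow> real^'n \<Rightarrow> ennreal. (\<And>j. F j \<in> borel_measurable borel) \<Longrightarrow>
      sq_integral lborel p (\<lambda>x. ennreal ((hw \<tau> x)\<^sup>2)) (\<lambda>j. strong_max \<kappa> (F j))
        \<le> ennreal C2 * sq_integral lborel p (\<lambda>x. ennreal ((hw \<tau> x)\<^sup>2)) F"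
    using strong_max_vector_valued[OF p, of \<kappa> \<tau>] assms(3,4) by blast
  \<comment> \<open>The degree of the weight h_\<tau>^2 may be negative; its absolute value bounds
    the ratio of the weights at x and \<open>proj x\<close> in both directions for norms between 1
    and 10.\<close>
  define s where "s = \<bar>2 * (\<Sum>i\<in>UNIV. \<tau> $ i)\<bar>"
  define K where "K = (10::real) powr s"
  have K: "0 < K" by (simp add: K_def)
  have Ks: "norm y powr (- 2 * (\<Sum>i\<in>UNIV. \<tau> $ i)) \<le> K" "norm y powr (2 * (\<Sum>i\<in>UNIV. \<tau> $ i)) \<le> K"
    if "1 < norm y" "norm y \<le> 10" for y :: "real^'n"
  proof -
    have "norm y powr a \<le> K" if "a \<le> s" for a
    proof -
      have "norm y powr a \<le> norm y powr s" using that \<open>1 < norm y\<close> by (intro powr_mono) auto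
      also have "\<dots> \<le> 10 powr s" using \<open>norm y \<le> 10\<close> by (intro powr_mono2) (auto simp: s_def)
      finally show ?thesis by (simp add: K_def)
    qed
    then show "norm y powr (- 2 * (\<Sum>i\<in>UNIV. \<tau> $ i)) \<le> K" "norm y powr (2 * (\<Sum>i\<in>UNIV. \<tau> $ i)) \<le> K" by (auto simp: s_def)
  qed
  define c where "c = real ?n * (K * C1 powr p * (C2 * (K * (10 ^ ?n - 1) / real ?n)))"
  have c: "0 \<le> c" using K C1 C2 by (simp add: c_def)
  have main: "(\<integral>\<^sup>+x. enn_powr (\<Sum>j. (M_kappa \<kappa> (f j) x)^2) (p/2) * ennreal ((hw \<tau> x)^2) \<partial>sph_measure)
      \<le> ennreal c * (\<integral>\<^sup>+x. enn_powr (\<Sum>j. ennreal ((f j x)^2)) (p/2) * ennreal ((hw \<tau> x)^2) \<partial>sph_measure)"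
    if f: "\<And>j. f j \<in> borel_measurable sph_measure" for f :: "nat \<Rightarrow> real^'n \<Rightarrow> real"
  proof (rule nn_integral_le_of_measurable_le)
    fix g :: "real^'n \<Rightarrow> ennreal" assume g: "g \<in> borel_measurable sph_measure"
      and gle: "\<And>x. g x \<le> enn_powr (\<Sum>j. (M_kappa \<kappa> (f j) x)^2) (p/2) * ennreal ((hw \<tau> x)^2)"
    define F where "F j = lift (f j)" for j
    have F[measurable]: "F j \<in> borel_measurable borel" for j unfolding F_def by (intro lift_measurable f)
    have [measurable]: "strong_max \<kappa> (F j) \<in> borel_measurable borel" for j by (intro strong_max_measurable F)
    define H where "H y = enn_powr (\<Sum>j. ennreal ((f j y)^2)) (p/2) * ennreal ((hw \<tau> y)^2)" for y
    have H: "H \<in> borel_measurable sph_measure"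
    proof -
      note f[measurable]
      have [measurable]: "hw \<tau> \<in> borel_measurable sph_measure" by (intro borel_measurable_sph hw_borel)
      show ?thesis unfolding H_def by measurable
    qed
    have "(\<integral>\<^sup>+x. g x \<partial>sph_measure) \<le> ennreal (2 ^ ?n - 1 ^ ?n) * (\<integral>\<^sup>+x. g x \<partial>sph_measure)"
    proof -
      \<comment> \<open>Since 2^n - 1 >= 1, spreading over the annulus from 1 to 2 costs no
        constant.\<close>
      have "(2::real) ^ 1 \<le> 2 ^ ?n" by (intro power_increasing) (auto simp: Suc_le_eq)
      then have "1 \<le> ennreal (2 ^ ?n - 1 ^ ?n)" by (simp flip: ennreal_1 add: ennreal_leI)
      then show ?thesis using mult_right_mono[of 1 "ennreal (2 ^ ?n - 1 ^ ?n)" "\<integral>\<^sup>+x. g x \<partial>sph_measure"] by simp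
    qed
    also have "\<dots> = ennreal (real ?n) * (\<integral>\<^sup>+x. g (proj x) * indicator (annulus 1 2) x \<partial>lborel)"
      by (intro nn_integral_annulus[symmetric] g) auto
    also have "\<dots> \<le> ennreal (real ?n) * (\<integral>\<^sup>+x. ennreal (K * C1 powr p) * (sq_fun p (\<lambda>j. strong_max \<kappa> (F j)) x * ennreal ((hw \<tau> x)\<^sup>2)) \<partial>lborel)"
    proof (intro mult_left_mono nn_integral_mono)
      fix x :: "real^'n"
      show "g (proj x) * indicator (annulus 1 2) x \<le> ennreal (K * C1 powr p) * (sq_fun p (\<lambda>j. strong_max \<kappa> (F j)) x * ennreal ((hw \<tau> x)\<^sup>2))"
      proof (cases "x \<in> annulus 1 2")
        case True
        then have x: "1 < norm x" "norm x \<le> 2" by (auto simp: annulus_def)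
        then have x0: "x \<noteq> 0" by auto
        have "(\<Sum>j. (M_kappa \<kappa> (f j) (proj x))^2) \<le> (\<Sum>j. (ennreal C1)\<^sup>2 * (strong_max \<kappa> (F j) x)\<^sup>2)"
          using C1(2)[OF f x] by (intro suminf_le) (auto simp: F_def intro: power_mono simp flip: power_mult_distrib)
        also have "\<dots> = (ennreal C1)\<^sup>2 * (\<Sum>j. (strong_max \<kappa> (F j) x)\<^sup>2)" by simp
        finally have "enn_powr (\<Sum>j. (M_kappa \<kappa> (f j) (proj x))^2) (p/2) \<le> enn_powr ((ennreal C1)\<^sup>2 * (\<Sum>j. (strong_max \<kappa> (F j) x)\<^sup>2)) (p/2)"
          using p by (intro enn_powr_mono) auto
        also have "\<dots> = enn_powr (enn_powr (ennreal C1) 2) (p/2) * sq_fun p (\<lambda>j. strong_max \<kappa> (F j)) x"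
          using p by (simp add: enn_powr_mult enn_powr_2)
        also have "enn_powr (enn_powr (ennreal C1) 2) (p/2) = ennreal (C1 powr p)"
          using p C1(1) by (simp only: enn_powr_powr) simp
        finally have a: "enn_powr (\<Sum>j. (M_kappa \<kappa> (f j) (proj x))^2) (p/2) \<le> ennreal (C1 powr p) * sq_fun p (\<lambda>j. strong_max \<kappa> (F j)) x" .
        have "(hw \<tau> (proj x))\<^sup>2 \<le> K * (hw \<tau> x)\<^sup>2"
          unfolding hw_proj_sq[OF x0] using Ks(1)[of x] x by (intro mult_right_mono) auto
        then have "ennreal ((hw \<tau> (proj x))\<^sup>2) \<le> ennreal K * ennreal ((hw \<tau> x)\<^sup>2)"
          using K by (simp add: ennreal_mult'[symmetric] ennreal_leI)
        then have "g (proj x) \<le> (ennreal (C1 powr p) * sq_fun p (\<lambda>j. strong_max \<kappa> (F j)) x) * (ennreal K * ennreal ((hw \<tau> x)\<^sup>2))"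
          by (intro order.trans[OF gle] mult_mono a) auto
        also have "\<dots> = ennreal (K * C1 powr p) * (sq_fun p (\<lambda>j. strong_max \<kappa> (F j)) x * ennreal ((hw \<tau> x)\<^sup>2))"
          using K by (simp add: ennreal_mult mult_ac)
        finally show ?thesis using True by simp
      qed simp
    qed auto
    also have "\<dots> = ennreal (real ?n) * (ennreal (K * C1 powr p) * sq_integral lborel p (\<lambda>x. ennreal ((hw \<tau> x)\<^sup>2)) (\<lambda>j. strong_max \<kappa> (F j)))"
      by (subst nn_integral_cmult) auto
    also have "\<dots> \<le> ennreal (real ?n) * (ennreal (K * C1 powr p) * (ennreal C2 * sq_integral lborel p (\<lambda>x. ennreal ((hw \<tau> x)\<^sup>2)) F))"
      by (intro mult_left_mono C2 F) auto
    also have "sq_integral lborel p (\<lambda>x. ennreal ((hw \<tau> x)\<^sup>2)) F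
        \<le> (\<integral>\<^sup>+x. ennreal K * (H (proj x) * indicator (annulus 1 10) x) \<partial>lborel)"
    proof (rule nn_integral_mono)
      fix x :: "real^'n"
      show "sq_fun p F x * ennreal ((hw \<tau> x)\<^sup>2) \<le> ennreal K * (H (proj x) * indicator (annulus 1 10) x)"
      proof (cases "x \<in> annulus 1 10")
        case True
        then have x: "1 < norm x" "norm x \<le> 10" by (auto simp: annulus_def)
        then have x0: "x \<noteq> 0" by auto
        have "(F j x)\<^sup>2 = ennreal ((f j (proj x))\<^sup>2)" for j
          using True by (simp add: F_def lift_def power2_eq_square flip: ennreal_mult)
        then have sF: "(\<Sum>j. (F j x)\<^sup>2) = (\<Sum>j. ennreal ((f j (proj x))\<^sup>2))" by simp
        have "norm x powr (2 * (\<Sum>i\<in>UNIV. \<tau> $ i)) * norm x powr (- 2 * (\<Sum>i\<in>UNIV. \<tau> $ i)) = 1"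
          using x0 by (simp flip: powr_add)
        then have "(hw \<tau> x)\<^sup>2 = norm x powr (2 * (\<Sum>i\<in>UNIV. \<tau> $ i)) * (hw \<tau> (proj x))\<^sup>2"
          unfolding hw_proj_sq[OF x0] by (simp add: mult.assoc[symmetric])
        also have "\<dots> \<le> K * (hw \<tau> (proj x))\<^sup>2" using Ks(2)[OF x] by (intro mult_right_mono) auto
        finally have "ennreal ((hw \<tau> x)\<^sup>2) \<le> ennreal K * ennreal ((hw \<tau> (proj x))\<^sup>2)"
          using K by (simp add: ennreal_mult'[symmetric] ennreal_leI)
        then have "sq_fun p F x * ennreal ((hw \<tau> x)\<^sup>2) \<le> sq_fun p F x * (ennreal K * ennreal ((hw \<tau> (proj x))\<^sup>2))"
          by (rule mult_left_mono) simp
        then show ?thesis using True unfolding sF H_def by (simp add: mult_ac)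
      next
        case False
        then show ?thesis using p by (simp add: F_def lift_def)
      qed
    qed
    also have "(\<integral>\<^sup>+x. ennreal K * (H (proj x) * indicator (annulus 1 10) x) \<partial>lborel) = ennreal K * (\<integral>\<^sup>+x. H (proj x) * indicator (annulus 1 10) x \<partial>lborel)"
      using homogeneous_measurable[OF H, of "annulus 1 10"] by (intro nn_integral_cmult) (auto simp: annulus_def)
    also have "(\<integral>\<^sup>+x. H (proj x) * indicator (annulus 1 10) x \<partial>lborel) = ennreal ((10 ^ ?n - 1) / real ?n) * (\<integral>\<^sup>+x. H x \<partial>sph_measure)"
    proof -
      have "ennreal (1 / real ?n) * (ennreal (real ?n) * (\<integral>\<^sup>+x. H (proj x) * indicator (annulus 1 10) x \<partial>lborel))
        = ennreal (1 / real ?n) * (ennreal (10 ^ ?n - 1 ^ ?n) * (\<integral>\<^sup>+x. H x \<partial>sph_measure))"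
        by (subst nn_integral_annulus[OF H]) auto
      then show ?thesis by (simp add: mult.assoc[symmetric] ennreal_mult'[symmetric])
    qed
    finally have "(\<integral>\<^sup>+x. g x \<partial>sph_measure) \<le> ennreal (real ?n) * (ennreal (K * C1 powr p) * (ennreal C2 * (ennreal K * (ennreal ((10 ^ ?n - 1) / real ?n) * (\<integral>\<^sup>+x. H x \<partial>sph_measure)))))"
      by (simp add: mult_left_mono)
    also have "\<dots> = ennreal c * (\<integral>\<^sup>+x. H x \<partial>sph_measure)"
      using K C1(1) C2(1) by (simp add: c_def mult.assoc[symmetric] ennreal_mult'[symmetric])
    finally show "(\<integral>\<^sup>+x. g x \<partial>sph_measure) \<le> ennreal c * (\<integral>\<^sup>+x. enn_powr (\<Sum>j. ennreal ((f j x)^2)) (p/2) * ennreal ((hw \<tau> x)^2) \<partial>sph_measure)"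
      by (simp add: H_def)
  qed
  have pw: "enn_powr (enn_powr z (1/2)) p = enn_powr z (p/2)" for z using p by (simp add: enn_powr_powr)
  show ?thesis
  proof (intro exI[of _ "c powr (1/p)"] allI impI)
    fix f :: "nat \<Rightarrow> real^'n \<Rightarrow> real" assume "\<forall>j. f j \<in> borel_measurable sph_measure"
    then have "enn_powr (\<integral>\<^sup>+x. enn_powr (\<Sum>j. (M_kappa \<kappa> (f j) x)^2) (p/2) * ennreal ((hw \<tau> x)^2) \<partial>sph_measure) (1/p)
      \<le> enn_powr (ennreal c * (\<integral>\<^sup>+x. enn_powr (\<Sum>j. ennreal ((f j x)^2)) (p/2) * ennreal ((hw \<tau> x)^2) \<partial>sph_measure)) (1/p)"
      using p by (intro enn_powr_mono main) auto
    then show "wnorm \<tau> p (\<lambda>x. enn_powr (\<Sum>j. (M_kappa \<kappa> (f j) x)^2) (1/2))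
             \<le> ennreal (c powr (1/p)) * wnorm \<tau> p (\<lambda>x. enn_powr (\<Sum>j. ennreal ((f j x)^2)) (1/2))"
      unfolding wnorm_def pw using p c by (simp add: enn_powr_mult)
  qed
qed

end
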